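(* Let $\mathbb{K}$ be a subfield of $\mathbb{C}$, $p\ge1$, and $A_1,\dots,A_p,n_1,\dots,n_p,r_1,\dots,r_p$ non-negative integers. Let $P\in\mathbb{K}[k_1,\dots,k_p]$ satisfy $\sum_{i=1}^j\deg_{k_i}P\le D_j$ for every $j\in\{1,\dots,p\}$, where $D_j=\big(\sum_{i=1}^jA_i(n_i+1)\big)-j-1$. Let $R=P/\prod_{i=1}^p(k_i+r_i)_{n_i+1}^{A_i}$ and $S=\sum_{k_1\ge\dots\ge k_p\ge1}R(k_1,\dots,k_p)$. Then there exists an admissible representation $(\lambda[s_1,\dots,s_q])$ of $S$ (as defined in the context) such that for all positive integers $s_1,\dots,s_p$, $$\lambda[s_1,\dots,s_p]=\sum_{j_1=0}^{n_1}\cdots\sum_{j_p=0}^{n_p}C[(s_1,\dots,s_p),(j_1,\dots,j_p)].$$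
   Context: $(k)_\alpha=k(k+1)\cdots(k+\alpha-1)$; $\zeta(s_1,\dots,s_q)=\sum_{k_1>\dots>k_q\ge1}k_1^{-s_1}\cdots k_q^{-s_q}$ for $s_1\ge2$, $s_i\ge1$, with $\zeta(\emptyset)=1$. Partial fractions: $R$ can be written uniquely as a $\mathbb{K}$-linear combination of products $u_1\cdots u_p$ where each $u_i$ is either a monomial $k_i^{f}$ ($f\ge0$) or $(k_i+r_i+j)^{-s}$ with $0\le j\le n_i$, $1\le s\le A_i$. For positive integers $s_i$ and integers $j_i$, $C[(s_1,\dots,s_p),(j_1,\dots,j_p)]$ denotes the coefficient of $\prod_{i=1}^p(k_i+r_i+j_i)^{-s_i}$ in this expansion (zero if some $s_i>A_i$ or some $j_i\notin\{0,\dots,n_i\}$). Admissible representation: a family of coefficients $\lambda[s_1,\dots,s_q]\in\mathbb{K}$, indexed by tuples of positive integers with $0\le q\le p$ and $s_1\ge2$ when $q\ge1$, only finitely many nonzero, such that $S=\sum\lambda[s_1,\dots,s_q]\zeta(s_1,\dots,s_q)$ and such that whenever $\lambda[s_1,\dots,s_q]\ne0$ with $q\ge1$: (a) there exist integers $1=\ell_0<\ell_1<\dots<\ell_q=p+1$ with $s_j\le A_{\ell_{j-1}}+A_{\ell_{j-1}+1}+\dots+A_{\ell_j-1}$ for every $j\in\{1,\dots,q\}$; (b) if moreover $r_i\ge r_{i+1}+n_{i+1}+1$ for all $i\in\{1,\dots,p-1\}$, then there exist $1\le i_1<\dots<i_q\le p$ with $1\le s_\ell\le A_{i_\ell}$ for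 every $\ell$, and the number of $\ell$ with $s_\ell=1$ is at most the number of $i\in\{1,\dots,p\}$ with $\deg_{k_i}P\ge A_i(n_i+1)-1$. The coefficients $\lambda[s_1,\dots,s_p]$ (tuples of length $p$) form the depth $p$ part. *)

theory Defs
  imports
    "HOL-Analysis.Analysis"
    "HOL-Library.Poly_Mapping"
    "HOL-Algebra.Algebraic_Closure_Type"
begin

text \<open>
  All indices are shifted to start at 0: the variables are \<open>k\<^sub>0, \<dots>, k\<^sub>p\<^sub>-\<^sub>1\<close>, and the
  parameters \<open>A\<close>, \<open>n\<close>, \<open>r\<close> are functions of which only the values at \<open>i < p\<close> matter.
  Tuples are lists.
\<close>

section \<open>Multivariate polynomials\<close>

text \<open>A monomial is a finitely supported map from variable indices to exponents.\<close>

type_synonym mpoly = "(nat \<Rightarrow>\<^sub>0 nat) \<Rightarrow>\<^sub>0 complex"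

definition mpolys :: "complex set \<Rightarrow> nat \<Rightarrow> mpoly set" where
  "mpolys K p = {P. (\<forall>m. Poly_Mapping.lookup P m \<in> K) \<and>
     (\<forall>m\<in>Poly_Mapping.keys P. Poly_Mapping.keys m \<subseteq> {..<p})}"

definition mpoly_eval :: "mpoly \<Rightarrow> complex list \<Rightarrow> complex" where
  "mpoly_eval P x = (\<Sum>m\<in>Poly_Mapping.keys P. Poly_Mapping.lookup P m *
     (\<Prod>i\<in>Poly_Mapping.keys m. (x ! i) ^ Poly_Mapping.lookup m i))"

text \<open>The degree in the \<open>i\<close>-th variable, which is \<open>-\<infinity>\<close> for the zero polynomial.\<close>

definition mdeg :: "nat \<Rightarrow> mpoly \<Rightarrow> ereal" where
  "mdeg i P = (SUP m\<in>Poly_Mapping.keys P. ereal (real (Poly_Mapping.lookup m i)))"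

definition deg_bound :: "(nat \<Rightarrow> nat) \<Rightarrow> (nat \<Rightarrow> nat) \<Rightarrow> nat \<Rightarrow> int" where
  "deg_bound A n j = (\<Sum>i<j. int (A i * (n i + 1))) - int j - 1"

section \<open>The rational function and its partial fraction expansion\<close>

definition ratfun ::
  "nat \<Rightarrow> (nat \<Rightarrow> nat) \<Rightarrow> (nat \<Rightarrow> nat) \<Rightarrow> (nat \<Rightarrow> nat) \<Rightarrow> mpoly \<Rightarrow> complex list \<Rightarrow> complex" where
  "ratfun p A n r P x =
     mpoly_eval P x / (\<Prod>i<p. pochhammer (x ! i + of_nat (r i)) (n i + 1) ^ A i)"

text \<open>\<open>Monomial f\<close> stands for \<open>k\<^sub>i\<^sup>f\<close> and \<open>Pole j s\<close> for \<open>(k\<^sub>i + r\<^sub>i + j)\<^sup>-\<^sup>s\<close>.\<close>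

datatype pf_factor = Monomial nat | Pole nat nat

fun factor_eval :: "nat \<Rightarrow> pf_factor \<Rightarrow> complex \<Rightarrow> complex" where
  "factor_eval r (Monomial f) x = x ^ f"
| "factor_eval r (Pole j s) x = 1 / (x + of_nat r + of_nat j) ^ s"

fun factor_ok :: "nat \<Rightarrow> nat \<Rightarrow> pf_factor \<Rightarrow> bool" where
  "factor_ok a n (Monomial f) \<longleftrightarrow> True"
| "factor_ok a n (Pole j s) \<longleftrightarrow> j \<le> n \<and> 1 \<le> s \<and> s \<le> a"

text \<open>
  A list \<open>u\<close> of length \<open>p\<close> stands for the product \<open>u\<^sub>0(k\<^sub>0) \<cdots> u\<^sub>p\<^sub>-\<^sub>1(k\<^sub>p\<^sub>-\<^sub>1)\<close>. The identity of rational
  functions is expressed as equality at all complex points outside the hyperplanes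
  \<open>k\<^sub>i + r\<^sub>i + j = 0\<close>, so that division by zero plays no role.
\<close>

definition is_pf_expansion ::
  "complex set \<Rightarrow> nat \<Rightarrow> (nat \<Rightarrow> nat) \<Rightarrow> (nat \<Rightarrow> nat) \<Rightarrow> (nat \<Rightarrow> nat) \<Rightarrow> mpoly
    \<Rightarrow> (pf_factor list \<Rightarrow>\<^sub>0 complex) \<Rightarrow> bool" where
  "is_pf_expansion K p A n r P c \<longleftrightarrow>
     (\<forall>u. Poly_Mapping.lookup c u \<in> K) \<and>
     (\<forall>u\<in>Poly_Mapping.keys c. length u = p \<and> (\<forall>i<p. factor_ok (A i) (n i) (u ! i))) \<and>
     (\<forall>x. length x = p \<and> (\<forall>i<p. \<forall>j\<le>n i. x ! i + of_nat (r i) + of_nat j \<noteq> 0) \<longrightarrow>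
        ratfun p A n r P x =
          (\<Sum>u\<in>Poly_Mapping.keys c. Poly_Mapping.lookup c u *
             (\<Prod>i<p. factor_eval (r i) (u ! i) (x ! i))))"

text \<open>
  Arguments \<open>s\<close>, \<open>j\<close> of \<open>pf_coeff\<close> are lists of length \<open>p\<close>. The coefficient is zero for
  inadmissible \<open>s\<close>, \<open>j\<close>, since the support of an expansion is restricted.
\<close>

definition pf_coeff ::
  "complex set \<Rightarrow> nat \<Rightarrow> (nat \<Rightarrow> nat) \<Rightarrow> (nat \<Rightarrow> nat) \<Rightarrow> (nat \<Rightarrow> nat) \<Rightarrow> mpoly
    \<Rightarrow> nat list \<Rightarrow> nat list \<Rightarrow> complex" where
  "pf_coeff K p A n r P s j =
     Poly_Mapping.lookup (THE c. is_pf_expansion K p A n r P c) (map2 Pole j s)"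

section \<open>Multiple series and multiple zeta values\<close>

definition series_index :: "nat \<Rightarrow> nat list set" where
  "series_index p = {k. length k = p \<and> sorted_wrt (\<ge>) k \<and> (\<forall>x\<in>set k. 1 \<le> x)}"

definition series_term ::
  "nat \<Rightarrow> (nat \<Rightarrow> nat) \<Rightarrow> (nat \<Rightarrow> nat) \<Rightarrow> (nat \<Rightarrow> nat) \<Rightarrow> mpoly \<Rightarrow> nat list \<Rightarrow> complex" where
  "series_term p A n r P k = ratfun p A n r P (map of_nat k)"

definition mzv :: "nat list \<Rightarrow> complex" where
  "mzv s = (\<Sum>\<^sub>\<infinity>k\<in>{k. length k = length s \<and> sorted_wrt (>) k \<and> (\<forall>x\<in>set k. 1 \<le> x)}.
              (\<Prod>i<length s. 1 / of_nat (k ! i) ^ (s ! i)))"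

lemma mzv_Nil: "mzv [] = 1"
proof -
  have "{k :: nat list. length k = length ([] :: nat list) \<and> sorted_wrt (>) k \<and> (\<forall>x\<in>set k. 1 \<le> x)} = {[]}"
    by auto
  then show ?thesis by (simp add: mzv_def)
qed

section \<open>Admissible representations\<close>

definition index_ok :: "nat \<Rightarrow> nat list \<Rightarrow> bool" where
  "index_ok p s \<longleftrightarrow> length s \<le> p \<and> (\<forall>x\<in>set s. 1 \<le> x) \<and> (s \<noteq> [] \<longrightarrow> 2 \<le> s ! 0)"

definition cond_a :: "nat \<Rightarrow> (nat \<Rightarrow> nat) \<Rightarrow> nat list \<Rightarrow> bool" where
  "cond_a p A s \<longleftrightarrow>
     (\<exists>l :: nat \<Rightarrow> nat. l 0 = 0 \<and> l (length s) = p \<and>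
        (\<forall>j<length s. l j < l (Suc j) \<and> s ! j \<le> (\<Sum>i\<in>{l j..<l (Suc j)}. A i)))"

definition cond_b ::
  "nat \<Rightarrow> (nat \<Rightarrow> nat) \<Rightarrow> (nat \<Rightarrow> nat) \<Rightarrow> (nat \<Rightarrow> nat) \<Rightarrow> mpoly \<Rightarrow> nat list \<Rightarrow> bool" where
  "cond_b p A n r P s \<longleftrightarrow>
     ((\<forall>i. Suc i < p \<longrightarrow> r i \<ge> r (Suc i) + n (Suc i) + 1) \<longrightarrow>
        (\<exists>h :: nat \<Rightarrow> nat. strict_mono_on {..<length s} h \<and>
           (\<forall>l<length s. h l < p \<and> 1 \<le> s ! l \<and> s ! l \<le> A (h l))) \<and>
        card {l. l < length s \<and> s ! l = 1}
          \<le> card {i. i < p \<and> mdeg i P \<ge> ereal (real (A i * (n i + 1)) - 1)})"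

text \<open>The family of coefficients is extended by zero to all lists.\<close>

definition admissible_rep ::
  "complex set \<Rightarrow> nat \<Rightarrow> (nat \<Rightarrow> nat) \<Rightarrow> (nat \<Rightarrow> nat) \<Rightarrow> (nat \<Rightarrow> nat) \<Rightarrow> mpoly \<Rightarrow> complex
    \<Rightarrow> (nat list \<Rightarrow>\<^sub>0 complex) \<Rightarrow> bool" where
  "admissible_rep K p A n r P S lam \<longleftrightarrow>
     (\<forall>s. Poly_Mapping.lookup lam s \<in> K) \<and>
     (\<forall>s\<in>Poly_Mapping.keys lam. index_ok p s) \<and>
     S = (\<Sum>s\<in>Poly_Mapping.keys lam. Poly_Mapping.lookup lam s * mzv s) \<and>
     (\<forall>s\<in>Poly_Mapping.keys lam. s \<noteq> [] \<longrightarrow> cond_a p A s \<and> cond_b p A n r P s)"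

end

theory Submission
  imports Defs
begin

text \<open>
  By linearity \<open>P\<close> may be taken to be a monomial, so that \<open>R\<close> is a product of rational functions
  of one variable, and one sums over the innermost variable first. Every partial sum, as a function of
  the next variable \<open>k\<close>, is a combination of products of a power of \<open>k\<close> or a pole \<open>(k + b)\<^sup>-\<^sup>s\<close>
  with a strict harmonic sum \<open>H\<^sub>k\<^sub>-\<^sub>1(w)\<close>. A pole times a harmonic sum is summed by shifting
  the argument of the harmonic sum to \<open>k + b - 1\<close>; the shift only creates poles other than the one at
  \<open>- b\<close>, so orders are never added. They are added only when a pole of one variable meets a
  pole produced by the inner variables, which the hypothesis in (b) excludes. A power times a harmonic sum
  is summed by parts.

  Divergent words never appear because the powers of \<open>k\<close> stay controlled by the degree conditions,
  and because a rational function of degree at most \<open>- 2\<close> has residues with sum zero: it is a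
  combination of poles of order at least \<open>2\<close> and of differences of simple poles, and summing such a
  difference creates no new letter \<open>1\<close>. The latter also gives the bound on the number of ones in (b).
  A word of length \<open>p\<close> arises only by choosing a pole in every variable and discarding all
  corrections, whence the formula for the depth \<open>p\<close> part.
\<close>

text \<open>A partial sum contains divergent pieces, powers of \<open>k\<close> and harmonic sums
  whose word begins with 1, so it cannot be split into convergent series. All work is therefore done
  on finite sums, and the limit is taken after the outermost summation. That nothing divergent is
  left by then is a matter of degrees: if \<open>e i\<close> is the decay of the rational function
  in variable \<open>i\<close>, a summation turns a degree \<open>d\<close> into at most
  \<open>d - e i + 1\<close>, and the bounds \<open>D_j\<close> leave the outermost summand with
  degree at most -2 in front of every harmonic sum. Membership in a span of restricted generators
  carries the bounds on depth, degree and number of ones without naming coefficients. Only leading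
  terms are explicit: summing a pole of order \<open>s\<close> times \<open>hsum w\<close> gives
  \<open>hsum (s # w)\<close>, whatever the pole, plus words no longer than \<open>w\<close>.
  Subtracting this term isolates the depth \<open>p\<close> coefficients, and makes differences of
  simple poles harmless, as the two copies of \<open>hsum (1 # w)\<close> cancel. Products of poles
  and harmonic sums survive the last summation but tend to 0, since harmonic sums grow at most like
  powers of a logarithm.\<close>

locale complex_subfield =
  fixes K :: "complex set"
  assumes zero_closed [simp]: "0 \<in> K"
    and one_closed [simp]: "1 \<in> K"
    and add_closed: "x \<in> K \<Longrightarrow> y \<in> K \<Longrightarrow> x + y \<in> K"
    and uminus_closed: "x \<in> K \<Longrightarrow> - x \<in> K"
    and mult_closed: "x \<in> K \<Longrightarrow> y \<in> K \<Longrightarrow> x * y \<in> K"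
    and inverse_closed: "x \<in> K \<Longrightarrow> inverse x \<in> K"
begin

lemma diff_closed: "x \<in> K \<Longrightarrow> y \<in> K \<Longrightarrow> x - y \<in> K"
  using add_closed[OF _ uminus_closed, of x y] by simp

lemma divide_closed: "x \<in> K \<Longrightarrow> y \<in> K \<Longrightarrow> x / y \<in> K"
  using mult_closed[OF _ inverse_closed, of x y] by (simp add: divide_inverse)

lemma of_nat_closed [simp]: "of_nat n \<in> K"
  by (induction n) (auto intro: add_closed)

lemma power_closed: "x \<in> K \<Longrightarrow> x ^ n \<in> K"
  by (induction n) (auto intro: mult_closed)

lemma sum_closed: "(\<And>x. x \<in> A \<Longrightarrow> f x \<in> K) \<Longrightarrow> sum f A \<in> K"
  by (induction A rule: infinite_finite_induct) (auto intro: add_closed)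

lemma prod_closed: "(\<And>x. x \<in> A \<Longrightarrow> f x \<in> K) \<Longrightarrow> prod f A \<in> K"
  by (induction A rule: infinite_finite_induct) (auto intro: mult_closed)

end

text \<open>From here on the operations of the type \<open>complex\<close> replace those of the
  record \<open>ring_of_type_algebra\<close>. Closure under \<open>inverse\<close> includes the
  argument 0, where \<open>inverse 0 = 0\<close>.\<close>

lemma complex_subfieldI:
  assumes "subfield K (ring_of_type_algebra :: complex ring)"
  shows "complex_subfield K"
proof -
  interpret R: field "ring_of_type_algebra :: complex ring"
    by (rule field_from_type_algebra)
  interpret S: subfield K "ring_of_type_algebra :: complex ring" by (rule assms)
  let ?R = "ring_of_type_algebra :: complex ring"
  have sr: "subring K ?R" and u: "\<And>k. k \<in> K - {\<zero>\<^bsub>?R\<^esub>} \<Longrightarrow> inv\<^bsub>?R\<^esub> k \<in> K"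
    using R.subfield_m_inv(1)[OF assms] subfieldE(1)[OF assms] by auto
  have um: "- x \<in> K" if "x \<in> K" for x
  proof -
    have "\<ominus>\<^bsub>?R\<^esub> x \<in> K" using subringE(5)[OF sr that] .
    moreover have "\<ominus>\<^bsub>?R\<^esub> x = - x"
      using R.minus_equality[of "-x" x] by (simp add: ring_of_type_algebra_def)
    ultimately show ?thesis by simp
  qed
  have iv: "inverse x \<in> K" if "x \<in> K" for x
  proof (cases "x = 0")
    case False
    have "inv\<^bsub>?R\<^esub> x \<in> K" using u that False by (simp add: ring_of_type_algebra_def)
    moreover have "inv\<^bsub>?R\<^esub> x = inverse x"
      using R.inv_unique'[of x "inverse x"] False by (simp add: ring_of_type_algebra_def)
    ultimately show ?thesis by simp
  qed (use that in auto)
  show ?thesis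
  proof
    show "0 \<in> K" "1 \<in> K"
      using subringE(2,3)[OF sr] by (simp_all add: ring_of_type_algebra_def)
    show "x + y \<in> K" "x * y \<in> K" if "x \<in> K" "y \<in> K" for x y
      using subringE(6,7)[OF sr] that by (simp_all add: ring_of_type_algebra_def)
  qed (use um iv in auto)
qed

section \<open>Linear spans of functions\<close>

text \<open>Functions count only through their values on \<open>D\<close>, so identities with
  denominators have to hold only where no denominator vanishes. The inductive form avoids families
  of coefficients: closure properties and the action of linear operators become inductions over the
  generation of the span.\<close>

inductive_set kspan :: "complex set \<Rightarrow> 'a set \<Rightarrow> ('a \<Rightarrow> complex) set \<Rightarrow> ('a \<Rightarrow> complex) set"
  for K D S where
  kspan_zero: "(\<And>x. x \<in> D \<Longrightarrow> f x = 0) \<Longrightarrow> f \<in> kspan K D S"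
| kspan_step: "c \<in> K \<Longrightarrow> g \<in> S \<Longrightarrow> h \<in> kspan K D S \<Longrightarrow>
    (\<And>x. x \<in> D \<Longrightarrow> f x = c * g x + h x) \<Longrightarrow> f \<in> kspan K D S"

lemma kspan_cong:
  "f \<in> kspan K D S \<Longrightarrow> (\<And>x. x \<in> D \<Longrightarrow> f x = g x) \<Longrightarrow> g \<in> kspan K D S"
  by (induction arbitrary: g rule: kspan.induct) (auto intro: kspan.intros)

lemma kspan_mono: "f \<in> kspan K D S \<Longrightarrow> S \<subseteq> T \<Longrightarrow> f \<in> kspan K D T"
  by (induction rule: kspan.induct) (auto intro: kspan.intros)

lemma kspan_add:
  assumes "f \<in> kspan K D S" "g \<in> kspan K D S"
  shows "(\<lambda>x. f x + g x) \<in> kspan K D S"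
  using assms
proof (induction rule: kspan.induct)
  case (kspan_zero f)
  then show ?case by (intro kspan_cong[OF kspan_zero(2)]) simp
next
  case (kspan_step c u h f)
  show ?case
    by (rule kspan.kspan_step[OF kspan_step(1,2) kspan_step(5)[OF kspan_step(6)]])
       (simp add: kspan_step(4) add.assoc)
qed

context complex_subfield
begin

lemma kspan_base: "f \<in> S \<Longrightarrow> f \<in> kspan K D S"
  by (rule kspan_step[of 1 K f S "\<lambda>_. 0"]) (auto intro: kspan_zero)

text \<open>The hypothesis on \<open>\<Phi>\<close> says that it is linear as a map from functions on \<open>D\<close> to functions
  on \<open>D'\<close>.\<close>

lemma kspan_map:
  assumes "f \<in> kspan K D S"
    and "\<And>f. (\<And>x. x \<in> D \<Longrightarrow> f x = 0) \<Longrightarrow> (\<And>y. y \<in> D' \<Longrightarrow> \<Phi> f y = 0)"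
    and "\<And>f c g h. (\<And>x. x \<in> D \<Longrightarrow> f x = c * g x + h x) \<Longrightarrow>
      (\<And>y. y \<in> D' \<Longrightarrow> \<Phi> f y = c * \<Phi> g y + \<Phi> h y)"
    and "\<And>g. g \<in> S \<Longrightarrow> \<Phi> g \<in> kspan K D' T"
  shows "\<Phi> f \<in> kspan K D' T"
  using assms(1)
proof (induction rule: kspan.induct)
  case (kspan_zero f)
  then show ?case by (intro kspan.kspan_zero assms(2)) auto
next
  case (kspan_step c g h f)
  \<comment> \<open>Closure under scalars is proved on the spot, since the general rule
    \<open>kspan_scale\<close> is itself deduced from this lemma.\<close>
  have sc: "(\<lambda>y. c * u y) \<in> kspan K D' T" if "u \<in> kspan K D' T" for u
    using that
  proof (induction rule: kspan.induct)
    case (kspan_step c' g' h' f')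
    show ?case
      by (rule kspan.kspan_step[OF mult_closed[OF \<open>c \<in> K\<close> kspan_step(1)] kspan_step(2,5)])
         (simp add: kspan_step(4) distrib_left)
  qed (auto intro: kspan.kspan_zero)
  show ?case
    by (rule kspan_cong[OF kspan_add[OF sc[OF assms(4)[OF kspan_step(2)]] kspan_step(5)]])
       (simp add: assms(3)[OF kspan_step(4)])
qed

lemma kspan_trans: "f \<in> kspan K D S \<Longrightarrow> (\<And>g. g \<in> S \<Longrightarrow> g \<in> kspan K D T) \<Longrightarrow> f \<in> kspan K D T"
  by (erule kspan_map[where \<Phi> = "\<lambda>f. f"]) auto

lemma kspan_mult:
  "f \<in> kspan K D S \<Longrightarrow> (\<And>g. g \<in> S \<Longrightarrow> (\<lambda>x. g x * h x) \<in> kspan K D T) \<Longrightarrow>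
    (\<lambda>x. f x * h x) \<in> kspan K D T"
  by (erule kspan_map[where \<Phi> = "\<lambda>f x. f x * h x"]) (auto simp: algebra_simps)

lemma kspan_scale:
  assumes "c \<in> K" "f \<in> kspan K D S"
  shows "(\<lambda>x. c * f x) \<in> kspan K D S"
proof (rule kspan_map[OF assms(2), where \<Phi> = "\<lambda>f x. c * f x"])
  show "(\<lambda>x. c * g x) \<in> kspan K D S" if "g \<in> S" for g
    by (rule kspan_step[OF assms(1) that, of "\<lambda>_. 0"]) (auto intro: kspan_zero)
qed (simp_all add: distrib_left mult.left_commute)

lemma kspan_diff:
  assumes "f \<in> kspan K D S" "g \<in> kspan K D S"
  shows "(\<lambda>x. f x - g x) \<in> kspan K D S"
  using kspan_add[OF assms(1) kspan_scale[OF uminus_closed[OF one_closed] assms(2)]] by simp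

lemma kspan_sum:
  "(\<And>i. i \<in> I \<Longrightarrow> f i \<in> kspan K D S) \<Longrightarrow> (\<lambda>x. \<Sum>i\<in>I. f i x) \<in> kspan K D S"
  by (induction I rule: infinite_finite_induct) (auto intro: kspan_add kspan_zero)

section \<open>Partial fractions in one variable\<close>

text \<open>For u = x + a and v = x + b the identity 1/(uv) = (1/u - 1/v)/(b - a) lowers one of the
  two orders at each use, and no order ever grows. Single simple poles can only come from 1/(uv)
  itself, hence as a difference; this is why \<open>A\<close> and \<open>B\<close> start at order 2
  and \<open>AB\<close> speaks of a difference.\<close>

lemma kspan_pole_prod:
  assumes "a \<noteq> b" "1 \<le> s" "1 \<le> t"
    and D: "\<And>x. x \<in> D \<Longrightarrow> \<xi> x + of_nat a \<noteq> 0 \<and> \<xi> x + of_nat b \<noteq> 0"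
    and A: "\<And>i. 2 \<le> i \<Longrightarrow> i \<le> s \<Longrightarrow> (\<lambda>x. 1 / (\<xi> x + of_nat a) ^ i * h x) \<in> kspan K D S"
    and B: "\<And>i. 2 \<le> i \<Longrightarrow> i \<le> t \<Longrightarrow> (\<lambda>x. 1 / (\<xi> x + of_nat b) ^ i * h x) \<in> kspan K D S"
    and AB: "(\<lambda>x. 1 / (\<xi> x + of_nat a) * h x - 1 / (\<xi> x + of_nat b) * h x) \<in> kspan K D S"
  shows "(\<lambda>x. 1 / (\<xi> x + of_nat a) ^ s * (1 / (\<xi> x + of_nat b) ^ t) * h x) \<in> kspan K D S"
  using assms(2,3) A B
proof (induction "s + t" arbitrary: s t rule: less_induct)
  case less
  let ?f = "\<lambda>s t x. 1 / (\<xi> x + of_nat a) ^ s * (1 / (\<xi> x + of_nat b) ^ t) * h x"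
  define d :: complex where "d = 1 / (of_nat b - of_nat a)"
  have dK: "d \<in> K" unfolding d_def by (intro divide_closed diff_closed) auto
  obtain s' t' where st: "s = Suc s'" "t = Suc t'"
    using less.prems by (metis Suc_le_D One_nat_def)
  have eq: "d * (?f s t' x - ?f s' t x) = ?f s t x" if "x \<in> D" for x
  proof -
    define u v where "u = \<xi> x + of_nat a" and "v = \<xi> x + of_nat b"
    have nz: "u \<noteq> 0" "v \<noteq> 0" and d: "d * (v - u) = 1"
      using D[OF that] assms(1) by (auto simp: u_def v_def d_def)
    have "d * (p ^ s * q ^ t' * z - p ^ s' * q ^ t * z) = p ^ s' * q ^ t' * z * (d * (p - q))"
      for p q z by (simp add: st algebra_simps)
    from this[of "1 / u" "1 / v" "h x"]
    have "d * (?f s t' x - ?f s' t x) = (1 / u) ^ s' * (1 / v) ^ t' * h x * (d * (1 / u - 1 / v))"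
      by (simp only: u_def v_def power_one_over)
    also have "d * (1 / u - 1 / v) = d * (v - u) * (1 / u * (1 / v))"
      using nz by (simp add: field_simps)
    finally show ?thesis using d by (simp add: st u_def v_def power_one_over)
  qed
  show ?case
  proof (cases "s' = 0 \<and> t' = 0")
    case True
    show ?thesis
      by (rule kspan_cong[OF kspan_scale[OF dK AB]]) (use eq True st in auto)
  next
    case False
    have "?f s t' \<in> kspan K D S"
    proof (cases "t' = 0")
      case True
      then show ?thesis using False less.prems(3)[of s] st by simp
    next
      case False
      then show ?thesis using st less.prems by (intro less.hyps) auto
    qed
    moreover have "?f s' t \<in> kspan K D S"
    proof (cases "s' = 0")
      case True
      then show ?thesis using False less.prems(4)[of t] st by simp
    next
      case False
      then show ?thesis using st less.prems by (intro less.hyps) auto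
    qed
    ultimately have "(\<lambda>x. d * (?f s t' x - ?f s' t x)) \<in> kspan K D S"
      by (intro kspan_scale kspan_diff dK)
    then show ?thesis by (rule kspan_cong) (use eq in auto)
  qed
qed

text \<open>Division with remainder, one factor at a time: x/(x + a)^t = 1/(x + a)^(t-1) - a/(x +
  a)^t.\<close>

lemma kspan_power_pole:
  assumes D: "\<And>x. x \<in> D \<Longrightarrow> \<xi> x + of_nat a \<noteq> 0"
    and P: "\<And>i. i + t \<le> q \<Longrightarrow> (\<lambda>x. \<xi> x ^ i * h x) \<in> kspan K D S"
    and A: "\<And>i. 1 \<le> i \<Longrightarrow> i \<le> t \<Longrightarrow> (\<lambda>x. 1 / (\<xi> x + of_nat a) ^ i * h x) \<in> kspan K D S"
  shows "(\<lambda>x. \<xi> x ^ q * (1 / (\<xi> x + of_nat a) ^ t) * h x) \<in> kspan K D S"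
  using P A
proof (induction q arbitrary: t)
  case 0
  then show ?case
    by (cases "t = 0") auto
next
  case (Suc q)
  show ?case
  proof (cases t)
    case 0
    then show ?thesis using Suc.prems(1)[of "Suc q"] by simp
  next
    case (Suc t')
    have "(\<lambda>x. \<xi> x ^ q * (1 / (\<xi> x + of_nat a) ^ t') * h x) \<in> kspan K D S"
      using Suc Suc.prems by (intro Suc.IH) auto
    moreover have "(\<lambda>x. \<xi> x ^ q * (1 / (\<xi> x + of_nat a) ^ t) * h x) \<in> kspan K D S"
      using Suc.prems by (intro Suc.IH) auto
    ultimately have "(\<lambda>x. \<xi> x ^ q * (1 / (\<xi> x + of_nat a) ^ t') * h x -
        of_nat a * (\<xi> x ^ q * (1 / (\<xi> x + of_nat a) ^ t) * h x)) \<in> kspan K D S"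
      by (intro kspan_diff kspan_scale) auto
    then show ?thesis
    proof (rule kspan_cong)
      fix x assume "x \<in> D"
      define u where "u = \<xi> x + of_nat a"
      have "\<xi> x ^ q * (u * w) * h x - of_nat a * (\<xi> x ^ q * w * h x) = \<xi> x ^ Suc q * w * h x" for w
        by (simp add: u_def algebra_simps)
      from this[of "1 / u ^ t"]
      have "\<xi> x ^ q * (1 / u ^ t') * h x - of_nat a * (\<xi> x ^ q * (1 / u ^ t) * h x) =
          \<xi> x ^ Suc q * (1 / u ^ t) * h x"
        using D[OF \<open>x \<in> D\<close>] by (simp add: Suc u_def)
      then show "\<xi> x ^ q * (1 / (\<xi> x + of_nat a) ^ t') * h x -
          of_nat a * (\<xi> x ^ q * (1 / (\<xi> x + of_nat a) ^ t) * h x) =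
          \<xi> x ^ Suc q * (1 / (\<xi> x + of_nat a) ^ t) * h x"
        unfolding u_def .
    qed
  qed
qed

end

text \<open>Here \<open>\<delta>\<close> is the degree of the rational function and
  \<open>\<alpha>\<close> bounds its pole orders. If \<open>\<delta>\<close> is at most -2 the
  residues have sum zero, so simple poles are offered only through \<open>pair\<close>. The variable
  is a function \<open>\<xi>\<close> because it is later the identity, for the expansion of the
  rational function, or \<open>pt\<close>, for summation.\<close>

inductive_set pf_gens :: "('a \<Rightarrow> complex) \<Rightarrow> (nat \<Rightarrow> nat) \<Rightarrow> int \<Rightarrow> ('a \<Rightarrow> complex) set"
  for \<xi> \<alpha> \<delta> where
  power: "int q \<le> \<delta> \<Longrightarrow> (\<lambda>x. \<xi> x ^ q) \<in> pf_gens \<xi> \<alpha> \<delta>"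
| pole: "1 \<le> s \<Longrightarrow> s \<le> \<alpha> a \<Longrightarrow> (s = 1 \<Longrightarrow> - 1 \<le> \<delta>) \<Longrightarrow>
    (\<lambda>x. 1 / (\<xi> x + of_nat a) ^ s) \<in> pf_gens \<xi> \<alpha> \<delta>"
| pair: "1 \<le> \<alpha> a \<Longrightarrow> 1 \<le> \<alpha> b \<Longrightarrow>
    (\<lambda>x. 1 / (\<xi> x + of_nat a) - 1 / (\<xi> x + of_nat b)) \<in> pf_gens \<xi> \<alpha> \<delta>"

context complex_subfield
begin

lemma kspan_pf_pole_step:
  assumes D: "\<And>x c. x \<in> D \<Longrightarrow> 1 \<le> \<alpha> c \<Longrightarrow> \<xi> x + of_nat c \<noteq> 0"
    and "1 \<le> s" "s \<le> \<beta> b"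
    and \<alpha>: "\<And>c. \<beta> c + (if c = a then 1 else 0) \<le> \<alpha> c"
  shows "(\<lambda>x. 1 / (\<xi> x + of_nat b) ^ s * (1 / (\<xi> x + of_nat a))) \<in> kspan K D (pf_gens \<xi> \<alpha> \<delta>)"
proof (cases "a = b")
  case True
  have "(\<lambda>x. 1 / (\<xi> x + of_nat b) ^ Suc s) \<in> kspan K D (pf_gens \<xi> \<alpha> \<delta>)"
    using assms(2,3) \<alpha>[of b] True by (intro kspan_base pf_gens.pole) auto
  then show ?thesis by (rule kspan_cong) (auto simp: True)
next
  case False
  have ab: "s \<le> \<alpha> b" "1 \<le> \<alpha> b" "1 \<le> \<alpha> a"
    using \<alpha>[of a] \<alpha>[of b] assms(2,3) by (auto split: if_splits)
  have "(\<lambda>x. 1 / (\<xi> x + of_nat b) ^ s * (1 / (\<xi> x + of_nat a) ^ 1) * 1) \<in>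
      kspan K D (pf_gens \<xi> \<alpha> \<delta>)"
  proof (rule kspan_pole_prod)
    show "(\<lambda>x. 1 / (\<xi> x + of_nat b) ^ i * 1) \<in> kspan K D (pf_gens \<xi> \<alpha> \<delta>)"
      if "2 \<le> i" "i \<le> s" for i
      using that ab unfolding mult_1_right by (intro kspan_base pf_gens.pole) auto
    show "(\<lambda>x. 1 / (\<xi> x + of_nat b) * 1 - 1 / (\<xi> x + of_nat a) * 1) \<in> kspan K D (pf_gens \<xi> \<alpha> \<delta>)"
      using ab unfolding mult_1_right by (intro kspan_base pf_gens.pair)
  qed (use False assms(2) ab D in auto)
  then show ?thesis by (rule kspan_cong) simp
qed

text \<open>Linear factors are divided out one by one. A power divided by x + a may leave a single
  simple pole, but then the degree reached is still at least -1; each further factor turns poles and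
  pairs into poles of order at least 2 and pairs.\<close>

lemma kspan_partial_fractions:
  assumes D: "\<And>x c. x \<in> D \<Longrightarrow> c \<in> set as \<Longrightarrow> \<xi> x + of_nat c \<noteq> 0"
  shows "(\<lambda>x. \<xi> x ^ m / (\<Prod>a\<leftarrow>as. \<xi> x + of_nat a)) \<in>
    kspan K D (pf_gens \<xi> (count_list as) (int m - int (length as)))"
  using D
proof (induction as)
  case Nil
  have "(\<lambda>x. \<xi> x ^ m) \<in> kspan K D (pf_gens \<xi> (count_list []) (int m - int (length [])))"
    by (intro kspan_base pf_gens.power) auto
  then show ?case by (rule kspan_cong) simp
next
  case (Cons a as)
  let ?\<alpha> = "count_list (a # as)"
  let ?\<delta> = "int m - int (length (a # as))"
  let ?T = "kspan K D (pf_gens \<xi> ?\<alpha> ?\<delta>)"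
  have D': "\<xi> x + of_nat c \<noteq> 0" if "x \<in> D" "1 \<le> ?\<alpha> c" for x c
    using Cons.prems[of x c] that count_list_0_iff[of "a # as" c] by (auto simp del: count_list.simps)
  have *: "(\<lambda>x. 1 / (\<xi> x + of_nat b) ^ s * (1 / (\<xi> x + of_nat a))) \<in> ?T"
    if "1 \<le> s" "s \<le> count_list as b" for b s
    by (rule kspan_pf_pole_step[where \<beta> = "count_list as"]) (use that D' in auto)
  have "(\<lambda>x. \<xi> x ^ m / (\<Prod>a\<leftarrow>as. \<xi> x + of_nat a) * (1 / (\<xi> x + of_nat a))) \<in> ?T"
  proof (rule kspan_mult[OF Cons.IH])
    fix g assume "g \<in> pf_gens \<xi> (count_list as) (int m - int (length as))"
    then show "(\<lambda>x. g x * (1 / (\<xi> x + of_nat a))) \<in> ?T"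
    proof cases
      case (power q)
      have "(\<lambda>x. \<xi> x ^ q * (1 / (\<xi> x + of_nat a) ^ 1) * 1) \<in> ?T"
      proof (rule kspan_power_pole)
        show "(\<lambda>x. \<xi> x ^ i * 1) \<in> ?T" if "i + 1 \<le> q" for i
          using that power unfolding mult_1_right by (intro kspan_base pf_gens.power) auto
        show "(\<lambda>x. 1 / (\<xi> x + of_nat a) ^ i * 1) \<in> ?T" if "1 \<le> i" "i \<le> 1" for i
          using that power unfolding mult_1_right by (intro kspan_base pf_gens.pole) auto
      qed (use Cons.prems in auto)
      then show ?thesis by (rule kspan_cong) (simp add: power)
    next
      case (pole s b)
      then show ?thesis unfolding pole(1) by (intro *)
    next
      case (pair b c)
      have "(\<lambda>x. 1 / (\<xi> x + of_nat b) ^ 1 * (1 / (\<xi> x + of_nat a)) -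
          1 / (\<xi> x + of_nat c) ^ 1 * (1 / (\<xi> x + of_nat a))) \<in> ?T"
        by (intro kspan_diff *) (use pair in auto)
      then show ?thesis by (rule kspan_cong) (simp add: pair algebra_simps)
    qed
  qed (use Cons.prems in auto)
  then show ?case by (rule kspan_cong) simp
qed

end

section \<open>Multiple harmonic sums\<close>

primrec hsum :: "nat list \<Rightarrow> nat \<Rightarrow> complex" where
  "hsum [] n = 1"
| "hsum (s # w) n = (\<Sum>k<n. 1 / of_nat (Suc k) ^ s * hsum w k)"

text \<open>The summation variable \<open>k \<ge> 1\<close> is encoded by \<open>k - 1\<close>, so that no pole is ever hit;
  accordingly \<open>hsum w n\<close> is \<open>H\<^sub>k\<^sub>-\<^sub>1(w)\<close> for \<open>k = pt n\<close>.\<close>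

definition pt :: "nat \<Rightarrow> complex" where
  "pt n = of_nat (Suc n)"

definition psum :: "(nat \<Rightarrow> complex) \<Rightarrow> nat \<Rightarrow> complex" where
  "psum f n = (\<Sum>k\<le>n. f k)"

text \<open>These are the products of a pole of order \<open>t\<close> and \<open>hsum v\<close>
  that arise from shifting the argument of \<open>hsum w\<close>. The order is bounded by one
  discarded letter and not by the sum of them, because the poles that get multiplied are
  distinct.\<close>

definition pole_words :: "nat list \<Rightarrow> (nat \<times> nat list) set" where
  "pole_words w = {(t, v). \<exists>x. w = x @ v \<and> (\<exists>y\<in>set x. 1 \<le> t \<and> t \<le> y)}"

inductive_set pole_gens :: "nat list \<Rightarrow> nat \<Rightarrow> (nat \<Rightarrow> complex) set" for w b where
  pole_gensI: "j < b \<Longrightarrow> (t, v) \<in> pole_words w \<Longrightarrow>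
    (\<lambda>n. 1 / (pt n + of_nat j) ^ t * hsum v n) \<in> pole_gens w b"

lemma pt_add_neq_0 [simp]: "pt n + of_nat a \<noteq> 0"
proof -
  have "pt n + of_nat a = of_nat (Suc n + a)" by (simp add: pt_def)
  then show ?thesis by (simp only: of_nat_eq_0_iff)
qed

lemma pt_neq_0 [simp]: "pt n \<noteq> 0"
  using pt_add_neq_0[of n 0] by simp

lemma hsum_add:
  "hsum (s # w) (n + b) - hsum (s # w) n = (\<Sum>j<b. 1 / (pt n + of_nat j) ^ s * hsum w (n + j))"
  by (induction b) (simp_all add: pt_def algebra_simps)

lemma pole_words_ConsI:
  "(t, v) \<in> pole_words w \<Longrightarrow> (t, v) \<in> pole_words (s # w)"
  "1 \<le> t \<Longrightarrow> t \<le> s \<Longrightarrow> (t, w) \<in> pole_words (s # w)"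
  "(t, v) \<in> pole_words w \<Longrightarrow> 1 \<le> i \<Longrightarrow> i \<le> s \<Longrightarrow> (i, v) \<in> pole_words (s # w)"
  "(t, v) \<in> pole_words w \<Longrightarrow> 1 \<le> i \<Longrightarrow> i \<le> t \<Longrightarrow> (i, v) \<in> pole_words w"
  unfolding pole_words_def mem_Collect_eq prod.case
     apply (metis append_Cons list.set_intros(2))
    apply (intro exI[of _ "[s]"], simp)
   apply (metis append_Cons list.set_intros(1))
  apply (metis le_trans)
  done

lemma pole_words_pos: "(t, v) \<in> pole_words w \<Longrightarrow> 1 \<le> t"
  by (auto simp: pole_words_def)

lemma pole_words_suffix:
  "(t, v) \<in> pole_words (s # w) \<Longrightarrow> \<exists>x. w = x @ v"
  unfolding pole_words_def by (auto simp: Cons_eq_append_conv)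

lemma psum_Suc: "psum f (Suc n) = psum f n + f (Suc n)"
  by (simp add: psum_def)

context complex_subfield
begin

lemma hsum_closed: "hsum w n \<in> K"
  by (induction w arbitrary: n)
     (auto intro!: sum_closed mult_closed divide_closed power_closed add_closed simp del: of_nat_Suc)

lemma kspan_psum:
  assumes "f \<in> kspan K UNIV T" "\<And>g. g \<in> T \<Longrightarrow> psum g \<in> kspan K UNIV S"
  shows "psum f \<in> kspan K UNIV S"
proof (rule kspan_map[OF assms(1)])
  show "psum f n = c * psum g n + psum h n" if "\<And>k. k \<in> UNIV \<Longrightarrow> f k = c * g k + h k" for f g h c n
    using that by (simp add: psum_def sum.distrib sum_distrib_left)
qed (simp add: psum_def, rule assms(2))

lemma kspan_const: "(\<lambda>_. 1) \<in> kspan K D S \<Longrightarrow> c \<in> K \<Longrightarrow> (\<lambda>_. c) \<in> kspan K D S"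
  using kspan_scale[of c "\<lambda>_. 1" D S] by simp

text \<open>The increment with index \<open>j\<close> has its pole at \<open>- j\<close>, while the
  inner sum shifted by \<open>j\<close> has poles only at \<open>- i\<close> with i < j. They never
  coincide, so \<open>kspan_pole_prod\<close> applies and orders are not added.\<close>

lemma kspan_hsum_shift:
  assumes "\<forall>y\<in>set w. 1 \<le> y"
  shows "(\<lambda>n. hsum w (n + b) - hsum w n) \<in> kspan K UNIV (pole_gens w b)"
  using assms
proof (induction w arbitrary: b)
  case Nil
  then show ?case by (auto intro: kspan_zero)
next
  case (Cons s u)
  let ?T = "kspan K UNIV (pole_gens (s # u) b)"
  have "(\<lambda>n. \<Sum>j<b. 1 / (pt n + of_nat j) ^ s * hsum u (n + j)) \<in> ?T"
  proof (rule kspan_sum)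
    fix j assume "j \<in> {..<b}"
    then have j: "j < b" by simp
    have 1: "(\<lambda>n. 1 / (pt n + of_nat j) ^ s * hsum u n) \<in> ?T"
      using Cons.prems j by (intro kspan_base pole_gensI pole_words_ConsI(2)) auto
    have 2: "(\<lambda>n. (hsum u (n + j) - hsum u n) * (1 / (pt n + of_nat j) ^ s)) \<in> ?T"
    proof (rule kspan_mult[OF Cons.IH])
      fix g assume "g \<in> pole_gens u j"
      then obtain i t v where g: "g = (\<lambda>n. 1 / (pt n + of_nat i) ^ t * hsum v n)"
        and i: "i < j" and tv: "(t, v) \<in> pole_words u" by cases
      have t: "1 \<le> t" using pole_words_pos[OF tv] .
      have s: "1 \<le> s" using Cons.prems by simp
      have P: "(\<lambda>n. 1 / (pt n + of_nat i) ^ k * hsum v n) \<in> ?T" if "1 \<le> k" "k \<le> t" for k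
        using i j pole_words_ConsI(4)[OF tv that]
        by (intro kspan_base pole_gensI pole_words_ConsI(1)) auto
      have Q: "(\<lambda>n. 1 / (pt n + of_nat j) ^ k * hsum v n) \<in> ?T" if "1 \<le> k" "k \<le> s" for k
        using j pole_words_ConsI(3)[OF tv that] by (intro kspan_base pole_gensI)
      have "(\<lambda>n. 1 / (pt n + of_nat i) ^ t * (1 / (pt n + of_nat j) ^ s) * hsum v n) \<in> ?T"
      proof (rule kspan_pole_prod)
        have "(\<lambda>n. 1 / (pt n + of_nat i) ^ 1 * hsum v n -
            1 / (pt n + of_nat j) ^ 1 * hsum v n) \<in> ?T"
          by (intro kspan_diff P Q t s) auto
        then show "(\<lambda>n. 1 / (pt n + of_nat i) * hsum v n -
            1 / (pt n + of_nat j) * hsum v n) \<in> ?T"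
          by (simp only: power_one_right)
      qed (use i s t P Q in auto)
      then show "(\<lambda>n. g n * (1 / (pt n + of_nat j) ^ s)) \<in> ?T"
        by (rule kspan_cong) (simp add: g)
    qed (use Cons.prems in auto)
    show "(\<lambda>n. 1 / (pt n + of_nat j) ^ s * hsum u (n + j)) \<in> ?T"
      by (rule kspan_cong[OF kspan_add[OF 1 2]]) (simp add: algebra_simps diff_divide_distrib)
  qed
  then show ?case by (simp only: hsum_add)
qed

text \<open>Faulhaber's formula: (k + 1)^(f+1) - k^(f+1) telescopes; expanding k as
  \<open>pt k - 1\<close> and solving for the term of degree \<open>f\<close> expresses its sum by
  sums of lower powers. The numbers \<open>c i\<close> are the binomial coefficients of this
  expansion.\<close>

lemma kspan_psum_power:
  "psum (\<lambda>k. pt k ^ f) \<in> kspan K UNIV {(\<lambda>n. pt n ^ q) | q. 1 \<le> q \<and> q \<le> Suc f}"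
proof (induction f rule: less_induct)
  case (less f)
  let ?T = "\<lambda>f. kspan K UNIV {(\<lambda>n. pt n ^ q) | q. 1 \<le> q \<and> q \<le> Suc f}"
  define c :: "nat \<Rightarrow> complex" where "c i = of_nat (Suc f choose i) * (- 1) ^ (Suc f - i)" for i
  have cK: "c i \<in> K" for i
    unfolding c_def by (intro mult_closed power_closed uminus_closed) auto
  have "psum (\<lambda>k. pt k ^ i) \<in> ?T f" if "i < f" for i
    by (rule kspan_mono[OF less.IH[OF that]]) (use that in auto)
  moreover have "(\<lambda>n. pt n ^ Suc f) \<in> ?T f"
    by (intro kspan_base CollectI exI[of _ "Suc f"]) simp
  ultimately have *: "(\<lambda>n. 1 / of_nat (Suc f) *
      (pt n ^ Suc f + (\<Sum>i<f. c i * psum (\<lambda>k. pt k ^ i) n))) \<in> ?T f"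
    by (intro kspan_scale kspan_add kspan_sum cK divide_closed of_nat_closed one_closed) auto
  have tel: "psum (\<lambda>k. pt k ^ Suc f - of_nat k ^ Suc f) n = pt n ^ Suc f" for n
    by (induction n) (simp_all add: psum_def pt_def)
  have bin: "pt k ^ Suc f - of_nat k ^ Suc f = of_nat (Suc f) * pt k ^ f - (\<Sum>i<f. c i * pt k ^ i)"
    for k
  proof -
    have "of_nat k ^ Suc f = (pt k + (- 1)) ^ Suc f" by (simp add: pt_def)
    also have "\<dots> = (\<Sum>i\<le>Suc f. c i * pt k ^ i)"
      unfolding binomial_ring c_def by (simp add: mult_ac)
    also have "\<dots> = (\<Sum>i<f. c i * pt k ^ i) + c f * pt k ^ f + c (Suc f) * pt k ^ Suc f"
      by (simp add: lessThan_Suc_atMost[symmetric])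
    finally show ?thesis by (simp add: c_def Suc_diff_Suc algebra_simps)
  qed
  have "psum (\<lambda>k. pt k ^ f) n = 1 / of_nat (Suc f) *
      (pt n ^ Suc f + (\<Sum>i<f. c i * psum (\<lambda>k. pt k ^ i) n))" for n
  proof -
    have "pt n ^ Suc f = psum (\<lambda>k. of_nat (Suc f) * pt k ^ f - (\<Sum>i<f. c i * pt k ^ i)) n"
      using tel[of n] by (simp only: bin)
    also have "\<dots> = of_nat (Suc f) * psum (\<lambda>k. pt k ^ f) n -
        (\<Sum>i<f. c i * psum (\<lambda>k. pt k ^ i) n)"
      unfolding psum_def sum_distrib_left sum_subtractf by (subst sum.swap) (rule refl)
    finally show ?thesis by (simp add: field_simps del: of_nat_Suc)
  qed
  then show ?case using * by simp
qed

end

section \<open>Summation of products of poles and harmonic sums\<close>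

text \<open>The parameter \<open>E\<close> bounds the number of letters \<open>1\<close>. A pole of order \<open>1\<close> is not counted here,
  but a nonconstant power of \<open>pt n\<close> is, since summing it can create one more letter \<open>1\<close>.
  The flag \<open>cv\<close> restricts to words whose harmonic sums converge.\<close>

inductive_set post_gens ::
  "nat list set \<Rightarrow> nat set \<Rightarrow> nat \<Rightarrow> nat \<Rightarrow> nat \<Rightarrow> bool \<Rightarrow> (nat \<Rightarrow> complex) set"
  for G B E l d cv where
  post_power: "w \<in> G \<Longrightarrow> length w < l \<Longrightarrow> f \<le> d \<Longrightarrow>
    count_list w 1 + (if f = 0 then 0 else 1) \<le> E \<Longrightarrow> (cv \<Longrightarrow> w = [] \<or> 2 \<le> hd w) \<Longrightarrow>
    (\<lambda>n. pt n ^ f * hsum w n) \<in> post_gens G B E l d cv"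
| post_pole: "b \<in> B \<Longrightarrow> 1 \<le> s \<Longrightarrow> s # w \<in> G \<Longrightarrow> length w < l \<Longrightarrow> count_list w 1 \<le> E \<Longrightarrow>
    (\<lambda>n. 1 / (pt n + of_nat b) ^ s * hsum w n) \<in> post_gens G B E l d cv"

text \<open>The closure conditions are those forced by a shift of the argument: it replaces a word
  by one of its \<open>pole_words\<close>, and removing a shift by \<open>b\<close> creates poles at
  smaller places, whence the downward closure of \<open>B\<close>.\<close>

locale word_class = complex_subfield K for K :: "complex set" +
  fixes G :: "nat list set" and B :: "nat set"
  assumes Nil_mem: "[] \<in> G"
    and letters_pos: "w \<in> G \<Longrightarrow> \<forall>y\<in>set w. 1 \<le> y"
    and pole_words_mem: "w \<in> G \<Longrightarrow> (t, v) \<in> pole_words w \<Longrightarrow> t # v \<in> G"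
    and B_down: "b \<in> B \<Longrightarrow> j \<le> b \<Longrightarrow> j \<in> B"
begin

lemma lower_mem: "s # w \<in> G \<Longrightarrow> 1 \<le> t \<Longrightarrow> t \<le> s \<Longrightarrow> t # w \<in> G"
  by (rule pole_words_mem, assumption) (rule pole_words_ConsI(2))

lemma delete_mem: "s # y # w \<in> G \<Longrightarrow> 1 \<le> t \<Longrightarrow> t \<le> s \<Longrightarrow> t # w \<in> G"
  "s # y # w \<in> G \<Longrightarrow> 1 \<le> t \<Longrightarrow> t \<le> y \<Longrightarrow> t # w \<in> G"
  by (erule pole_words_mem, force simp: pole_words_def intro!: exI[of _ "[s, y]"])+

lemma tl_mem: "s # w \<in> G \<Longrightarrow> w \<in> G"
proof (cases w)
  case (Cons y u)
  assume "s # w \<in> G"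
  with Cons letters_pos[of "s # w"] have "s # w \<in> G" "1 \<le> y" by auto
  with Cons show ?thesis using pole_words_mem[OF _ pole_words_ConsI(1)[OF pole_words_ConsI(2)]] by blast
qed (simp add: Nil_mem)

lemma post_hsum:
  assumes "w \<in> G" "length w < l" "count_list w 1 \<le> E" "cv \<Longrightarrow> w = [] \<or> 2 \<le> hd w"
  shows "hsum w \<in> kspan K UNIV (post_gens G B E l d cv)"
  using kspan_base[OF post_power[of w G l 0 d E cv B]] assms by simp

lemma post_const:
  assumes "0 < l" "c \<in> K"
  shows "(\<lambda>_. c) \<in> kspan K UNIV (post_gens G B E l d cv)"
proof (rule kspan_const)
  show "(\<lambda>_. 1) \<in> kspan K UNIV (post_gens G B E l d cv)"
    by (rule kspan_cong[OF post_hsum[of "[]"]]) (use assms Nil_mem in auto)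
qed (use assms in auto)

lemma post_shift:
  assumes "s # w \<in> G" "length w < l" "count_list w 1 \<le> E" "b \<in> B"
  shows "(\<lambda>n. hsum (s # w) (n + Suc b) - hsum (s # w) n) \<in> kspan K UNIV (post_gens G B E l d cv)"
proof (rule kspan_trans[OF kspan_hsum_shift])
  fix g assume "g \<in> pole_gens (s # w) (Suc b)"
  then obtain j t v where g: "g = (\<lambda>n. 1 / (pt n + of_nat j) ^ t * hsum v n)"
    and j: "j < Suc b" and tv: "(t, v) \<in> pole_words (s # w)" by cases
  obtain x where x: "w = x @ v" using pole_words_suffix[OF tv] by blast
  show "g \<in> kspan K UNIV (post_gens G B E l d cv)"
    unfolding g using assms x j pole_words_mem[OF assms(1) tv] pole_words_pos[OF tv] B_down[of b j]
    by (intro kspan_base post_pole) auto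
qed (use letters_pos[OF assms(1)] in auto)

text \<open>If the shift equals the pole, the summand depends on \<open>k + b\<close> only, and the
  sum is a stretch of the harmonic sum of \<open>s # w\<close>; the constant
  \<open>hsum (s # w) b\<close> stands for the missing initial terms.\<close>

lemma psum_pole_diag:
  assumes "s # w \<in> G" "length w < l" "count_list w 1 \<le> E" "b \<in> B"
  shows "(\<lambda>n. psum (\<lambda>k. 1 / (pt k + of_nat b) ^ s * hsum w (k + b)) n - hsum (s # w) n) \<in>
    kspan K UNIV (post_gens G B E l d cv)"
proof -
  have eq: "psum (\<lambda>k. 1 / (pt k + of_nat b) ^ s * hsum w (k + b)) n =
      hsum (s # w) (n + Suc b) - hsum (s # w) b" for n
    by (induction n) (simp_all add: psum_def pt_def algebra_simps)
  have "(\<lambda>n. (hsum (s # w) (n + Suc b) - hsum (s # w) n) - hsum (s # w) b) \<in>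
      kspan K UNIV (post_gens G B E l d cv)"
    by (intro kspan_diff post_shift assms post_const hsum_closed) (use assms in auto)
  then show ?thesis unfolding eq by (rule kspan_cong) (simp del: hsum.simps)
qed

text \<open>The leading term does not depend on \<open>b\<close> or \<open>c\<close>, and the
  remainder needs only words no longer than \<open>w\<close>; the letter \<open>s\<close> is not
  charged to \<open>E\<close>. The depth \<open>p\<close> formula and the cancellation in
  \<open>psum_pair_post\<close> both rest on this. A general shift \<open>c\<close> is required
  because the induction meets a pole at \<open>- b\<close> next to a sum shifted by some j <
  b.\<close>

lemma psum_pole:
  assumes "s # w \<in> G" "length w < l" "count_list w 1 \<le> E" "b \<in> B" "c \<le> b"
  shows "(\<lambda>n. psum (\<lambda>k. 1 / (pt k + of_nat b) ^ s * hsum w (k + c)) n - hsum (s # w) n) \<in>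
    kspan K UNIV (post_gens G B E l d cv)"
  using assms
proof (induction w arbitrary: s b c)
  case Nil
  then show ?case using psum_pole_diag[of s "[]" l E b] by simp
next
  case (Cons y u)
  let ?T = "kspan K UNIV (post_gens G B E l d cv)"
  have yu: "1 \<le> y" "1 \<le> s" using letters_pos[OF Cons.prems(1)] by auto
  have cu: "count_list u 1 \<le> E" "length u < l" using Cons.prems(2,3) by (auto split: if_splits)
  \<comment> \<open>This is the outer pole times the increment of \<open>hsum (y # u)\<close> from
    \<open>k + j\<close> to \<open>k + j + 1\<close>. Since j < b, its two poles are
    distinct.\<close>
  define q where "q j k = 1 / (pt k + of_nat b) ^ s * (1 / (pt k + of_nat j) ^ y) * hsum u (k + j)"
    for j k
  have "psum (q j) \<in> ?T" if j: "j \<in> {c..<b}" for j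
  proof -
    let ?P = "{f. psum f \<in> ?T}"
    have jB: "j \<in> B" using B_down[OF Cons.prems(4), of j] j by auto
    have P: "(\<lambda>k. 1 / (pt k + of_nat a) ^ i * hsum u (k + j)) \<in> kspan K UNIV ?P"
      if i: "2 \<le> i" "i # u \<in> G" and a: "a \<in> B" "j \<le> a" for a i
    proof (rule kspan_base, rule CollectI)
      have "(\<lambda>n. psum (\<lambda>k. 1 / (pt k + of_nat a) ^ i * hsum u (k + j)) n - hsum (i # u) n) \<in> ?T"
        by (rule Cons.IH) (use i a cu in auto)
      moreover have "hsum (i # u) \<in> ?T"
        using i cu Cons.prems(2) by (intro post_hsum) auto
      ultimately have "(\<lambda>n. (psum (\<lambda>k. 1 / (pt k + of_nat a) ^ i * hsum u (k + j)) n -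
          hsum (i # u) n) + hsum (i # u) n) \<in> ?T" by (rule kspan_add)
      then show "psum (\<lambda>k. 1 / (pt k + of_nat a) ^ i * hsum u (k + j)) \<in> ?T"
        by (rule kspan_cong) simp
    qed
    have "q j \<in> kspan K UNIV ?P"
      unfolding q_def
    proof (rule kspan_pole_prod)
      fix i assume "2 \<le> i" "i \<le> s"
      then show "(\<lambda>k. 1 / (pt k + of_nat b) ^ i * hsum u (k + j)) \<in> kspan K UNIV ?P"
        using j Cons.prems by (intro P delete_mem(1)[OF Cons.prems(1)]) auto
    next
      fix i assume "2 \<le> i" "i \<le> y"
      then show "(\<lambda>k. 1 / (pt k + of_nat j) ^ i * hsum u (k + j)) \<in> kspan K UNIV ?P"
        using j jB Cons.prems by (intro P delete_mem(2)[OF Cons.prems(1)]) auto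
    next
      have 1: "1 # u \<in> G" using delete_mem(1)[OF Cons.prems(1)] yu by auto
      \<comment> \<open>Both leading terms are \<open>hsum (1 # u)\<close> and cancel, so this
        possibly divergent sum never has to belong to the span.\<close>
      have "(\<lambda>n. (psum (\<lambda>k. 1 / (pt k + of_nat b) ^ 1 * hsum u (k + j)) n - hsum (1 # u) n) -
          (psum (\<lambda>k. 1 / (pt k + of_nat j) ^ 1 * hsum u (k + j)) n - hsum (1 # u) n)) \<in> ?T"
        by (intro kspan_diff Cons.IH 1 cu jB Cons.prems(4)) (use j in auto)
      then have c: "psum (\<lambda>k. 1 / (pt k + of_nat b) * hsum u (k + j) -
          1 / (pt k + of_nat j) * hsum u (k + j)) \<in> ?T"
        by (rule kspan_cong) (simp add: psum_def sum_subtractf)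
      show "(\<lambda>k. 1 / (pt k + of_nat b) * hsum u (k + j) -
          1 / (pt k + of_nat j) * hsum u (k + j)) \<in> kspan K UNIV ?P"
        by (rule kspan_base, rule CollectI, rule c)
    qed (use j yu in auto)
    then show ?thesis by (rule kspan_psum) simp
  qed
  then have "(\<lambda>n. (psum (\<lambda>k. 1 / (pt k + of_nat b) ^ s * hsum (y # u) (k + b)) n -
      hsum (s # y # u) n) - (\<Sum>j\<in>{c..<b}. psum (q j) n)) \<in> ?T"
    by (intro kspan_diff kspan_sum psum_pole_diag Cons.prems) auto
  then show ?case
  proof (rule kspan_cong)
    fix n :: nat
    have "1 / (pt k + of_nat b) ^ s * hsum (y # u) (k + c) =
        1 / (pt k + of_nat b) ^ s * hsum (y # u) (k + b) - (\<Sum>j\<in>{c..<b}. q j k)" for k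
    proof -
      have "(\<Sum>j\<in>{c..<b}. 1 / (pt k + of_nat j) ^ y * hsum u (k + j)) =
          hsum (y # u) (k + b) - hsum (y # u) (k + c)"
        using sum.atLeastLessThan_concat[of 0 c b "\<lambda>j. 1 / (pt k + of_nat j) ^ y * hsum u (k + j)"]
          hsum_add[of y u k b] hsum_add[of y u k c] Cons.prems(5)
        by (simp add: atLeast0LessThan del: hsum.simps) (simp add: algebra_simps)
      then have "(\<Sum>j\<in>{c..<b}. q j k) =
          1 / (pt k + of_nat b) ^ s * (hsum (y # u) (k + b) - hsum (y # u) (k + c))"
        unfolding q_def mult.assoc sum_distrib_left[symmetric] by (simp only:)
      then show ?thesis by (simp add: right_diff_distrib del: hsum.simps)
    qed
    then have "psum (\<lambda>k. 1 / (pt k + of_nat b) ^ s * hsum (y # u) (k + c)) n =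
        psum (\<lambda>k. 1 / (pt k + of_nat b) ^ s * hsum (y # u) (k + b)) n - (\<Sum>j\<in>{c..<b}. psum (q j) n)"
      unfolding psum_def by (simp add: sum_subtractf sum.swap[of _ "{c..<b}"] del: hsum.simps)
    then show "psum (\<lambda>k. 1 / (pt k + of_nat b) ^ s * hsum (y # u) (k + b)) n - hsum (s # y # u) n -
        (\<Sum>j\<in>{c..<b}. psum (q j) n) =
        psum (\<lambda>k. 1 / (pt k + of_nat b) ^ s * hsum (y # u) (k + c)) n - hsum (s # y # u) n"
      by (simp del: hsum.simps)
  qed
qed

lemma psum_pole_post:
  assumes "s # w \<in> G" "Suc (length w) < l" "count_list (s # w) 1 \<le> E" "b \<in> B"
    "cv \<Longrightarrow> 2 \<le> s"
  shows "psum (\<lambda>k. 1 / (pt k + of_nat b) ^ s * hsum w k) \<in> kspan K UNIV (post_gens G B E l d cv)"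
proof -
  have "(\<lambda>n. psum (\<lambda>k. 1 / (pt k + of_nat b) ^ s * hsum w (k + 0)) n - hsum (s # w) n) \<in>
      kspan K UNIV (post_gens G B E l d cv)"
    using assms by (intro psum_pole) (auto split: if_splits)
  moreover have "hsum (s # w) \<in> kspan K UNIV (post_gens G B E l d cv)"
    using assms by (intro post_hsum) auto
  ultimately have "(\<lambda>n. (psum (\<lambda>k. 1 / (pt k + of_nat b) ^ s * hsum w (k + 0)) n - hsum (s # w) n)
      + hsum (s # w) n) \<in> kspan K UNIV (post_gens G B E l d cv)"
    by (rule kspan_add)
  then show ?thesis by (rule kspan_cong) (simp del: hsum.simps)
qed

lemma psum_pair_post:
  assumes "1 # w \<in> G" "length w < l" "count_list w 1 \<le> E" "a \<in> B" "b \<in> B"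
  shows "psum (\<lambda>k. (1 / (pt k + of_nat a) - 1 / (pt k + of_nat b)) * hsum w k) \<in>
    kspan K UNIV (post_gens G B E l d cv)"
proof -
  have "(\<lambda>n. (psum (\<lambda>k. 1 / (pt k + of_nat a) ^ 1 * hsum w (k + 0)) n - hsum (1 # w) n) -
      (psum (\<lambda>k. 1 / (pt k + of_nat b) ^ 1 * hsum w (k + 0)) n - hsum (1 # w) n)) \<in>
      kspan K UNIV (post_gens G B E l d cv)"
    using assms by (intro kspan_diff psum_pole) auto
  then show ?thesis
    by (rule kspan_cong) (simp add: psum_def sum_subtractf left_diff_distrib)
qed

text \<open>Summation by parts, with the sum of the powers as the factor that is differenced back.
  Dividing it by \<open>pt k ^ s\<close> may leave a simple pole even when s > 1, and summing that
  pole produces a letter 1; the hypothesis on \<open>E\<close> reserves room for it.\<close>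

lemma psum_power_post:
  assumes "w \<in> G" "length w < l" "count_list w 1 + 1 \<le> E" "Suc f \<le> d" "0 \<in> B"
  shows "psum (\<lambda>k. pt k ^ f * hsum w k) \<in> kspan K UNIV (post_gens G B E l d False)"
  using assms
proof (induction w arbitrary: f)
  case Nil
  have "psum (\<lambda>k. pt k ^ f) \<in> kspan K UNIV (post_gens G B E l d False)"
  proof (rule kspan_trans[OF kspan_psum_power])
    fix g assume "g \<in> {\<lambda>n. pt n ^ q |q. 1 \<le> q \<and> q \<le> Suc f}"
    then obtain q where q: "g = (\<lambda>n. pt n ^ q)" "q \<le> Suc f" by blast
    have "(\<lambda>n. pt n ^ q * hsum [] n) \<in> kspan K UNIV (post_gens G B E l d False)"
      using Nil q by (intro kspan_base post_power) auto
    then show "g \<in> kspan K UNIV (post_gens G B E l d False)" using q by simp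
  qed
  then show ?case by simp
next
  case (Cons s u)
  let ?T = "kspan K UNIV (post_gens G B E l d False)"
  have su: "u \<in> G" "1 \<le> s" "length u < l" "count_list u 1 + 1 \<le> E"
    using tl_mem[OF Cons.prems(1)] letters_pos[OF Cons.prems(1)] Cons.prems(2,3)
    by (auto split: if_splits)
  define F where "F = psum (\<lambda>k. pt k ^ f)"
  define g where "g k = F k * (1 / pt k ^ s) * hsum u k" for k
  \<comment> \<open>Summation by parts calls for the sum of \<open>g\<close> over k < n, which is
    \<open>psum g n - g n\<close>. Hence both \<open>g\<close> and its sums have to lie in the
    span.\<close>
  let ?S = "{h. psum h \<in> ?T \<and> h \<in> ?T}"
  have "(\<lambda>k. F k * (1 / pt k ^ s * hsum u k)) \<in> kspan K UNIV ?S"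
    unfolding F_def
  proof (rule kspan_mult[OF kspan_psum_power])
    fix h assume "h \<in> {\<lambda>n. pt n ^ q |q. 1 \<le> q \<and> q \<le> Suc f}"
    then obtain q where q: "h = (\<lambda>n. pt n ^ q)" "1 \<le> q" "q \<le> Suc f" by blast
    show "(\<lambda>k. h k * (1 / pt k ^ s * hsum u k)) \<in> kspan K UNIV ?S"
    proof (cases "s \<le> q")
      case True
      then have qs: "q = (q - s) + s" by simp
      have "psum (\<lambda>k. pt k ^ (q - s) * hsum u k) \<in> ?T"
        using su q Cons.prems(4,5) by (intro Cons.IH) auto
      moreover have "(\<lambda>k. pt k ^ (q - s) * hsum u k) \<in> ?T"
        using su q Cons.prems by (intro kspan_base post_power) auto
      ultimately have "(\<lambda>k. pt k ^ (q - s) * hsum u k) \<in> kspan K UNIV ?S"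
        by (intro kspan_base) auto
      then show ?thesis
        by (rule kspan_cong) (subst q(1), subst qs, simp add: power_add)
    next
      case False
      then have sq: "s = q + (s - q)" by simp
      have m: "(s - q) # u \<in> G" using lower_mem[OF Cons.prems(1)] False by auto
      have "psum (\<lambda>k. 1 / (pt k + of_nat 0) ^ (s - q) * hsum u k) \<in> ?T"
        using su m Cons.prems by (intro psum_pole_post) auto
      moreover have "(\<lambda>k. 1 / (pt k + of_nat 0) ^ (s - q) * hsum u k) \<in> ?T"
        using su m Cons.prems False by (intro kspan_base post_pole) auto
      ultimately have "(\<lambda>k. 1 / (pt k + of_nat 0) ^ (s - q) * hsum u k) \<in> kspan K UNIV ?S"
        by (intro kspan_base) auto
      then show ?thesis
        by (rule kspan_cong) (subst q(1), subst (2) sq, simp add: power_add)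
    qed
  qed
  then have gS: "g \<in> kspan K UNIV ?S"
    by (rule kspan_cong) (simp add: g_def)
  have 1: "psum g \<in> ?T" by (rule kspan_psum[OF gS]) simp
  have 2: "g \<in> ?T" by (rule kspan_trans[OF gS]) simp
  have 3: "(\<lambda>n. F n * hsum (s # u) n) \<in> ?T"
    unfolding F_def
  proof (rule kspan_mult[OF kspan_psum_power])
    fix h assume "h \<in> {\<lambda>n. pt n ^ q |q. 1 \<le> q \<and> q \<le> Suc f}"
    then obtain q where q: "h = (\<lambda>n. pt n ^ q)" "q \<le> Suc f" by blast
    show "(\<lambda>n. h n * hsum (s # u) n) \<in> ?T"
      unfolding q(1) using q(2) Cons.prems by (intro kspan_base post_power) auto
  qed
  have "psum (\<lambda>k. pt k ^ f * hsum (s # u) k) n = F n * hsum (s # u) n - psum g n + g n" for n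
  proof (induction n)
    case (Suc n)
    define t where "t = 1 / pt n ^ s * hsum u n"
    have "hsum (s # u) (Suc n) = hsum (s # u) n + t" "g n = F n * t"
      by (simp_all add: pt_def g_def t_def)
    moreover have "F (Suc n) = F n + pt (Suc n) ^ f"
      by (simp add: F_def psum_Suc)
    ultimately show ?case
      using Suc by (simp add: psum_Suc algebra_simps del: hsum.simps)
  qed (simp add: psum_def F_def g_def)
  moreover have "(\<lambda>n. F n * hsum (s # u) n - psum g n + g n) \<in> ?T"
    by (intro kspan_add kspan_diff 1 2 3)
  ultimately show ?case by (simp del: hsum.simps)
qed

end

section \<open>One summation step\<close>

definition rfun :: "nat \<Rightarrow> nat \<Rightarrow> nat \<Rightarrow> nat \<Rightarrow> complex \<Rightarrow> complex" where
  "rfun m a n r x = x ^ m / pochhammer (x + of_nat r) (n + 1) ^ a"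

definition pole_order :: "nat \<Rightarrow> nat \<Rightarrow> nat \<Rightarrow> nat \<Rightarrow> nat" where
  "pole_order a n r b = (if r \<le> b \<and> b \<le> r + n then a else 0)"

definition pf_factors :: "nat \<Rightarrow> nat \<Rightarrow> int \<Rightarrow> pf_factor set" where
  "pf_factors a n \<delta> = Monomial ` {q. int q \<le> \<delta>} \<union> (\<lambda>(j, s). Pole j s) ` ({..n} \<times> {1..a})"

lemma finite_nat_le_int: "finite {q. int q \<le> \<delta>}"
  by (rule finite_subset[of _ "{..nat \<delta>}"]) auto

lemma finite_factors: "finite (pf_factors a n \<delta>)"
  unfolding pf_factors_def by (auto intro: finite_nat_le_int)

lemma sum_factors:
  "(\<Sum>u\<in>pf_factors a n \<delta>. g u) =
    (\<Sum>q | int q \<le> \<delta>. g (Monomial q)) + (\<Sum>j\<le>n. \<Sum>s=1..a. g (Pole j s))"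
proof -
  have "(\<Sum>u\<in>pf_factors a n \<delta>. g u) = (\<Sum>u\<in>Monomial ` {q. int q \<le> \<delta>}. g u) +
      (\<Sum>u\<in>(\<lambda>(j, s). Pole j s) ` ({..n} \<times> {1..a}). g u)"
    unfolding pf_factors_def by (rule sum.union_disjoint) (auto intro: finite_nat_le_int)
  also have "(\<Sum>u\<in>Monomial ` {q. int q \<le> \<delta>}. g u) = (\<Sum>q | int q \<le> \<delta>. g (Monomial q))"
    by (subst sum.reindex) (auto simp: inj_on_def)
  also have "(\<Sum>u\<in>(\<lambda>(j, s). Pole j s) ` ({..n} \<times> {1..a}). g u) =
      (\<Sum>j\<le>n. \<Sum>s=1..a. g (Pole j s))"
    by (subst sum.reindex) (auto simp: inj_on_def sum.cartesian_product case_prod_beta)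
  finally show ?thesis .
qed

lemma factors_iff: "Monomial q \<in> pf_factors a n \<delta> \<longleftrightarrow> int q \<le> \<delta>"
  "Pole j s \<in> pf_factors a n \<delta> \<longleftrightarrow> j \<le> n \<and> 1 \<le> s \<and> s \<le> a"
  by (auto simp: pf_factors_def)

lemma factor_ok_factors: "u \<in> pf_factors a n \<delta> \<Longrightarrow> factor_ok a n u"
  by (auto simp: pf_factors_def)

lemma count_list_concat_replicate: "count_list (concat (replicate a xs)) x = a * count_list xs x"
  by (induction a) auto

lemma count_list_upt: "count_list [i..<j] x = (if i \<le> x \<and> x < j then 1 else 0)"
  by (induction j) auto

context complex_subfield
begin

lemma kspan_rfun:
  assumes D: "\<And>x j. x \<in> D \<Longrightarrow> j \<le> n \<Longrightarrow> \<xi> x + of_nat r + of_nat j \<noteq> 0"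
  shows "(\<lambda>x. rfun m a n r (\<xi> x)) \<in>
    kspan K D (pf_gens \<xi> (pole_order a n r) (int m - int (a * (n + 1))))"
proof -
  let ?as = "concat (replicate a [r..<r + n + 1])"
  have c: "count_list ?as = pole_order a n r"
    by (auto simp: fun_eq_iff count_list_concat_replicate count_list_upt pole_order_def)
  have l: "length ?as = a * (n + 1)"
    by (induction a) auto
  have "pochhammer (z + of_nat r) (n + 1) = (\<Prod>b\<leftarrow>[r..<r + n + 1]. z + of_nat b)" for z :: complex
    by (induction n) (simp_all add: pochhammer_Suc algebra_simps)
  then have p: "pochhammer (z + of_nat r) (n + 1) ^ a = (\<Prod>b\<leftarrow>?as. z + of_nat b)" for z :: complex
    by (induction a) auto
  have "(\<lambda>x. \<xi> x ^ m / (\<Prod>b\<leftarrow>?as. \<xi> x + of_nat b)) \<in>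
    kspan K D (pf_gens \<xi> (count_list ?as) (int m - int (length ?as)))"
  proof (rule kspan_partial_fractions)
    fix x c assume "x \<in> D" "c \<in> set ?as"
    have "set ?as \<subseteq> {r..<r + n + 1}" by (induction a) auto
    then have "c \<in> {r..<r + n + 1}" using \<open>c \<in> set ?as\<close> by (rule subsetD)
    then have "r \<le> c" "c - r \<le> n" by auto
    with D[OF \<open>x \<in> D\<close>, of "c - r"] show "\<xi> x + of_nat c \<noteq> 0"
      by (simp add: of_nat_diff)
  qed
  then show ?thesis unfolding c l rfun_def p .
qed

text \<open>The vanishing sum of residues can be read off from the generators: in degree at most -2
  only \<open>pair\<close> supplies simple poles, with coefficients 1 and -1.\<close>

lemma rfun_coeffs:
  assumes "f \<in> kspan K D (pf_gens (\<lambda>x. x) (pole_order a n r) \<delta>)"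
  shows "\<exists>c. (\<forall>u. c u \<in> K) \<and> (\<forall>u. u \<notin> pf_factors a n \<delta> \<longrightarrow> c u = 0) \<and>
    (\<delta> \<le> - 2 \<longrightarrow> (\<Sum>j\<le>n. c (Pole j 1)) = 0) \<and>
    (\<forall>x\<in>D. f x = (\<Sum>u\<in>pf_factors a n \<delta>. c u * factor_eval r u x))"
  using assms
proof (induction rule: kspan.induct)
  case (kspan_zero f)
  then show ?case by (intro exI[of _ "\<lambda>_. 0"]) auto
next
  case (kspan_step k g h f)
  from kspan_step.IH obtain c where c: "\<And>u. c u \<in> K" "\<And>u. u \<notin> pf_factors a n \<delta> \<Longrightarrow> c u = 0"
    "\<delta> \<le> - 2 \<Longrightarrow> (\<Sum>j\<le>n. c (Pole j 1)) = 0"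
    "\<And>x. x \<in> D \<Longrightarrow> h x = (\<Sum>u\<in>pf_factors a n \<delta>. c u * factor_eval r u x)" by blast
  have "\<exists>b. (\<forall>u. b u \<in> K) \<and> (\<forall>u. u \<notin> pf_factors a n \<delta> \<longrightarrow> b u = 0) \<and>
    (\<delta> \<le> - 2 \<longrightarrow> (\<Sum>j\<le>n. b (Pole j 1)) = 0) \<and>
    (\<forall>x\<in>D. g x = (\<Sum>u\<in>pf_factors a n \<delta>. b u * factor_eval r u x))"
    using kspan_step(2)
  proof cases
    case (power q)
    let ?b = "\<lambda>u. if u = Monomial q then 1 else 0 :: complex"
    have "(\<Sum>u\<in>pf_factors a n \<delta>. ?b u * factor_eval r u x) = x ^ q" for x
      using power finite_factors[of a n \<delta>] by (subst sum.remove[of _ "Monomial q"]) (auto simp: factors_iff)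
    then show ?thesis using power by (intro exI[of _ ?b]) (auto simp: factors_iff)
  next
    case (pole s i)
    let ?b = "\<lambda>u. if u = Pole (i - r) s then 1 else 0 :: complex"
    have i: "r \<le> i" "i - r \<le> n" "s \<le> a" using pole by (auto simp: pole_order_def split: if_splits)
    then have m: "Pole (i - r) s \<in> pf_factors a n \<delta>" using pole by (auto simp: factors_iff)
    have "(\<Sum>u\<in>pf_factors a n \<delta>. ?b u * factor_eval r u x) = 1 / (x + of_nat i) ^ s" for x
      using m finite_factors[of a n \<delta>] i
      by (subst sum.remove[of _ "Pole (i - r) s"]) (auto simp: of_nat_diff)
    then show ?thesis using pole m by (intro exI[of _ ?b]) (auto intro!: sum.neutral)
  next
    case (pair i j)
    let ?b1 = "\<lambda>u. if u = Pole (i - r) 1 then 1 else 0 :: complex"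
    let ?b2 = "\<lambda>u. if u = Pole (j - r) 1 then 1 else 0 :: complex"
    have i: "r \<le> i" "i - r \<le> n" "1 \<le> a" "r \<le> j" "j - r \<le> n"
      using pair by (auto simp: pole_order_def split: if_splits)
    then have m: "Pole (i - r) 1 \<in> pf_factors a n \<delta>" "Pole (j - r) 1 \<in> pf_factors a n \<delta>"
      by (auto simp: factors_iff)
    have "(\<Sum>u\<in>pf_factors a n \<delta>. ?b1 u * factor_eval r u x) = 1 / (x + of_nat i)"
      "(\<Sum>u\<in>pf_factors a n \<delta>. ?b2 u * factor_eval r u x) = 1 / (x + of_nat j)" for x
      using m finite_factors[of a n \<delta>] i
      by (subst sum.remove[of _ "Pole (i - r) 1"] sum.remove[of _ "Pole (j - r) 1"];
          auto simp: of_nat_diff)+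
    then have s: "(\<Sum>u\<in>pf_factors a n \<delta>. (?b1 u - ?b2 u) * factor_eval r u x) = g x" for x
      by (simp only: left_diff_distrib sum_subtractf pair)
    have "(\<Sum>l\<le>n. ?b1 (Pole l 1)) = 1" "(\<Sum>l\<le>n. ?b2 (Pole l 1)) = 1"
      using i by (simp_all add: sum.delta)
    then have "(\<Sum>l\<le>n. ?b1 (Pole l 1) - ?b2 (Pole l 1)) = 0"
      by (simp only: sum_subtractf) simp
    moreover have "\<forall>u. u \<notin> pf_factors a n \<delta> \<longrightarrow> ?b1 u - ?b2 u = 0" using m by auto
    moreover have "\<forall>u. ?b1 u - ?b2 u \<in> K" by (auto intro: uminus_closed)
    ultimately show ?thesis using s by (intro exI[of _ "\<lambda>u. ?b1 u - ?b2 u"]) simp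
  qed
  then obtain b where b: "\<And>u. b u \<in> K" "\<And>u. u \<notin> pf_factors a n \<delta> \<Longrightarrow> b u = 0"
    "\<delta> \<le> - 2 \<Longrightarrow> (\<Sum>j\<le>n. b (Pole j 1)) = 0"
    "\<And>x. x \<in> D \<Longrightarrow> g x = (\<Sum>u\<in>pf_factors a n \<delta>. b u * factor_eval r u x)" by blast
  show ?case
  proof (intro exI[of _ "\<lambda>u. k * b u + c u"] conjI allI impI ballI)
    show "k * b u + c u \<in> K" for u by (intro add_closed mult_closed b c kspan_step)
    show "(\<Sum>j\<le>n. k * b (Pole j 1) + c (Pole j 1)) = 0" if "\<delta> \<le> - 2"
      using b(3)[OF that] c(3)[OF that] by (simp add: sum.distrib flip: sum_distrib_left)
    show "f x = (\<Sum>u\<in>pf_factors a n \<delta>. (k * b u + c u) * factor_eval r u x)" if "x \<in> D" for x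
      using kspan_step(4)[OF that] b(4)[OF that] c(4)[OF that]
      by (simp add: distrib_right sum.distrib mult.assoc flip: sum_distrib_left)
  qed (use b c in auto)
qed

end

text \<open>\<open>G'\<close> and \<open>B'\<close> describe the sum over the inner variables. By \<open>merge_mem\<close> the orders of
  colliding poles add up.\<close>

locale word_step = word_class K G B for K :: "complex set" and G B +
  fixes G' :: "nat list set" and B' :: "nat set" and m a n r :: nat
  assumes G'_subset: "G' \<subseteq> G" and B'_subset: "B' \<subseteq> B"
    and tl_mem': "t # w \<in> G' \<Longrightarrow> w \<in> G'"
    and poles_mem: "j \<le> n \<Longrightarrow> r + j \<in> B"
    and Cons_mem: "w \<in> G' \<Longrightarrow> 1 \<le> s \<Longrightarrow> s \<le> a \<Longrightarrow> s # w \<in> G"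
    and merge_mem: "t # w \<in> G' \<Longrightarrow> 1 \<le> s \<Longrightarrow> s \<le> a \<Longrightarrow> r \<le> b \<Longrightarrow> b \<le> r + n \<Longrightarrow> b \<in> B' \<Longrightarrow>
      (s + t) # w \<in> G"
begin

text \<open>The order of decay at infinity of the rational function in the current variable.\<close>

definition defect :: int where
  "defect = int (a * (n + 1)) - int m"

lemma zero_mem: "0 \<in> B"
  using B_down[OF poles_mem[of 0], of 0] by simp

lemma pole_orderD: "1 \<le> s \<Longrightarrow> s \<le> pole_order a n r b \<Longrightarrow> r \<le> b \<and> b \<le> r + n \<and> b \<in> B \<and> s \<le> a"
  using poles_mem[of "b - r"] by (auto simp: pole_order_def split: if_splits)

lemma pt_nonzero: "pt k + of_nat r + of_nat j \<noteq> 0"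
  using pt_add_neq_0[of k "r + j"] by (simp add: add.assoc)

text \<open>Leading words are kept outside the span because \<open>s # w\<close> may have length
  \<open>l\<close>, which the span excludes. All poles of order \<open>s\<close> have the same
  leading term, so its coefficient is the sum of \<open>c (Pole j s)\<close> over
  \<open>j\<close>.\<close>

lemma psum_top:
  assumes c: "\<And>u. c u \<in> K"
    "\<And>k. rfun m a n r (pt k) = (\<Sum>u\<in>pf_factors a n (- defect). c u * factor_eval r u (pt k))"
    and w: "w \<in> G'" "length w < l" "count_list w 1 \<le> E"
    and E: "E \<le> E'" "defect \<le> 1 \<Longrightarrow> E < E'"
    and d: "\<And>f. int f \<le> - defect \<Longrightarrow> Suc f \<le> d'" and cv: "cv \<Longrightarrow> 1 \<le> defect"
  shows "(\<lambda>N. psum (\<lambda>k. rfun m a n r (pt k) * hsum w k) N -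
      (\<Sum>s=1..a. (\<Sum>j\<le>n. c (Pole j s)) * hsum (s # w) N)) \<in>
    kspan K UNIV (post_gens G B E' l d' cv)"
proof -
  let ?T = "kspan K UNIV (post_gens G B E' l d' cv)"
  have "psum (\<lambda>k. pt k ^ q * hsum w k) \<in> ?T" if "int q \<le> - defect" for q
  proof -
    have "psum (\<lambda>k. pt k ^ q * hsum w k) \<in> kspan K UNIV (post_gens G B E' l d' False)"
      using that w E d G'_subset zero_mem by (intro psum_power_post) auto
    moreover have "cv = False" using cv that by auto
    ultimately show ?thesis by simp
  qed
  moreover have "(\<lambda>N. psum (\<lambda>k. 1 / (pt k + of_nat (r + j)) ^ s * hsum w (k + 0)) N -
      hsum (s # w) N) \<in> ?T" if "j \<le> n" "s \<in> {1..a}" for j s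
    using that w E poles_mem by (intro psum_pole Cons_mem) auto
  ultimately have *: "(\<lambda>N. (\<Sum>q | int q \<le> - defect. c (Monomial q) * psum (\<lambda>k. pt k ^ q * hsum w k) N) +
    (\<Sum>j\<le>n. \<Sum>s=1..a. c (Pole j s) *
      (psum (\<lambda>k. 1 / (pt k + of_nat (r + j)) ^ s * hsum w (k + 0)) N - hsum (s # w) N))) \<in> ?T"
    by (intro kspan_add kspan_sum kspan_scale c) auto
  have "psum (\<lambda>k. rfun m a n r (pt k) * hsum w k) N =
      (\<Sum>u\<in>pf_factors a n (- defect). c u * psum (\<lambda>k. factor_eval r u (pt k) * hsum w k) N)" for N
    unfolding psum_def c(2) sum_distrib_right sum_distrib_left
    by (subst sum.swap) (simp add: mult.assoc)
  then have eq: "psum (\<lambda>k. rfun m a n r (pt k) * hsum w k) N =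
      (\<Sum>q | int q \<le> - defect. c (Monomial q) * psum (\<lambda>k. pt k ^ q * hsum w k) N) +
      (\<Sum>j\<le>n. \<Sum>s=1..a. c (Pole j s) *
        psum (\<lambda>k. 1 / (pt k + of_nat (r + j)) ^ s * hsum w (k + 0)) N)" for N
    unfolding sum_factors by (simp add: add.assoc)
  have sw: "(\<Sum>s=1..a. (\<Sum>j\<le>n. c (Pole j s)) * hsum (s # w) N) =
      (\<Sum>j\<le>n. \<Sum>s=1..a. c (Pole j s) * hsum (s # w) N)" for N
    unfolding sum_distrib_right by (rule sum.swap)
  show ?thesis
    by (rule kspan_cong[OF *])
       (simp only: eq sw right_diff_distrib sum_subtractf add_diff_eq)
qed

text \<open>A new letter 1 requires degree at least -1 in front of the harmonic sum. Either the
  rational function has it alone, and then E < E', or a nonconstant power from the inner sum helps,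
  for which \<open>post_gens\<close> has set aside a letter. A product of two poles decays at least
  quadratically and costs nothing.\<close>

lemma psum_step:
  assumes \<Phi>: "\<Phi> \<in> kspan K UNIV (post_gens G' B' E l d False)"
    and E: "E \<le> E'" "defect \<le> 1 \<Longrightarrow> E < E'"
    and d: "\<And>f. int f \<le> int d - defect \<Longrightarrow> Suc f \<le> d'" and cv: "cv \<Longrightarrow> int d - defect \<le> - 2"
  shows "psum (\<lambda>k. rfun m a n r (pt k) * \<Phi> k) \<in> kspan K UNIV (post_gens G B E' (Suc l) d' cv)"
proof -
  let ?T = "kspan K UNIV (post_gens G B E' (Suc l) d' cv)"
  let ?P = "{f. psum f \<in> ?T}"
  let ?S = "kspan K UNIV ?P"
  have hpow: "(\<lambda>k. pt k ^ f * hsum w k) \<in> ?S"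
    if "w \<in> G'" "length w < l" "int f \<le> int d - defect" "count_list w 1 + 1 \<le> E'" for w f
  proof (rule kspan_base, rule CollectI)
    have "psum (\<lambda>k. pt k ^ f * hsum w k) \<in> kspan K UNIV (post_gens G B E' (Suc l) d' False)"
      using that d G'_subset zero_mem by (intro psum_power_post) auto
    moreover have "cv = False" using cv that by auto
    ultimately show "psum (\<lambda>k. pt k ^ f * hsum w k) \<in> ?T" by simp
  qed
  have hpole: "(\<lambda>k. 1 / (pt k + of_nat b) ^ s * hsum w k) \<in> ?S"
    if "s # w \<in> G" "length w < l" "count_list (s # w) 1 \<le> E'" "b \<in> B" "cv \<Longrightarrow> 2 \<le> s" for w s b
    using that by (intro kspan_base[of _ ?P] CollectI psum_pole_post) auto
  have hpair: "(\<lambda>k. (1 / (pt k + of_nat b) - 1 / (pt k + of_nat c)) * hsum w k) \<in> ?S"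
    if "1 # w \<in> G" "length w < l" "count_list w 1 \<le> E'" "b \<in> B" "c \<in> B" for w b c
    using that by (intro kspan_base[of _ ?P] CollectI psum_pair_post) auto
  \<comment> \<open>Whether the orders add up or the product is split, only orders at least 2 and
    differences of simple poles occur; neither the number of ones nor convergence is put at
    risk.\<close>
  have pp: "(\<lambda>k. 1 / (pt k + of_nat b) ^ t * (1 / (pt k + of_nat c) ^ s) * hsum w k) \<in> ?S"
    if w: "t # w \<in> G'" "length w < l" "count_list w 1 \<le> E" and b: "b \<in> B'" "1 \<le> t"
      and c: "r \<le> c" "c \<le> r + n" "c \<in> B" "1 \<le> s" "s \<le> a" for w b c s t
  proof (cases "b = c")
    case True
    have "(\<lambda>k. 1 / (pt k + of_nat c) ^ (s + t) * hsum w k) \<in> ?S"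
      using that True E by (intro hpole merge_mem) auto
    then show ?thesis by (rule kspan_cong) (simp add: True power_add mult.commute)
  next
    case False
    have tw: "t # w \<in> G" using w G'_subset by auto
    have sw: "i # w \<in> G" if "1 \<le> i" "i \<le> s" for i
      using tl_mem'[OF w(1)] that c by (intro Cons_mem) auto
    have "(\<lambda>k. 1 / (pt k + of_nat b) ^ t * (1 / (pt k + of_nat c) ^ s) * hsum w k) \<in> ?S"
    proof (rule kspan_pole_prod)
      show "(\<lambda>k. 1 / (pt k + of_nat b) ^ i * hsum w k) \<in> ?S" if "2 \<le> i" "i \<le> t" for i
        using that b w E B'_subset lower_mem[OF tw, of i] by (intro hpole) auto
      show "(\<lambda>k. 1 / (pt k + of_nat c) ^ i * hsum w k) \<in> ?S" if "2 \<le> i" "i \<le> s" for i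
        using that c w E sw by (intro hpole) auto
      have "(\<lambda>k. (1 / (pt k + of_nat b) - 1 / (pt k + of_nat c)) * hsum w k) \<in> ?S"
        using b c w E B'_subset sw[of 1] by (intro hpair) auto
      then show "(\<lambda>k. 1 / (pt k + of_nat b) * hsum w k - 1 / (pt k + of_nat c) * hsum w k) \<in> ?S"
        by (rule kspan_cong) (rule left_diff_distrib)
    qed (use False b c in auto)
    then show ?thesis .
  qed
  have "(\<lambda>k. \<Phi> k * rfun m a n r (pt k)) \<in> ?S"
  proof (rule kspan_mult[OF \<Phi>])
    fix g assume "g \<in> post_gens G' B' E l d False"
    then show "(\<lambda>k. g k * rfun m a n r (pt k)) \<in> ?S"
    proof cases
      case (post_power w f)
      \<comment> \<open>The inner power joins the numerator before the partial fraction expansion,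
        so that the total degree \<open>f - defect\<close> decides whether single simple poles
        occur.\<close>
      have "(\<lambda>k. rfun (m + f) a n r (pt k)) \<in>
          kspan K UNIV (pf_gens pt (pole_order a n r) (int (m + f) - int (a * (n + 1))))"
        by (rule kspan_rfun) (rule pt_nonzero)
      then have "(\<lambda>k. rfun (m + f) a n r (pt k) * hsum w k) \<in> ?S"
      proof (rule kspan_mult)
        fix u assume "u \<in> pf_gens pt (pole_order a n r) (int (m + f) - int (a * (n + 1)))"
        then show "(\<lambda>k. u k * hsum w k) \<in> ?S"
        proof cases
          case (power q)
          then have q: "int q \<le> int f - defect" by (simp add: defect_def)
          have "(\<lambda>k. pt k ^ q * hsum w k) \<in> ?S"
            using post_power q E by (intro hpow) (auto split: if_splits)
          then show ?thesis by (simp add: power)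
        next
          case (pole s b)
          have q: "- 1 \<le> int f - defect" if "s = 1" using pole(4) that by (simp add: defect_def)
          have "(\<lambda>k. 1 / (pt k + of_nat b) ^ s * hsum w k) \<in> ?S"
          proof (rule hpole)
            show "s # w \<in> G" using post_power pole pole_orderD[OF pole(2,3)] by (intro Cons_mem) auto
            show "count_list (s # w) 1 \<le> E'"
              using post_power E q by (cases "s = 1") (auto split: if_splits)
            show "2 \<le> s" if cv using cv[OF that] q post_power pole(2) by (cases "s = 1") auto
          qed (use post_power pole_orderD[OF pole(2,3)] in auto)
          then show ?thesis by (simp add: pole)
        next
          case (pair b c)
          have bc: "b \<in> B" "c \<in> B" "1 \<le> a"
            using pole_orderD[OF _ pair(2)] pole_orderD[OF _ pair(3)] by auto
          then show ?thesis
            unfolding pair(1) using post_power E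
            by (intro hpair Cons_mem)
              (auto split: if_splits)
        qed
      qed
      then show ?thesis by (rule kspan_cong) (simp add: post_power rfun_def power_add)
    next
      case (post_pole b t w)
      let ?h = "\<lambda>k. 1 / (pt k + of_nat b) ^ t * hsum w k"
      have tw: "t # w \<in> G" and wG: "w \<in> G'"
        using post_pole G'_subset tl_mem' by auto
      have "(\<lambda>k. rfun m a n r (pt k)) \<in>
          kspan K UNIV (pf_gens pt (pole_order a n r) (int m - int (a * (n + 1))))"
        by (rule kspan_rfun) (rule pt_nonzero)
      then have "(\<lambda>k. rfun m a n r (pt k) * ?h k) \<in> ?S"
      proof (rule kspan_mult)
        fix u assume "u \<in> pf_gens pt (pole_order a n r) (int m - int (a * (n + 1)))"
        then show "(\<lambda>k. u k * ?h k) \<in> ?S"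
        proof cases
          case (power q)
          then have q: "int q \<le> - defect" by (simp add: defect_def)
          then have E'': "E < E'" using E by auto
          have "(\<lambda>k. pt k ^ q * (1 / (pt k + of_nat b) ^ t) * hsum w k) \<in> ?S"
          proof (rule kspan_power_pole)
            show "(\<lambda>k. pt k ^ i * hsum w k) \<in> ?S" if "i + t \<le> q" for i
              using that q post_pole E'' wG by (intro hpow) auto
            show "(\<lambda>k. 1 / (pt k + of_nat b) ^ i * hsum w k) \<in> ?S" if "1 \<le> i" "i \<le> t" for i
              using that q post_pole E'' lower_mem[OF tw that] B'_subset cv by (intro hpole) auto
          qed (rule pt_add_neq_0)
          then show ?thesis by (rule kspan_cong) (simp add: power)
        next
          case (pole s c)
          then show ?thesis
            using pp[of t w b c s] post_pole pole_orderD[OF pole(2,3)] by (simp add: mult_ac)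
        next
          case (pair c c')
          have *: "(\<lambda>k. 1 / (pt k + of_nat b) ^ t * (1 / (pt k + of_nat x) ^ 1) * hsum w k) \<in> ?S"
            if "1 \<le> pole_order a n r x" for x
            using post_pole pole_orderD[OF _ that] by (intro pp) auto
          show ?thesis
            by (rule kspan_cong[OF kspan_diff[OF *[OF pair(2)] *[OF pair(3)]]])
               (simp add: pair algebra_simps)
        qed
      qed
      then show ?thesis by (rule kspan_cong) (simp add: post_pole)
    qed
  qed
  then have "(\<lambda>k. rfun m a n r (pt k) * \<Phi> k) \<in> ?S" by (simp only: mult.commute)
  then show ?thesis by (rule kspan_psum) simp
qed

end

section \<open>Admissible words\<close>

text \<open>The block conditions of (b) and (a), for the variables with indices in \<open>{i..<p}\<close>; \<open>hy\<close>
  stands for the hypothesis in (b). Blocks need not cover everything, which makes the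
  condition stable under deleting and decreasing letters.\<close>

primrec good :: "bool \<Rightarrow> nat \<Rightarrow> (nat \<Rightarrow> nat) \<Rightarrow> nat list \<Rightarrow> nat \<Rightarrow> bool" where
  "good hy p A [] i \<longleftrightarrow> True"
| "good hy p A (s # w) i \<longleftrightarrow> (\<exists>j. i < j \<and> j \<le> p \<and> 1 \<le> s \<and>
    (if hy then \<exists>l\<in>{i..<j}. s \<le> A l else s \<le> sum A {i..<j}) \<and> good hy p A w j)"

lemma good_antimono: "good hy p A w j \<Longrightarrow> i \<le> j \<Longrightarrow> good hy p A w i"
proof (cases w)
  case (Cons s u)
  assume *: "good hy p A w j" "i \<le> j"
  then obtain k where k: "j < k" "k \<le> p" "1 \<le> s"
    "if hy then \<exists>l\<in>{j..<k}. s \<le> A l else s \<le> sum A {j..<k}" "good hy p A u k"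
    unfolding Cons by auto
  have "sum A {j..<k} \<le> sum A {i..<k}" using * by (intro sum_mono2) auto
  then have "if hy then \<exists>l\<in>{i..<k}. s \<le> A l else s \<le> sum A {i..<k}"
    using k * by (fastforce split: if_splits)
  then show ?thesis using k * by (auto simp: Cons intro!: exI[of _ k])
qed simp

lemma good_drop: "good hy p A (x @ v) i \<Longrightarrow> good hy p A v i"
proof (induction x arbitrary: i)
  case (Cons a x)
  then obtain j where "i < j" "good hy p A v j" by auto
  then show ?case by (auto intro: good_antimono[OF _ less_imp_le])
qed simp

lemma good_pole_word:
  "good hy p A (x @ v) i \<Longrightarrow> y \<in> set x \<Longrightarrow> 1 \<le> t \<Longrightarrow> t \<le> y \<Longrightarrow> good hy p A (t # v) i"
proof (induction x arbitrary: i)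
  case (Cons a x)
  then obtain j where j: "i < j" "j \<le> p" "if hy then \<exists>l\<in>{i..<j}. a \<le> A l else a \<le> sum A {i..<j}"
    "good hy p A (x @ v) j" by auto
  show ?case
  proof (cases "y = a")
    case True
    then show ?thesis
      using j Cons.prems good_drop[OF j(4)] by (auto intro!: exI[of _ j] split: if_splits dest: order_trans)
  next
    case False
    then have "good hy p A (t # v) j" using Cons j by auto
    then show ?thesis by (rule good_antimono[OF _ less_imp_le[OF j(1)]])
  qed
qed simp

lemma good_pos: "good hy p A w i \<Longrightarrow> \<forall>y\<in>set w. 1 \<le> y"
  by (induction w arbitrary: i) auto

lemma good_Cons:
  "good hy p A w (Suc i) \<Longrightarrow> i < p \<Longrightarrow> 1 \<le> s \<Longrightarrow> s \<le> A i \<Longrightarrow> good hy p A (s # w) i"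
  by (auto intro!: exI[of _ "Suc i"])

text \<open>The block of \<open>t\<close> is extended to the left by the index \<open>i\<close>, and
  \<open>A i\<close> pays for \<open>s\<close>. A condition on one index per block would not survive
  this, so the flag is \<open>False\<close>.\<close>

lemma good_merge:
  assumes "good False p A (t # w) (Suc i)" "s \<le> A i"
  shows "good False p A ((s + t) # w) i"
proof -
  obtain j where j: "Suc i < j" "j \<le> p" "1 \<le> t" "t \<le> sum A {Suc i..<j}" "good False p A w j"
    using assms by auto
  then have "s + t \<le> sum A {i..<j}"
    using assms(2) by (subst sum.atLeast_Suc_lessThan) auto
  then show ?thesis using j by (auto intro!: exI[of _ j])
qed

text \<open>Successive blocks already abut; the last one is stretched to end at \<open>p\<close>,
  which can only increase its sum. A bound by a single \<open>A l\<close> of the block is also a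
  bound by the sum.\<close>

lemma good_cond_a:
  "good hy p A w i \<Longrightarrow> w \<noteq> [] \<Longrightarrow> \<exists>l. l 0 = i \<and> l (length w) = p \<and>
    (\<forall>j<length w. l j < l (Suc j) \<and> w ! j \<le> (\<Sum>k\<in>{l j..<l (Suc j)}. A k))"
proof (induction w arbitrary: i)
  case (Cons s u)
  then obtain j where j: "i < j" "j \<le> p" "if hy then \<exists>l\<in>{i..<j}. s \<le> A l else s \<le> sum A {i..<j}"
    "good hy p A u j" by auto
  have s: "s \<le> sum A {i..<j}"
  proof (cases hy)
    case True
    then obtain l where l: "l \<in> {i..<j}" "s \<le> A l" using j by auto
    have "A l \<le> sum A {i..<j}" using l(1) by (intro member_le_sum) auto
    then show ?thesis using l by simp
  qed (use j in simp)
  show ?case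
  proof (cases "u = []")
    case True
    have "sum A {i..<j} \<le> sum A {i..<p}" using j by (intro sum_mono2) auto
    then show ?thesis using True j s by (intro exI[of _ "\<lambda>k. if k = 0 then i else p"]) auto
  next
    case False
    obtain l where l: "l 0 = j" "l (length u) = p"
      "\<forall>j<length u. l j < l (Suc j) \<and> u ! j \<le> (\<Sum>k\<in>{l j..<l (Suc j)}. A k)"
      using Cons.IH[OF j(4) False] by auto
    show ?thesis
      using l j s by (intro exI[of _ "case_nat i l"]) (auto simp: nth_Cons split: nat.splits)
  qed
qed simp

lemma good_embedding:
  "good True p A w i \<Longrightarrow> \<exists>h :: nat \<Rightarrow> nat. strict_mono_on {..<length w} h \<and>
    (\<forall>l<length w. i \<le> h l \<and> h l < p \<and> 1 \<le> w ! l \<and> w ! l \<le> A (h l))"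
proof (induction w arbitrary: i)
  case Nil
  then show ?case by (auto simp: strict_mono_on_def)
next
  case (Cons s u)
  then obtain j l where j: "i < j" "j \<le> p" "1 \<le> s" "l \<in> {i..<j}" "s \<le> A l" "good True p A u j"
    by auto
  obtain h where h: "strict_mono_on {..<length u} h"
    "\<forall>l<length u. j \<le> h l \<and> h l < p \<and> 1 \<le> u ! l \<and> u ! l \<le> A (h l)"
    using Cons.IH[OF j(6)] by auto
  have "strict_mono_on {..<length (s # u)} (case_nat l h)"
  proof (rule strict_mono_onI)
    fix a b assume "a \<in> {..<length (s # u)}" "b \<in> {..<length (s # u)}" "a < b"
    then show "case_nat l h a < case_nat l h b"
      using h(2) j strict_mono_onD[OF h(1)] by (cases a; cases b) (auto intro: less_le_trans)
  qed
  then show ?case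
    using h j by (intro exI[of _ "case_nat l h"]) (force simp: nth_Cons split: nat.splits)
qed

section \<open>Iterated summation\<close>

text \<open>This treats one monomial of the numerator, with exponents \<open>m i\<close>;
  \<open>c i\<close> holds the partial fraction coefficients of its factor in variable
  \<open>i\<close>.\<close>

locale nested = complex_subfield K for K :: "complex set" +
  fixes hy :: bool and p :: nat and A n r m :: "nat \<Rightarrow> nat"
    and c :: "nat \<Rightarrow> pf_factor \<Rightarrow> complex"
  assumes hy: "hy \<Longrightarrow> Suc i < p \<Longrightarrow> r (Suc i) + n (Suc i) + 1 \<le> r i"
    and c_mem: "c i u \<in> K"
    and residue: "int (m i) - int (A i * (n i + 1)) \<le> - 2 \<Longrightarrow> (\<Sum>j\<le>n i. c i (Pole j 1)) = 0"
    and expansion: "(\<And>j. j \<le> n i \<Longrightarrow> x + of_nat (r i) + of_nat j \<noteq> 0) \<Longrightarrow>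
      rfun (m i) (A i) (n i) (r i) x =
      (\<Sum>u\<in>pf_factors (A i) (n i) (int (m i) - int (A i * (n i + 1))). c i u * factor_eval (r i) u x)"
begin

abbreviation e :: "nat \<Rightarrow> int" where
  "e i \<equiv> int (A i * (n i + 1)) - int (m i)"

text \<open>The condition \<open>e l \<le> 1\<close> says that the exponent of variable
  \<open>l\<close> is at least \<open>A l * (n l + 1) - 1\<close>, as in the count of (b). Only then
  can the residues in that variable have a nonzero sum.\<close>

definition ones :: "nat \<Rightarrow> nat" where
  "ones i = card {l. i \<le> l \<and> l < p \<and> e l \<le> 1}"

text \<open>Under \<open>hy\<close> every element of \<open>poles (Suc i)\<close> is below
  \<open>r i\<close>, so it misses the poles of variable \<open>i\<close>. Beyond the last variable
  nothing has been summed and the set is empty. Without \<open>hy\<close> poles may collide and no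
  restriction is imposed.\<close>

definition poles :: "nat \<Rightarrow> nat set" where
  "poles i = {b. hy \<longrightarrow> i < p \<and> b \<le> r i + n i}"

definition words :: "nat \<Rightarrow> nat list set" where
  "words i = {w. good hy p A w i}"

primrec nest :: "nat \<Rightarrow> nat \<Rightarrow> nat \<Rightarrow> complex" where
  "nest 0 i N = 1"
| "nest (Suc q) i N = psum (\<lambda>k. rfun (m i) (A i) (n i) (r i) (pt k) * nest q (Suc i) k) N"

primrec top_words :: "nat \<Rightarrow> nat \<Rightarrow> nat list set" where
  "top_words 0 i = {[]}"
| "top_words (Suc q) i = (\<lambda>(s, w). s # w) ` ({1..A i} \<times> top_words q (Suc i))"

primrec coef :: "nat list \<Rightarrow> nat \<Rightarrow> complex" where
  "coef [] i = 1"
| "coef (s # w) i = (\<Sum>j\<le>n i. c i (Pole j s)) * coef w (Suc i)"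

text \<open>Multiplication by the rational function lowers the degree by \<open>e i\<close> and
  summation raises it by one. The truncation by \<open>nat\<close> leaves room for constants, which
  persist when this number is negative.\<close>

primrec pol_deg :: "nat \<Rightarrow> nat \<Rightarrow> nat" where
  "pol_deg 0 i = 0"
| "pol_deg (Suc q) i = nat (int (pol_deg q (Suc i)) - e i + 1)"

section \<open>Leading words and their coefficients\<close>

lemma finite_top_words: "finite (top_words q i)"
  by (induction q arbitrary: i) auto

lemma coef_closed: "coef w i \<in> K"
  by (induction w arbitrary: i) (auto intro!: mult_closed sum_closed c_mem)

lemma length_top_words: "w \<in> top_words q i \<Longrightarrow> length w = q"
  by (induction q arbitrary: i w) auto

lemma sum_top_words_Suc:
  "(\<Sum>v\<in>top_words (Suc q) i. f v) = (\<Sum>w\<in>top_words q (Suc i). \<Sum>s=1..A i. f (s # w))"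
proof -
  have "(\<Sum>v\<in>top_words (Suc q) i. f v) = (\<Sum>(s, w)\<in>{1..A i} \<times> top_words q (Suc i). f (s # w))"
    by (simp add: sum.reindex inj_on_def case_prod_beta)
  also have "\<dots> = (\<Sum>s=1..A i. \<Sum>w\<in>top_words q (Suc i). f (s # w))"
    by (rule sum.cartesian_product[symmetric])
  finally show ?thesis by (simp only: sum.swap[of _ "top_words q (Suc i)"])
qed

lemma top_words_good: "w \<in> top_words q i \<Longrightarrow> i + q = p \<Longrightarrow> w \<in> words i"
proof (induction q arbitrary: i w)
  case (Suc q)
  then show ?case by (auto simp: words_def simp del: good.simps intro!: good_Cons)
qed (simp add: words_def)

lemma ones_Suc: "i < p \<Longrightarrow> ones i = (if e i \<le> 1 then 1 else 0) + ones (Suc i)"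
proof -
  assume "i < p"
  then have "{l. i \<le> l \<and> l < p \<and> e l \<le> 1} =
      (if e i \<le> 1 then insert i else id) {l. Suc i \<le> l \<and> l < p \<and> e l \<le> 1}"
    by (auto simp: le_less Suc_le_eq)
  then show ?thesis unfolding ones_def by auto
qed

text \<open>A letter 1 for variable \<open>i\<close> contributes the sum of the residues as a factor
  of the coefficient; if this is nonzero, \<open>residue\<close> forces
  \<open>e i \<le> 1\<close>.\<close>

lemma coef_nz_ones:
  "w \<in> top_words q i \<Longrightarrow> i + q = p \<Longrightarrow> coef w i \<noteq> 0 \<Longrightarrow> count_list w 1 \<le> ones i"
proof (induction q arbitrary: i w)
  case (Suc q)
  then obtain s u where w: "w = s # u" "u \<in> top_words q (Suc i)" by auto
  have "count_list u 1 \<le> ones (Suc i)" using Suc w by auto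
  moreover have "e i \<le> 1" if "s = 1" using that Suc.prems(3) residue[of i] w by force
  ultimately show ?case using Suc.prems(2) w by (auto simp: ones_Suc)
qed simp

lemma coef_nz_hd:
  "w \<in> top_words (Suc q) i \<Longrightarrow> coef w i \<noteq> 0 \<Longrightarrow> 2 \<le> e i \<Longrightarrow> 2 \<le> hd w"
proof -
  assume w: "w \<in> top_words (Suc q) i" "coef w i \<noteq> 0" and e: "2 \<le> e i"
  then obtain s u where s: "w = s # u" "1 \<le> s" by auto
  have "s \<noteq> 1" using w(2) residue[of i] e s by auto
  then show ?thesis using s by simp
qed

text \<open>The depth \<open>p\<close> formula concerns all words with positive letters; this
  confines the nonzero coefficients to a finite set.\<close>

lemma coef_nz_top_words:
  assumes "\<And>i j s. A i < s \<Longrightarrow> c i (Pole j s) = 0"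
  shows "coef w i \<noteq> 0 \<Longrightarrow> \<forall>x\<in>set w. 1 \<le> x \<Longrightarrow> w \<in> top_words (length w) i"
proof (induction w arbitrary: i)
  case (Cons s w)
  have "(\<Sum>j\<le>n i. c i (Pole j s)) \<noteq> 0" using Cons.prems by simp
  then have "s \<le> A i" using assms[of i s] by (metis not_le sum.neutral)
  then show ?case using Cons by auto
qed simp

lemma word_step: "i < p \<Longrightarrow>
  word_step K (words i) (poles i) (words (Suc i)) (poles (Suc i)) (A i) (n i) (r i)"
proof unfold_locales
  assume i: "i < p"
  show "[] \<in> words i" by (simp add: words_def)
  show "\<forall>y\<in>set w. 1 \<le> y" if "w \<in> words i" for w using that good_pos by (auto simp: words_def)
  show "t # v \<in> words i" if "w \<in> words i" "(t, v) \<in> pole_words w" for w t v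
    using that good_pole_word unfolding words_def pole_words_def by blast
  show "j \<in> poles i" if "b \<in> poles i" "j \<le> b" for b j using that by (auto simp: poles_def)
  show "words (Suc i) \<subseteq> words i" using good_antimono by (auto simp: words_def)
  show "poles (Suc i) \<subseteq> poles i" using hy[of i] by (auto simp: poles_def)
  show "w \<in> words (Suc i)" if "t # w \<in> words (Suc i)" for t w
    using good_drop[of hy p A "[t]" w] that by (auto simp: words_def)
  show "r i + j \<in> poles i" if "j \<le> n i" for j using that i by (auto simp: poles_def)
  show "s # w \<in> words i" if "w \<in> words (Suc i)" "1 \<le> s" "s \<le> A i" for w s
    using that i good_Cons by (auto simp: words_def simp del: good.simps)
  show "(s + t) # w \<in> words i" if "t # w \<in> words (Suc i)" "1 \<le> s" "s \<le> A i" "r i \<le> b"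
    "b \<le> r i + n i" "b \<in> poles (Suc i)" for t w s b
  proof -
    have "\<not> hy" using hy[of i] that by (auto simp: poles_def)
    then have "hy = False" by simp
    then show ?thesis
      using that(1,3) good_merge unfolding words_def mem_Collect_eq by (simp del: good.simps)
  qed
qed

text \<open>The remainder of the inner sum goes through \<open>psum_step\<close> and its leading
  part through \<open>psum_top\<close>. The leading terms put out by the latter assemble to those of
  \<open>top_words (Suc q) i\<close>.\<close>

lemma nest_step:
  assumes iq: "i + Suc q = p"
    and IH: "(\<lambda>N. nest q (Suc i) N - (\<Sum>w\<in>top_words q (Suc i). coef w (Suc i) * hsum w N)) \<in>
      kspan K UNIV (post_gens (words (Suc i)) (poles (Suc i)) (ones (Suc i)) q d False)"
    and d: "\<And>f. int f \<le> int d - e i \<Longrightarrow> Suc f \<le> d'" and cv: "cv \<Longrightarrow> int d - e i \<le> - 2"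
  shows "(\<lambda>N. nest (Suc q) i N - (\<Sum>w\<in>top_words (Suc q) i. coef w i * hsum w N)) \<in>
      kspan K UNIV (post_gens (words i) (poles i) (ones i) (Suc q) d' cv)"
proof -
  interpret word_step K "words i" "poles i" "words (Suc i)" "poles (Suc i)" "m i" "A i" "n i" "r i"
    using iq by (intro word_step) auto
  let ?T = "kspan K UNIV (post_gens (words i) (poles i) (ones i) (Suc q) d' cv)"
  let ?R = "\<lambda>k. rfun (m i) (A i) (n i) (r i) (pt k)"
  let ?W = "top_words q (Suc i)"
  have ones: "ones (Suc i) \<le> ones i" "e i \<le> 1 \<Longrightarrow> ones (Suc i) < ones i"
    using ones_Suc[of i] iq by auto
  have de: "defect = e i" by (simp add: defect_def)
  have 1: "psum (\<lambda>k. ?R k * (nest q (Suc i) k - (\<Sum>w\<in>?W. coef w (Suc i) * hsum w k))) \<in> ?T"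
    by (rule psum_step[OF IH ones[folded de]]) (use d cv de in auto)
  have 2: "(\<lambda>N. coef w (Suc i) * (psum (\<lambda>k. ?R k * hsum w k) N -
      (\<Sum>s=1..A i. (\<Sum>j\<le>n i. c i (Pole j s)) * hsum (s # w) N))) \<in> ?T" if w: "w \<in> ?W" for w
  \<comment> \<open>A bound on the ones of \<open>w\<close> is available only when its coefficient
    is nonzero.\<close>
  proof (cases "coef w (Suc i) = 0")
    case True
    then show ?thesis by (auto intro: kspan_zero)
  next
    case False
    have "count_list w 1 \<le> ones (Suc i)" using coef_nz_ones[OF w _ False] iq by auto
    moreover have "w \<in> words (Suc i)" using top_words_good[OF w] iq by auto
    moreover have "?R k = (\<Sum>u\<in>pf_factors (A i) (n i) (- defect). c i u * factor_eval (r i) u (pt k))" for k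
      using expansion[of i "pt k"] pt_nonzero de by simp
    ultimately show ?thesis
      using length_top_words[OF w] ones d cv unfolding de[symmetric]
      by (intro kspan_scale[OF coef_closed] psum_top[of "c i", OF c_mem]) force+
  qed
  have "(\<lambda>N. psum (\<lambda>k. ?R k * (nest q (Suc i) k - (\<Sum>w\<in>?W. coef w (Suc i) * hsum w k))) N +
    (\<Sum>w\<in>?W. coef w (Suc i) * (psum (\<lambda>k. ?R k * hsum w k) N -
      (\<Sum>s=1..A i. (\<Sum>j\<le>n i. c i (Pole j s)) * hsum (s # w) N)))) \<in> ?T"
    by (intro kspan_add kspan_sum 1 2)
  then show ?thesis
  proof (rule kspan_cong)
    fix N :: nat
    have "psum (\<lambda>k. ?R k * (nest q (Suc i) k - (\<Sum>w\<in>?W. coef w (Suc i) * hsum w k))) N =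
        nest (Suc q) i N - (\<Sum>w\<in>?W. coef w (Suc i) * psum (\<lambda>k. ?R k * hsum w k) N)"
      unfolding psum_def nest.simps right_diff_distrib sum_subtractf sum_distrib_left
      by (subst (2) sum.swap) (simp add: mult.left_commute)
    moreover have "(\<Sum>v\<in>top_words (Suc q) i. coef v i * hsum v N) =
        (\<Sum>w\<in>?W. coef w (Suc i) * (\<Sum>s=1..A i. (\<Sum>j\<le>n i. c i (Pole j s)) * hsum (s # w) N))"
      unfolding sum_top_words_Suc sum_distrib_left by (simp add: mult_ac del: hsum.simps)
    ultimately show "psum (\<lambda>k. ?R k * (nest q (Suc i) k - (\<Sum>w\<in>?W. coef w (Suc i) * hsum w k))) N +
        (\<Sum>w\<in>?W. coef w (Suc i) * (psum (\<lambda>k. ?R k * hsum w k) N -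
          (\<Sum>s=1..A i. (\<Sum>j\<le>n i. c i (Pole j s)) * hsum (s # w) N))) =
        nest (Suc q) i N - (\<Sum>w\<in>top_words (Suc q) i. coef w i * hsum w N)"
      by (simp only: right_diff_distrib sum_subtractf) (simp del: hsum.simps nest.simps coef.simps)
  qed
qed

lemma nest_expansion:
  "i + q = p \<Longrightarrow> (\<lambda>N. nest q i N - (\<Sum>w\<in>top_words q i. coef w i * hsum w N)) \<in>
    kspan K UNIV (post_gens (words i) (poles i) (ones i) q (pol_deg q i) False)"
proof (induction q arbitrary: i)
  case 0
  then show ?case by (auto intro: kspan_zero)
next
  case (Suc q)
  show ?case by (rule nest_step[OF Suc.prems Suc.IH]) (use Suc.prems in auto)
qed

text \<open>Unfolding the recursion shows \<open>pol_deg q i\<close> to be the largest among 0 and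
  the sums of \<open>1 - e l\<close> over i \<le> l < j. In the induction the bound \<open>t\<close>
  has to move by \<open>e i - 1\<close>.\<close>

lemma pol_deg_le:
  "i + q = p \<Longrightarrow> 0 \<le> t \<Longrightarrow> (\<And>j. i < j \<Longrightarrow> j \<le> p \<Longrightarrow> (\<Sum>l\<in>{i..<j}. 1 - e l) \<le> t) \<Longrightarrow>
    int (pol_deg q i) \<le> t"
proof (induction q arbitrary: i t)
  case (Suc q)
  have s: "(\<Sum>l\<in>{i..<j}. 1 - e l) = 1 - e i + (\<Sum>l\<in>{Suc i..<j}. 1 - e l)" if "i < j" for j
    using that by (rule sum.atLeast_Suc_lessThan)
  have "int (pol_deg q (Suc i)) \<le> t + e i - 1"
  proof (rule Suc.IH)
    show "0 \<le> t + e i - 1" using Suc.prems(1) Suc.prems(3)[of "Suc i"] by simp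
    show "(\<Sum>l\<in>{Suc i..<j}. 1 - e l) \<le> t + e i - 1" if "Suc i < j" "j \<le> p" for j
      using Suc.prems(3)[of j] s[of j] that by simp
  qed (use Suc.prems in auto)
  then show ?case using Suc.prems(2) by simp
qed simp

text \<open>Taking \<open>e 0\<close> out of the sum of \<open>e l\<close> over l < j, which is at
  least j + 1, bounds the sums of \<open>1 - e l\<close> over 1 \<le> l < j by
  \<open>e 0 - 2\<close>. Hence the outermost summand has degree at most -2, and the last step can
  be made with the convergence flag and degree 0.\<close>

lemma nest_expansion_final:
  assumes "1 \<le> p" and dec: "\<And>j. 1 \<le> j \<Longrightarrow> j \<le> p \<Longrightarrow> int j + 1 \<le> (\<Sum>l<j. e l)"
  shows "(\<lambda>N. nest p 0 N - (\<Sum>w\<in>top_words p 0. coef w 0 * hsum w N)) \<in>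
    kspan K UNIV (post_gens (words 0) (poles 0) (ones 0) p 0 True)"
proof -
  obtain q where q: "p = Suc q" using assms(1) by (cases p) auto
  have "2 \<le> e 0" using dec[of 1] q by simp
  have "int (pol_deg q 1) \<le> e 0 - 2"
  proof (rule pol_deg_le)
    show "(\<Sum>l\<in>{1..<j}. 1 - e l) \<le> e 0 - 2" if "1 < j" "j \<le> p" for j
    proof -
      have "(\<Sum>l<j. e l) = e 0 + (\<Sum>l\<in>{1..<j}. e l)"
        using that by (simp add: lessThan_atLeast0 sum.atLeast_Suc_lessThan)
      then show ?thesis using dec[of j] that by (simp add: sum_subtractf of_nat_diff)
    qed
  qed (use q \<open>2 \<le> e 0\<close> in auto)
  then have "int (pol_deg q 1) - e 0 \<le> - 2" by simp
  then have "(\<lambda>N. nest (Suc q) 0 N - (\<Sum>w\<in>top_words (Suc q) 0. coef w 0 * hsum w N)) \<in>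
      kspan K UNIV (post_gens (words 0) (poles 0) (ones 0) (Suc q) 0 True)"
    using q nest_expansion[of 1 q] by (intro nest_step[where d = "pol_deg q 1"]) auto
  then show ?thesis by (simp only: q[symmetric])
qed

end

section \<open>Convergence\<close>

definition pos_lists :: "nat \<Rightarrow> nat list set" where
  "pos_lists p = {k. length k = p \<and> (\<forall>x\<in>set k. 1 \<le> x)}"

lemma lists_Suc_conv:
  "{k. length k = Suc p \<and> (\<forall>i<Suc p. k ! i \<in> S i)} =
    (\<lambda>(x, k). x # k) ` (S 0 \<times> {k. length k = p \<and> (\<forall>i<p. k ! i \<in> S (Suc i))})"
proof (intro subset_antisym subsetI)
  fix k assume k: "k \<in> {k. length k = Suc p \<and> (\<forall>i<Suc p. k ! i \<in> S i)}"
  then obtain x u where xu: "k = x # u" by (cases k) auto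
  have "x \<in> S 0" using k xu by (auto dest: spec[of _ 0])
  moreover have "u ! i \<in> S (Suc i)" if "i < p" for i
    using k xu that by (auto dest: spec[of _ "Suc i"])
  ultimately show "k \<in> (\<lambda>(x, k). x # k) ` (S 0 \<times> {k. length k = p \<and> (\<forall>i<p. k ! i \<in> S (Suc i))})"
    using k xu by auto
qed (auto simp: nth_Cons split: nat.splits)

lemma finite_lists_nth:
  "(\<And>i. i < p \<Longrightarrow> finite (S i)) \<Longrightarrow> finite {k. length k = p \<and> (\<forall>i<p. k ! i \<in> S i)}"
proof (induction p arbitrary: S)
  case (Suc p)
  then show ?case unfolding lists_Suc_conv by (intro finite_imageI finite_cartesian_product) auto
qed simp

lemma sum_prod_lists:
  fixes g :: "nat \<Rightarrow> 'b \<Rightarrow> 'a::comm_semiring_1"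
  shows "(\<Sum>k | length k = p \<and> (\<forall>i<p. k ! i \<in> S i). \<Prod>i<p. g i (k ! i)) = (\<Prod>i<p. \<Sum>x\<in>S i. g i x)"
proof (induction p arbitrary: S g)
  case (Suc p)
  have "(\<Sum>k | length k = Suc p \<and> (\<forall>i<Suc p. k ! i \<in> S i). \<Prod>i<Suc p. g i (k ! i)) =
      (\<Sum>x\<in>S 0. \<Sum>k | length k = p \<and> (\<forall>i<p. k ! i \<in> S (Suc i)). g 0 x * (\<Prod>i<p. g (Suc i) (k ! i)))"
    unfolding lists_Suc_conv
    by (subst sum.reindex)
       (auto simp: inj_on_def prod.lessThan_Suc_shift sum.cartesian_product case_prod_beta
         simp del: prod.lessThan_Suc)
  also have "\<dots> = (\<Prod>i<Suc p. \<Sum>x\<in>S i. g i x)"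
    unfolding sum_distrib_left[symmetric] Suc.IH[of "\<lambda>i. g (Suc i)" "\<lambda>i. S (Suc i)"]
    by (simp add: sum_distrib_right[symmetric] prod.lessThan_Suc_shift del: prod.lessThan_Suc)
  finally show ?case .
qed simp

text \<open>A finite set of lists lies in a box, over which the sum factors into the
  \<open>p\<close>-th power of a partial sum of a convergent series.\<close>

lemma summable_on_pos_lists:
  assumes t: "1 < t"
  shows "(\<lambda>k. \<Prod>i<p. real (k ! i) powr - t) summable_on pos_lists p"
proof (rule nonneg_bdd_above_summable_on)
  have sm: "summable (\<lambda>n. real n powr - t)" using t by (simp add: summable_real_powr_iff)
  show "bdd_above (sum (\<lambda>k. \<Prod>i<p. real (k ! i) powr - t) ` {F. F \<subseteq> pos_lists p \<and> finite F})"
  proof (rule bdd_aboveI2)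
    fix F assume F: "F \<in> {F. F \<subseteq> pos_lists p \<and> finite F}"
    define N where "N = Max (insert 0 (\<Union>k\<in>F. set k))"
    let ?L = "{k. length k = p \<and> (\<forall>i<p. k ! i \<in> {..N})}"
    have fin: "finite (insert 0 (\<Union>k\<in>F. set k))" using F by auto
    have "F \<subseteq> ?L"
    proof
      fix k assume "k \<in> F"
      then have "length k = p" using F by (auto simp: pos_lists_def)
      moreover have "k ! i \<le> N" if "i < length k" for i
        unfolding N_def using fin \<open>k \<in> F\<close> nth_mem[OF that] by (intro Max_ge) auto
      ultimately show "k \<in> ?L" by auto
    qed
    moreover have "finite ?L" by (rule finite_lists_nth) auto
    ultimately have "(\<Sum>k\<in>F. \<Prod>i<p. real (k ! i) powr - t) \<le> (\<Sum>k\<in>?L. \<Prod>i<p. real (k ! i) powr - t)"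
      by (intro sum_mono2) (auto intro: prod_nonneg)
    also have "\<dots> = (\<Sum>x\<le>N. real x powr - t) ^ p"
      by (subst sum_prod_lists) simp
    also have "\<dots> \<le> (suminf (\<lambda>n. real n powr - t)) ^ p"
      by (intro power_mono sum_le_suminf sm sum_nonneg) auto
    finally show "(\<Sum>k\<in>F. \<Prod>i<p. real (k ! i) powr - t) \<le> (suminf (\<lambda>n. real n powr - t)) ^ p" .
  qed
qed (auto intro: prod_nonneg)

text \<open>Abel summation: replacing all weights by the smallest one can only decrease the sum, and
  then the sign of the full sum of \<open>g\<close> decides.\<close>

lemma weighted_sum_nonneg:
  fixes g y :: "nat \<Rightarrow> real"
  assumes "\<And>i. Suc i < p \<Longrightarrow> y (Suc i) \<le> y i" "\<And>i. i < p \<Longrightarrow> 0 \<le> y i"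
    and "\<And>j. j \<le> p \<Longrightarrow> 0 \<le> (\<Sum>i<j. g i)"
  shows "0 \<le> (\<Sum>i<p. g i * y i)"
proof (cases p)
  case (Suc q)
  have "(\<Sum>i<Suc j. g i) * y j \<le> (\<Sum>i<Suc j. g i * y i)" if "j < p" for j
    using that
  proof (induction j)
    case (Suc j)
    have "(\<Sum>i<Suc (Suc j). g i) * y (Suc j) = (\<Sum>i<Suc j. g i) * y (Suc j) + g (Suc j) * y (Suc j)"
      by (simp add: algebra_simps)
    also have "(\<Sum>i<Suc j. g i) * y (Suc j) \<le> (\<Sum>i<Suc j. g i) * y j"
      using Suc.prems assms(1)[of j] assms(3)[of "Suc j"] by (intro mult_left_mono) auto
    also have "\<dots> \<le> (\<Sum>i<Suc j. g i * y i)" using Suc by auto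
    finally show ?case by simp
  qed simp
  from this[of q] Suc have "(\<Sum>i<p. g i) * y q \<le> (\<Sum>i<p. g i * y i)" by simp
  moreover have "0 \<le> (\<Sum>i<p. g i) * y q"
    using assms(2)[of q] assms(3)[of p] Suc by (intro mult_nonneg_nonneg) auto
  ultimately show ?thesis by linarith
qed simp

text \<open>Monotonicity of \<open>k\<close> allows moving decay from the larger to the smaller variables, until every
  variable has exponent \<open>1 + 1 / p\<close>.\<close>

lemma prod_powr_le:
  fixes e :: "nat \<Rightarrow> int"
  assumes k: "k \<in> series_index p" and dec: "\<And>j. 1 \<le> j \<Longrightarrow> j \<le> p \<Longrightarrow> int j + 1 \<le> (\<Sum>l<j. e l)"
  shows "(\<Prod>i<p. real (k ! i) powr - real_of_int (e i)) \<le> (\<Prod>i<p. real (k ! i) powr - (1 + 1 / real p))"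
proof -
  have len: "length k = p" and pos: "1 \<le> k ! i" if "i < p" for i
    using k that by (auto simp: series_index_def)
  have mono: "k ! j \<le> k ! i" if "i < j" "j < p" for i j
    using k that by (auto simp: series_index_def sorted_wrt_iff_nth_less)
  have ex: "real (k ! i) powr z = exp (z * ln (real (k ! i)))" if "i < p" for i z
    using pos[OF that] by (simp add: powr_def)
  have "0 \<le> (\<Sum>i<p. (real_of_int (e i) - (1 + 1 / real p)) * ln (real (k ! i)))"
  proof (rule weighted_sum_nonneg)
    show "ln (real (k ! Suc i)) \<le> ln (real (k ! i))" if "Suc i < p" for i
      using mono[of i "Suc i"] pos[of "Suc i"] that by simp
    show "0 \<le> ln (real (k ! i))" if "i < p" for i using pos[OF that] by simp
    \<comment> \<open>The partial sum is at least j + 1 - j (1 + 1/p) = 1 - j/p. The spare unit in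
      the degree bound is thus shared equally among the \<open>p\<close> variables.\<close>
    show "0 \<le> (\<Sum>i<j. real_of_int (e i) - (1 + 1 / real p))" if "j \<le> p" for j
    proof (cases "j = 0")
      case False
      have "real_of_int (int j + 1) \<le> real_of_int (\<Sum>l<j. e l)"
        using dec[of j] that False by (simp only: of_int_le_iff)
      moreover have "real j / real p \<le> 1" using that False by (simp add: divide_le_eq_1)
      ultimately show ?thesis by (simp add: sum_subtractf field_simps)
    qed simp
  qed
  then have "(\<Sum>i<p. - real_of_int (e i) * ln (real (k ! i))) \<le>
      (\<Sum>i<p. - (1 + 1 / real p) * ln (real (k ! i)))"
    by (simp only: left_diff_distrib sum_subtractf mult_minus_left sum_negf neg_le_iff_le diff_ge_0_iff_ge)
  then have "exp (\<Sum>i<p. - real_of_int (e i) * ln (real (k ! i))) \<le>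
      exp (\<Sum>i<p. - (1 + 1 / real p) * ln (real (k ! i)))" by simp
  then show ?thesis unfolding exp_sum[OF finite_lessThan] by (simp add: ex)
qed

lemma summable_on_series_index:
  fixes f :: "nat list \<Rightarrow> complex" and e :: "nat \<Rightarrow> int"
  assumes dec: "\<And>j. 1 \<le> j \<Longrightarrow> j \<le> p \<Longrightarrow> int j + 1 \<le> (\<Sum>l<j. e l)"
    and A: "A \<subseteq> series_index p"
    and f: "\<And>k. k \<in> A \<Longrightarrow> norm (f k) \<le> (\<Prod>i<p. real (k ! i) powr - real_of_int (e i))"
  shows "f summable_on A"
proof (rule abs_summable_summable)
  \<comment> \<open>For p = 0 the quotient is 0 and the exponent is not above 1, but the index set
    is then a single empty list.\<close>
  have "1 < 1 + 1 / real p \<or> p = 0" by auto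
  then have "(\<lambda>k. \<Prod>i<p. real (k ! i) powr - (1 + 1 / real p)) summable_on pos_lists p"
  proof
    assume "p = 0"
    then have "pos_lists p = {[]}" by (auto simp: pos_lists_def)
    then show ?thesis by simp
  qed (rule summable_on_pos_lists)
  then have g: "(\<lambda>k. \<Prod>i<p. real (k ! i) powr - (1 + 1 / real p)) summable_on A"
    by (rule summable_on_subset_banach) (use A in \<open>auto simp: series_index_def pos_lists_def\<close>)
  have "norm (f k) \<le> (\<Prod>i<p. real (k ! i) powr - (1 + 1 / real p))" if "k \<in> A" for k
    using f[OF that] prod_powr_le[of k p e] dec A that by fastforce
  then show "(\<lambda>k. norm (f k)) summable_on A"
    by (intro summable_on_comparison_test[OF g]) auto
qed

lemma sum_tendsto_infsum:
  assumes f: "f summable_on A"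
    and F: "\<And>N. finite (F N)" "\<And>N. F N \<subseteq> A" "\<And>x. x \<in> A \<Longrightarrow> eventually (\<lambda>N. x \<in> F N) sequentially"
  shows "(\<lambda>N. sum f (F N)) \<longlonglongrightarrow> infsum f A"
proof (rule filterlim_compose[OF infsum_tendsto[OF f]])
  show "filterlim F (finite_subsets_at_top A) sequentially"
    unfolding filterlim_finite_subsets_at_top
  proof safe
    fix Y assume Y: "finite Y" "Y \<subseteq> A"
    have "eventually (\<lambda>N. \<forall>x\<in>Y. x \<in> F N) sequentially"
      using Y F(3) by (intro eventually_ball_finite) auto
    then show "eventually (\<lambda>N. finite (F N) \<and> Y \<subseteq> F N \<and> F N \<subseteq> A) sequentially"
      by eventually_elim (use F in auto)
  qed
qed

section \<open>Truncated multiple sums and their limits\<close>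

definition strict_lists :: "nat \<Rightarrow> nat \<Rightarrow> nat list set" where
  "strict_lists q N = {k. length k = q \<and> sorted_wrt (>) k \<and> (\<forall>x\<in>set k. 1 \<le> x \<and> x \<le> N)}"

text \<open>The bound is \<open>Suc N\<close> because \<open>psum\<close> includes the index
  \<open>N\<close>, which encodes the value \<open>N + 1\<close>; in \<open>hsum\<close> the index
  stays below \<open>N\<close>.\<close>

definition weak_lists :: "nat \<Rightarrow> nat \<Rightarrow> nat list set" where
  "weak_lists q N = {k. length k = q \<and> sorted_wrt (\<ge>) k \<and> (\<forall>x\<in>set k. 1 \<le> x \<and> x \<le> Suc N)}"

lemma finite_strict_lists: "finite (strict_lists q N)"
  by (rule finite_subset[OF _ finite_lists_length_eq[of "{..N}" q]]) (auto simp: strict_lists_def)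

lemma finite_weak_lists: "finite (weak_lists q N)"
  by (rule finite_subset[OF _ finite_lists_length_eq[of "{..Suc N}" q]]) (auto simp: weak_lists_def)

lemma strict_lists_Suc:
  "strict_lists (Suc q) N = (\<lambda>(x, k). Suc x # k) ` (SIGMA x:{..<N}. strict_lists q x)"
proof (intro subset_antisym subsetI)
  fix k assume k: "k \<in> strict_lists (Suc q) N"
  then obtain y u where yu: "k = y # u" by (cases k) (auto simp: strict_lists_def)
  then obtain x where "y = Suc x" using k by (cases y) (auto simp: strict_lists_def)
  then show "k \<in> (\<lambda>(x, k). Suc x # k) ` (SIGMA x:{..<N}. strict_lists q x)"
    using k yu by (auto simp: strict_lists_def intro!: image_eqI[of _ _ "(x, u)"])
qed (fastforce simp: strict_lists_def)

lemma weak_lists_Suc: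
  "weak_lists (Suc q) N = (\<lambda>(x, k). Suc x # k) ` (SIGMA x:{..N}. weak_lists q x)"
proof (intro subset_antisym subsetI)
  fix k assume k: "k \<in> weak_lists (Suc q) N"
  then obtain y u where yu: "k = y # u" by (cases k) (auto simp: weak_lists_def)
  then obtain x where "y = Suc x" using k by (cases y) (auto simp: weak_lists_def)
  then show "k \<in> (\<lambda>(x, k). Suc x # k) ` (SIGMA x:{..N}. weak_lists q x)"
    using k yu by (auto simp: weak_lists_def intro!: image_eqI[of _ _ "(x, u)"])
qed (fastforce simp: weak_lists_def)

lemma hsum_strict_lists:
  "hsum w N = (\<Sum>k\<in>strict_lists (length w) N. \<Prod>i<length w. 1 / of_nat (k ! i) ^ (w ! i))"
proof (induction w arbitrary: N)
  case Nil
  have "strict_lists 0 N = {[]}" by (auto simp: strict_lists_def)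
  then show ?case by simp
next
  case (Cons s w)
  let ?g = "\<lambda>x k. 1 / of_nat (Suc x) ^ s * (\<Prod>i<length w. 1 / of_nat (k ! i) ^ (w ! i)) :: complex"
  have "hsum (s # w) N = (\<Sum>x<N. \<Sum>k\<in>strict_lists (length w) x. ?g x k)"
    unfolding hsum.simps Cons.IH sum_distrib_left ..
  also have "\<dots> = (\<Sum>(x, k)\<in>(SIGMA x:{..<N}. strict_lists (length w) x). ?g x k)"
    by (rule sum.Sigma) (auto simp: finite_strict_lists)
  also have "\<dots> = (\<Sum>k\<in>strict_lists (length (s # w)) N.
      \<Prod>i<length (s # w). 1 / of_nat (k ! i) ^ ((s # w) ! i))"
    unfolding length_Cons strict_lists_Suc
    by (subst sum.reindex)
       (auto simp: inj_on_def prod.lessThan_Suc_shift case_prod_beta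
         simp del: prod.lessThan_Suc of_nat_Suc)
  finally show ?case .
qed

lemma hsum_tendsto_mzv:
  assumes pos: "\<forall>x\<in>set w. 1 \<le> x" and hd: "w \<noteq> [] \<Longrightarrow> 2 \<le> hd w"
  shows "hsum w \<longlonglongrightarrow> mzv w"
proof -
  let ?A = "{k :: nat list. length k = length w \<and> sorted_wrt (>) k \<and> (\<forall>x\<in>set k. 1 \<le> x)}"
  let ?f = "\<lambda>k :: nat list. \<Prod>i<length w. 1 / of_nat (k ! i) ^ (w ! i) :: complex"
  have "?f summable_on ?A"
  \<comment> \<open>The letters play the role of the decay exponents; the first letter, being at
    least 2, supplies the extra unit in \<open>j + 1\<close>.\<close>
  proof (rule summable_on_series_index[where e = "\<lambda>i. int (w ! i)"])
    fix j assume j: "1 \<le> j" "j \<le> length w"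
    then have "2 \<le> w ! 0" using hd by (cases w) auto
    have "(\<Sum>l<j. 1 + (if l = 0 then 1 else 0)) \<le> (\<Sum>l<j. int (w ! l))"
      using pos j \<open>2 \<le> w ! 0\<close> by (intro sum_mono) (auto simp: Suc_le_eq)
    moreover have "(\<Sum>l<j. 1 + (if l = 0 then 1 else 0 :: int)) = int j + 1"
      using j by (simp add: sum.distrib)
    ultimately show "int j + 1 \<le> (\<Sum>l<j. int (w ! l))" by simp
  next
    show "?A \<subseteq> series_index (length w)"
      by (auto simp: series_index_def intro: sorted_wrt_mono_rel[of _ "(>)"])
  next
    fix k assume "k \<in> ?A"
    then have "norm (1 / of_nat (k ! i) ^ (w ! i) :: complex) = real (k ! i) powr - real_of_int (int (w ! i))"
      if "i < length w" for i
    proof -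
      have "0 < k ! i" using that \<open>k \<in> ?A\<close> by (auto simp: Suc_le_eq)
      then show ?thesis
        by (simp add: norm_inverse norm_power powr_minus powr_realpow divide_inverse)
    qed
    then show "norm (?f k) \<le> (\<Prod>i<length w. real (k ! i) powr - real_of_int (int (w ! i)))"
      by (simp add: prod_norm[symmetric])
  qed
  then have "(\<lambda>N. sum ?f (strict_lists (length w) N)) \<longlonglongrightarrow> infsum ?f ?A"
  proof (rule sum_tendsto_infsum)
    fix k assume k: "k \<in> ?A"
    have "eventually (\<lambda>N. \<forall>x\<in>set k. x \<le> N) sequentially"
      by (intro eventually_ball_finite) (auto simp: eventually_ge_at_top)
    then show "eventually (\<lambda>N. k \<in> strict_lists (length w) N) sequentially"
      by eventually_elim (use k in \<open>auto simp: strict_lists_def\<close>)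
  qed (auto simp: finite_strict_lists, auto simp: strict_lists_def)
  then show ?thesis unfolding mzv_def by (simp add: hsum_strict_lists[abs_def])
qed

section \<open>Logarithmic growth of harmonic sums\<close>

lemma norm_hsum_le: "\<forall>x\<in>set w. 1 \<le> x \<Longrightarrow> norm (hsum w n) \<le> harm n ^ length w"
proof (induction w arbitrary: n)
  case (Cons s w)
  have "norm (hsum (s # w) n) \<le> (\<Sum>k<n. norm (1 / of_nat (Suc k) ^ s * hsum w k))"
    unfolding hsum.simps by (rule norm_sum)
  also have "\<dots> \<le> (\<Sum>k<n. inverse (real (Suc k)) * harm n ^ length w)"
  proof (rule sum_mono)
    fix k assume k: "k \<in> {..<n}"
    have "norm (1 / of_nat (Suc k) ^ s :: complex) = inverse (real (Suc k)) ^ s"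
      by (simp only: divide_inverse mult_1 power_inverse[symmetric] norm_power norm_inverse norm_of_nat)
    also have "\<dots> \<le> inverse (real (Suc k)) ^ 1"
      using Cons.prems by (intro power_decreasing) (auto simp: field_simps)
    finally have 1: "norm (1 / of_nat (Suc k) ^ s :: complex) \<le> inverse (real (Suc k))" by simp
    have "norm (hsum w k) \<le> harm k ^ length w" using Cons by auto
    also have "\<dots> \<le> harm n ^ length w"
      using k by (intro power_mono harm_mono harm_nonneg) auto
    finally show "norm (1 / of_nat (Suc k) ^ s * hsum w k) \<le> inverse (real (Suc k)) * harm n ^ length w"
      unfolding norm_mult using 1 by (intro mult_mono) auto
  qed
  also have "\<dots> = harm n ^ length (s # w)"
    by (simp add: harm_altdef sum_distrib_right[symmetric])
  finally show ?case .
qed simp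

text \<open>With u = 1 + ln (N + 1) the harmonic number is at most u and 1/(N + 1) = e / exp u, so
  everything is dominated by a power of u over exp u.\<close>

lemma hsum_pole_tendsto_0:
  assumes "\<forall>x\<in>set w. 1 \<le> x" "1 \<le> s"
  shows "(\<lambda>N. 1 / (pt N + of_nat b) ^ s * hsum w N) \<longlonglongrightarrow> 0"
proof (rule Lim_null_comparison)
  let ?q = "length w"
  let ?u = "\<lambda>N. 1 + ln (real (Suc N))"
  show "eventually (\<lambda>N. norm (1 / (pt N + of_nat b) ^ s * hsum w N) \<le>
      exp 1 * (?u N ^ ?q / exp (?u N))) sequentially"
  proof (intro always_eventually allI)
    fix N :: nat
    have "(harm N :: real) \<le> harm (Suc N)" by (simp add: harm_Suc)
    also have "\<dots> - ln (real (Suc N)) \<le> (harm (Suc 0) :: real) - ln (real (Suc 0))"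
      using decseqD[OF decseq_harm_diff_ln, of 0 N] by simp
    then have "harm (Suc N) \<le> ?u N" by (simp add: harm_Suc harm_expand(1))
    finally have "harm N \<le> ?u N" .
    then have h: "norm (hsum w N) \<le> ?u N ^ ?q"
      by (intro order_trans[OF norm_hsum_le[OF assms(1)]] power_mono harm_nonneg)
    have "norm (1 / (pt N + of_nat b) ^ s) = inverse (real (Suc N + b)) ^ s"
    proof -
      have "pt N + of_nat b = of_nat (Suc N + b)" by (simp add: pt_def)
      then show ?thesis
        by (simp only: norm_inverse norm_power norm_of_nat power_inverse divide_inverse mult_1)
    qed
    also have "\<dots> \<le> inverse (real (Suc N + b)) ^ 1"
      using assms(2) by (intro power_decreasing) (auto simp: field_simps)
    also have "\<dots> \<le> inverse (real (Suc N))" by (simp add: field_simps)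
    finally have "norm (1 / (pt N + of_nat b) ^ s * hsum w N) \<le> inverse (real (Suc N)) * ?u N ^ ?q"
      unfolding norm_mult using h by (intro mult_mono) auto
    also have "inverse (real (Suc N)) = exp 1 / exp (?u N)"
      by (simp add: exp_add divide_inverse del: of_nat_Suc)
    finally show "norm (1 / (pt N + of_nat b) ^ s * hsum w N) \<le> exp 1 * (?u N ^ ?q / exp (?u N))"
      by simp
  qed
  have "filterlim ?u at_top sequentially"
    by (intro filterlim_tendsto_add_at_top[OF tendsto_const] filterlim_compose[OF ln_at_top]
        filterlim_compose[OF filterlim_real_sequentially] filterlim_Suc)
  then have "(\<lambda>N. ?u N ^ ?q / exp (?u N)) \<longlonglongrightarrow> 0"
    by (rule filterlim_compose[OF tendsto_power_div_exp_0])
  then show "(\<lambda>N. exp 1 * (?u N ^ ?q / exp (?u N))) \<longlonglongrightarrow> 0"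
    by (rule tendsto_mult_right_zero)
qed

section \<open>Linear combinations of multiple zeta values\<close>

definition mzv_comb :: "complex set \<Rightarrow> nat list set \<Rightarrow> complex \<Rightarrow> bool" where
  "mzv_comb K V z \<longleftrightarrow> (\<exists>lam :: nat list \<Rightarrow>\<^sub>0 complex.
    (\<forall>s. Poly_Mapping.lookup lam s \<in> K) \<and> Poly_Mapping.keys lam \<subseteq> V \<and>
    z = (\<Sum>s\<in>Poly_Mapping.keys lam. Poly_Mapping.lookup lam s * mzv s))"

lemma mzv_comb_mono: "mzv_comb K V z \<Longrightarrow> V \<subseteq> W \<Longrightarrow> mzv_comb K W z"
  unfolding mzv_comb_def by blast

lemma sum_keys_superset:
  "finite F \<Longrightarrow> Poly_Mapping.keys c \<subseteq> F \<Longrightarrow>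
    (\<Sum>s\<in>Poly_Mapping.keys c. Poly_Mapping.lookup c s * g s) = (\<Sum>s\<in>F. Poly_Mapping.lookup c s * (g s :: complex))"
  by (intro sum.mono_neutral_left) (auto simp: in_keys_iff)

lemma sum_keys_add:
  "(\<Sum>s\<in>Poly_Mapping.keys (c + d). Poly_Mapping.lookup (c + d) s * g s) =
    (\<Sum>s\<in>Poly_Mapping.keys c. Poly_Mapping.lookup c s * g s) +
    (\<Sum>s\<in>Poly_Mapping.keys d. Poly_Mapping.lookup d s * (g s :: complex))"
proof -
  let ?F = "Poly_Mapping.keys c \<union> Poly_Mapping.keys d"
  have F: "finite ?F" "Poly_Mapping.keys (c + d) \<subseteq> ?F" by (auto simp: Poly_Mapping.keys_add)
  show ?thesis
    unfolding sum_keys_superset[OF F] sum_keys_superset[OF F(1) Un_upper1]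
      sum_keys_superset[OF F(1) Un_upper2] by (simp add: lookup_add distrib_right sum.distrib)
qed

context complex_subfield
begin

lemma mzv_comb_0: "mzv_comb K V 0"
  unfolding mzv_comb_def by (intro exI[of _ 0]) auto

lemma mzv_comb_mzv:
  assumes "w \<in> V" "k \<in> K"
  shows "mzv_comb K V (k * mzv w)"
  unfolding mzv_comb_def
proof (intro exI[of _ "Poly_Mapping.single w k"] conjI allI)
  show "k * mzv w = (\<Sum>s\<in>Poly_Mapping.keys (Poly_Mapping.single w k).
      Poly_Mapping.lookup (Poly_Mapping.single w k) s * mzv s)"
    by (subst sum_keys_superset[of "{w}"]) auto
qed (use assms in \<open>auto simp: lookup_single when_def\<close>)

lemma mzv_comb_add:
  assumes "mzv_comb K V x" "mzv_comb K V y"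
  shows "mzv_comb K V (x + y)"
proof -
  obtain a b where a: "\<forall>s. Poly_Mapping.lookup a s \<in> K" "Poly_Mapping.keys a \<subseteq> V"
      "x = (\<Sum>s\<in>Poly_Mapping.keys a. Poly_Mapping.lookup a s * mzv s)"
    and b: "\<forall>s. Poly_Mapping.lookup b s \<in> K" "Poly_Mapping.keys b \<subseteq> V"
      "y = (\<Sum>s\<in>Poly_Mapping.keys b. Poly_Mapping.lookup b s * mzv s)"
    using assms unfolding mzv_comb_def by blast
  show ?thesis unfolding mzv_comb_def
  proof (intro exI[of _ "a + b"] conjI allI)
    show "Poly_Mapping.keys (a + b) \<subseteq> V" using a(2) b(2) Poly_Mapping.keys_add[of a b] by blast
    show "x + y = (\<Sum>s\<in>Poly_Mapping.keys (a + b). Poly_Mapping.lookup (a + b) s * mzv s)"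
      unfolding sum_keys_add a(3) b(3) ..
  qed (use a b in \<open>auto simp: lookup_add intro: add_closed\<close>)
qed

lemma mzv_comb_scale:
  assumes "mzv_comb K V z" "k \<in> K"
  shows "mzv_comb K V (k * z)"
proof -
  obtain a where a: "\<forall>s. Poly_Mapping.lookup a s \<in> K" "Poly_Mapping.keys a \<subseteq> V"
    "z = (\<Sum>s\<in>Poly_Mapping.keys a. Poly_Mapping.lookup a s * mzv s)"
    using assms unfolding mzv_comb_def by blast
  have fin: "finite (Poly_Mapping.keys a)" by simp
  have "mzv_comb K V (\<Sum>s\<in>Y. k * Poly_Mapping.lookup a s * mzv s)"
    if "finite Y" "Y \<subseteq> Poly_Mapping.keys a" for Y
    using that
  proof (induction Y rule: finite_induct)
    case (insert s Y)
    then show ?case using a assms(2) by (auto intro!: mzv_comb_add mzv_comb_mzv mult_closed)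
  qed (simp add: mzv_comb_0)
  from this[OF fin] show ?thesis by (simp add: a(3) sum_distrib_left mult.assoc)
qed

lemma mzv_comb_sum:
  "(\<And>i. i \<in> I \<Longrightarrow> mzv_comb K V (f i)) \<Longrightarrow> mzv_comb K V (\<Sum>i\<in>I. f i)"
  by (induction I rule: infinite_finite_induct) (auto intro: mzv_comb_add mzv_comb_0)

text \<open>With degree 0 and the convergence flag each generator has a limit of its own: a harmonic
  sum tends to its multiple zeta value and a term with a pole to 0.\<close>

lemma mzv_comb_limit:
  assumes "f \<in> kspan K UNIV (post_gens G B E l 0 True)" and pos: "\<And>w. w \<in> G \<Longrightarrow> \<forall>y\<in>set w. 1 \<le> y"
  shows "\<exists>z. f \<longlonglongrightarrow> z \<and>
    mzv_comb K {w \<in> G. length w < l \<and> count_list w 1 \<le> E \<and> (w = [] \<or> 2 \<le> hd w)} z"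
  using assms(1)
proof (induction rule: kspan.induct)
  case (kspan_zero f)
  then have "f = (\<lambda>_. 0)" by auto
  then show ?case using mzv_comb_0 by auto
next
  case (kspan_step k g h f)
  let ?V = "{w \<in> G. length w < l \<and> count_list w 1 \<le> E \<and> (w = [] \<or> 2 \<le> hd w)}"
  obtain z where z: "h \<longlonglongrightarrow> z" "mzv_comb K ?V z" using kspan_step by blast
  have f: "f = (\<lambda>x. k * g x + h x)" using kspan_step(4) by auto
  have "\<exists>y. g \<longlonglongrightarrow> y \<and> mzv_comb K ?V (k * y)"
    using kspan_step(2)
  proof cases
    case (post_power w f)
    then have "g = hsum w" by (simp add: fun_eq_iff)
    then have "g \<longlonglongrightarrow> mzv w" using hsum_tendsto_mzv[of w] pos post_power by auto
    moreover have "mzv_comb K ?V (k * mzv w)"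
      using post_power kspan_step(1) by (intro mzv_comb_mzv) auto
    ultimately show ?thesis by blast
  next
    case (post_pole b s w)
    then have "g \<longlonglongrightarrow> 0" using hsum_pole_tendsto_0[of w s b] pos[of "s # w"] by simp
    then show ?thesis using mzv_comb_0 by auto
  qed
  then obtain y where "g \<longlonglongrightarrow> y" "mzv_comb K ?V (k * y)" by blast
  then show ?case unfolding f using z
    by (intro exI[of _ "k * y + z"] conjI tendsto_intros mzv_comb_add)
qed

end

section \<open>Uniqueness of partial fraction expansions\<close>

definition off_poles :: "nat \<Rightarrow> nat \<Rightarrow> complex set" where
  "off_poles n r = {x. \<forall>j\<le>n. x + of_nat r + of_nat j \<noteq> 0}"

text \<open>After multiplication by \<open>(x - b) ^ M\<close>, with \<open>M\<close> the highest
  order that has a nonzero coefficient at the pole \<open>b\<close>, only the term of that order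
  survives as x tends to b.\<close>

lemma factor_eval_pole_coeff_0:
  assumes F: "finite F" "\<And>u. u \<in> F \<Longrightarrow> factor_ok a n u"
    and zero: "\<And>x. x \<in> off_poles n r \<Longrightarrow> (\<Sum>u\<in>F. c u * factor_eval r u x) = 0"
    and u: "Pole j s \<in> F"
  shows "c (Pole j s) = 0"
proof (rule ccontr)
  assume nz: "c (Pole j s) \<noteq> 0"
  define M where "M = Max {t. Pole j t \<in> F \<and> c (Pole j t) \<noteq> 0}"
  have fin: "finite {t. Pole j t \<in> F \<and> c (Pole j t) \<noteq> 0}"
    by (rule finite_subset[of _ "(\<lambda>u. case u of Pole j t \<Rightarrow> t | Monomial f \<Rightarrow> 0) ` F"])
       (use F(1) in \<open>force+\<close>)
  have M: "Pole j M \<in> F" "c (Pole j M) \<noteq> 0"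
    using Max_in[OF fin] u nz unfolding M_def by auto
  have M_max: "t \<le> M" if "Pole j t \<in> F" "c (Pole j t) \<noteq> 0" for t
    unfolding M_def using that fin by (intro Max_ge) auto
  have M1: "1 \<le> M" and jn: "j \<le> n" using F(2)[OF M(1)] by auto
  define b :: complex where "b = - of_nat (r + j)"
  let ?g = "\<lambda>u x. c u * factor_eval r u x * (x - b) ^ M"
  have lim: "(?g u \<longlongrightarrow> (if u = Pole j M then c u else 0)) (at b)" if "u \<in> F" for u
  proof (cases u)
    case (Monomial f)
    have "(?g u \<longlongrightarrow> c u * b ^ f * (b - b) ^ M) (at b)"
      unfolding Monomial factor_eval.simps by (intro tendsto_intros)
    then show ?thesis using M1 Monomial by (simp add: zero_power)
  next
    case (Pole i t)
    show ?thesis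
    proof (cases "i = j")
      case False
      have "b + of_nat r + of_nat i \<noteq> 0" using False by (simp add: b_def)
      then have "(?g u \<longlongrightarrow> c u * (1 / (b + of_nat r + of_nat i) ^ t) * (b - b) ^ M) (at b)"
        unfolding Pole factor_eval.simps by (intro tendsto_intros) auto
      then show ?thesis using M1 Pole False by (simp add: zero_power)
    next
      case True
      show ?thesis
      proof (cases "c u = 0")
        case False
        then have tM: "t \<le> M" using M_max[of t] \<open>u \<in> F\<close> Pole True by auto
        have ev: "eventually (\<lambda>x. ?g u x = c u * (x - b) ^ (M - t)) (at b)"
          using eventually_neq_at_within[of b b UNIV]
        proof eventually_elim
          case (elim x)
          have "x + of_nat r + of_nat j = x - b" by (simp add: b_def)
          then have "factor_eval r u x = 1 / (x - b) ^ t"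
            by (simp only: Pole True factor_eval.simps)
          moreover have "(x - b) ^ M = (x - b) ^ (M - t) * (x - b) ^ t"
            using tM by (simp flip: power_add)
          ultimately show ?case using elim by simp
        qed
        have "((\<lambda>x. c u * (x - b) ^ (M - t)) \<longlongrightarrow> c u * (b - b) ^ (M - t)) (at b)"
          by (intro tendsto_intros)
        then have "(?g u \<longlongrightarrow> c u * (b - b) ^ (M - t)) (at b)"
          by (rule tendsto_cong[OF ev, THEN iffD2])
        moreover have "c u * (b - b) ^ (M - t) = (if u = Pole j M then c u else 0)"
          using Pole True tM by (auto simp: zero_power)
        ultimately show ?thesis by simp
      qed (use M(2) in auto)
    qed
  qed
  have "((\<lambda>x. \<Sum>u\<in>F. ?g u x) \<longlongrightarrow> (\<Sum>u\<in>F. if u = Pole j M then c u else 0)) (at b)"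
    by (intro tendsto_sum lim)
  then have "((\<lambda>x. \<Sum>u\<in>F. ?g u x) \<longlongrightarrow> c (Pole j M)) (at b)"
    using F(1) M(1) by (simp add: sum.delta)
  moreover have "eventually (\<lambda>x. (\<Sum>u\<in>F. ?g u x) = 0) (at b)"
  proof -
    have "eventually (\<lambda>x. \<forall>i\<in>{..n}. x \<noteq> - of_nat (r + i)) (at b)"
      by (intro eventually_ball_finite ballI eventually_neq_at_within) auto
    then show ?thesis
    proof eventually_elim
      case (elim x)
      have "x \<in> off_poles n r"
        unfolding off_poles_def
      proof (rule CollectI, intro allI impI notI)
        fix i assume "i \<le> n" "x + of_nat r + of_nat i = 0"
        then have "x + of_nat (r + i) = 0" by (simp only: of_nat_add add.assoc)
        then have "x = - of_nat (r + i)" by (rule eq_neg_iff_add_eq_0[THEN iffD2])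
        with elim \<open>i \<le> n\<close> show False by blast
      qed
      then show ?case using zero[of x] by (simp flip: sum_distrib_right)
    qed
  qed
  then have "((\<lambda>x. \<Sum>u\<in>F. ?g u x) \<longlongrightarrow> 0) (at b)"
    by (rule tendsto_eventually)
  ultimately have "c (Pole j M) = 0"
    by (intro tendsto_unique[of "at b"]) auto
  with M(2) show False by simp
qed

text \<open>Once the pole coefficients are known to vanish, what remains is a polynomial with all
  positive integers as roots.\<close>

lemma factor_eval_independent:
  assumes F: "finite F" "\<And>u. u \<in> F \<Longrightarrow> factor_ok a n u"
    and zero: "\<And>x. x \<in> off_poles n r \<Longrightarrow> (\<Sum>u\<in>F. c u * factor_eval r u x) = 0"
    and u: "u \<in> F"
  shows "c u = 0"
proof (cases u)
  case (Pole j s)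
  then show ?thesis using factor_eval_pole_coeff_0[of F a n r c j s] assms by blast
next
  case (Monomial f)
  define G where "G = {q. Monomial q \<in> F}"
  have finG: "finite G"
    unfolding G_def using finite_vimageI[OF F(1), of Monomial] by (simp add: vimage_def inj_on_def)
  define P where "P = (\<Sum>q\<in>G. Polynomial.monom (c (Monomial q)) q)"
  have "poly P x = 0" if x: "x \<in> off_poles n r" for x
  proof -
    have "(\<Sum>u\<in>F. c u * factor_eval r u x) = (\<Sum>u\<in>Monomial ` G. c u * factor_eval r u x)"
    proof (rule sum.mono_neutral_right)
      show "\<forall>u\<in>F - Monomial ` G. c u * factor_eval r u x = 0"
      proof
        fix u assume "u \<in> F - Monomial ` G"
        then obtain j s where "u = Pole j s" "u \<in> F" by (cases u) (auto simp: G_def)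
        then show "c u * factor_eval r u x = 0"
          using factor_eval_pole_coeff_0[of F a n r c j s] F zero by auto
      qed
    qed (auto simp: F G_def)
    also have "\<dots> = poly P x"
      by (simp add: P_def sum.reindex inj_on_def poly_sum poly_monom)
    finally show ?thesis using zero[OF x] by simp
  qed
  then have "range (of_nat \<circ> Suc) \<subseteq> {x. poly P x = 0}"
  proof (clarsimp)
    fix k :: nat
    assume *: "\<And>x. x \<in> off_poles n r \<Longrightarrow> poly P x = 0"
    show "poly P (1 + of_nat k) = 0"
    proof (rule *)
      have "1 + of_nat k + of_nat r + of_nat j \<noteq> (0 :: complex)" for j
        using of_nat_neq_0[of "k + r + j", where 'a = complex] by (simp add: add_ac)
      then show "1 + of_nat k \<in> off_poles n r"
        unfolding off_poles_def by blast
    qed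
  qed
  moreover have "infinite (range (of_nat \<circ> Suc :: nat \<Rightarrow> complex))"
    by (rule range_inj_infinite) (auto simp: inj_on_def)
  ultimately have "P = 0" using poly_roots_finite finite_subset by blast
  then have "Polynomial.coeff P f = 0" by simp
  moreover have "Polynomial.coeff P f = c u"
    using finG u Monomial by (simp add: P_def coeff_sum G_def sum.delta)
  ultimately show ?thesis by simp
qed

text \<open>With the other variables fixed, independence in the first variable makes the sum over
  each fibre of \<open>hd\<close> vanish; a fibre is then a relation in one variable less.\<close>

lemma prod_factor_eval_independent:
  assumes F: "finite F" "\<And>u i. u \<in> F \<Longrightarrow> i < p \<Longrightarrow> factor_ok (A i) (n i) (u ! i)"
    "\<And>u. u \<in> F \<Longrightarrow> length u = p"
    and zero: "\<And>x. length x = p \<Longrightarrow> (\<And>i. i < p \<Longrightarrow> x ! i \<in> off_poles (n i) (r i)) \<Longrightarrow>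
      (\<Sum>u\<in>F. c u * (\<Prod>i<p. factor_eval (r i) (u ! i) (x ! i))) = 0"
    and u: "u \<in> F"
  shows "c u = 0"
  using assms
proof (induction p arbitrary: F A n r c u)
  case 0
  then have "F = {[]}" by auto
  then show ?case using 0(4)[of "[]"] 0(5) by simp
next
  case (Suc p)
  obtain v w where u: "u = v # w" using Suc.prems(3)[OF Suc.prems(5)] by (cases u) auto
  define T where "T v = {u \<in> F. hd u = v}" for v
  have fT: "finite (T v)" for v using Suc.prems(1) by (simp add: T_def)
  let ?pr = "\<lambda>w xs. \<Prod>i<p. factor_eval (r (Suc i)) (w ! i) (xs ! i)"
  have inner: "(\<Sum>u\<in>T v. c u * ?pr (tl u) xs) = 0"
    if xs: "length xs = p" "\<And>i. i < p \<Longrightarrow> xs ! i \<in> off_poles (n (Suc i)) (r (Suc i))" for xs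
  proof (rule factor_eval_independent[of "hd ` F" "A 0" "n 0" "r 0" "\<lambda>v. \<Sum>u\<in>T v. c u * ?pr (tl u) xs"])
    show "factor_ok (A 0) (n 0) v'" if "v' \<in> hd ` F" for v'
      using that Suc.prems(2)[of _ 0] Suc.prems(3) by (force simp: hd_conv_nth simp flip: length_greater_0_conv)
    show "(\<Sum>v\<in>hd ` F. (\<Sum>u\<in>T v. c u * ?pr (tl u) xs) * factor_eval (r 0) v x) = 0"
      if x: "x \<in> off_poles (n 0) (r 0)" for x
    proof -
      have 0: "(\<Sum>u\<in>F. c u * (\<Prod>i<Suc p. factor_eval (r i) (u ! i) ((x # xs) ! i))) = 0"
        using x xs by (intro Suc.prems(4)) (auto simp: nth_Cons split: nat.splits)
      have "(\<Sum>u\<in>F. c u * (\<Prod>i<Suc p. factor_eval (r i) (u ! i) ((x # xs) ! i))) =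
          (\<Sum>u\<in>F. c u * ?pr (tl u) xs * factor_eval (r 0) (hd u) x)"
      proof (rule sum.cong)
        fix u assume "u \<in> F"
        then obtain a b where "u = a # b" using Suc.prems(3)[of u] by (cases u) auto
        then show "c u * (\<Prod>i<Suc p. factor_eval (r i) (u ! i) ((x # xs) ! i)) =
            c u * ?pr (tl u) xs * factor_eval (r 0) (hd u) x"
          by (simp add: prod.lessThan_Suc_shift mult_ac del: prod.lessThan_Suc)
      qed simp
      also have "\<dots> = (\<Sum>v\<in>hd ` F. \<Sum>u\<in>T v. c u * ?pr (tl u) xs * factor_eval (r 0) (hd u) x)"
        unfolding T_def by (rule sum.image_gen[OF Suc.prems(1)])
      also have "\<dots> = (\<Sum>v\<in>hd ` F. (\<Sum>u\<in>T v. c u * ?pr (tl u) xs) * factor_eval (r 0) v x)"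
        unfolding sum_distrib_right by (intro sum.cong) (auto simp: T_def)
      finally show ?thesis using 0 by simp
    qed
    show "v \<in> hd ` F" using Suc.prems(5) u by force
  qed (use Suc.prems(1) in auto)
  have inj: "inj_on tl (T v)"
  proof (rule inj_onI)
    fix a b assume "a \<in> T v" "b \<in> T v" "tl a = tl b"
    then show "a = b" using Suc.prems(3) unfolding T_def by (cases a; cases b) force+
  qed
  have "c (v # w) = 0"
  proof (rule Suc.IH[of "tl ` T v" "\<lambda>i. A (Suc i)" "\<lambda>i. n (Suc i)" "\<lambda>i. r (Suc i)" "\<lambda>w. c (v # w)"])
    show "finite (tl ` T v)" using fT by simp
    show "factor_ok (A (Suc i)) (n (Suc i)) (b ! i)" if "b \<in> tl ` T v" "i < p" for b i
    proof -
      obtain a where a: "a \<in> F" "b = tl a" using \<open>b \<in> tl ` T v\<close> by (auto simp: T_def)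
      then show ?thesis using Suc.prems(2)[OF a(1), of "Suc i"] Suc.prems(3)[OF a(1)] that
        by (simp add: nth_tl)
    qed
    show "length b = p" if "b \<in> tl ` T v" for b
      using that Suc.prems(3) by (auto simp: T_def)
    show "(\<Sum>b\<in>tl ` T v. c (v # b) * ?pr b xs) = 0"
      if xs: "length xs = p" "\<And>i. i < p \<Longrightarrow> xs ! i \<in> off_poles (n (Suc i)) (r (Suc i))" for xs
    proof -
      have "(\<Sum>b\<in>tl ` T v. c (v # b) * ?pr b xs) = (\<Sum>a\<in>T v. c a * ?pr (tl a) xs)"
        unfolding sum.reindex[OF inj] o_def
      proof (rule sum.cong)
        fix a assume a: "a \<in> T v"
        then have "v # tl a = a" using Suc.prems(3)[of a] by (cases a) (auto simp: T_def)
        then show "c (v # tl a) * ?pr (tl a) xs = c a * ?pr (tl a) xs" by simp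
      qed simp
      then show ?thesis using inner[OF xs] by simp
    qed
    show "w \<in> tl ` T v" using Suc.prems(5) u by (force simp: T_def)
  qed
  then show ?case by (simp add: u)
qed

text \<open>This gives meaning to the definite description in \<open>pf_coeff\<close>.\<close>

lemma pf_expansion_unique:
  assumes "is_pf_expansion K p A n r P c" "is_pf_expansion K p A n r P d"
  shows "c = d"
proof (rule poly_mapping_eqI)
  fix u
  let ?F = "Poly_Mapping.keys c \<union> Poly_Mapping.keys d"
  show "Poly_Mapping.lookup c u = Poly_Mapping.lookup d u"
  proof (cases "u \<in> ?F")
    case True
    have "Poly_Mapping.lookup c u - Poly_Mapping.lookup d u = 0"
    proof (rule prod_factor_eval_independent[of ?F p A n r "\<lambda>u. Poly_Mapping.lookup c u - Poly_Mapping.lookup d u"])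
      fix x :: "complex list"
      assume x: "length x = p" "\<And>i. i < p \<Longrightarrow> x ! i \<in> off_poles (n i) (r i)"
      then have off: "length x = p \<and> (\<forall>i<p. \<forall>j\<le>n i. x ! i + of_nat (r i) + of_nat j \<noteq> 0)"
        by (auto simp: off_poles_def)
      have eq: "ratfun p A n r P x = (\<Sum>u\<in>Poly_Mapping.keys b. Poly_Mapping.lookup b u *
          (\<Prod>i<p. factor_eval (r i) (u ! i) (x ! i)))" if "is_pf_expansion K p A n r P b" for b
        using that off unfolding is_pf_expansion_def by simp
      have "(\<Sum>u\<in>?F. Poly_Mapping.lookup b u * (\<Prod>i<p. factor_eval (r i) (u ! i) (x ! i))) =
          ratfun p A n r P x" if "is_pf_expansion K p A n r P b" "Poly_Mapping.keys b \<subseteq> ?F" for b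
        unfolding eq[OF that(1)] by (rule sum_keys_superset[symmetric]) (use that in auto)
      then show "(\<Sum>u\<in>?F. (Poly_Mapping.lookup c u - Poly_Mapping.lookup d u) *
          (\<Prod>i<p. factor_eval (r i) (u ! i) (x ! i))) = 0"
        using assms by (simp add: left_diff_distrib sum_subtractf)
    qed (use assms True in \<open>auto simp: is_pf_expansion_def\<close>)
    then show ?thesis by simp
  qed (auto simp: in_keys_iff)
qed

section \<open>Nested sums as sums over lists\<close>

lemma norm_rfun_le:
  assumes "1 \<le> k"
  shows "norm (rfun m a n r (of_nat k)) \<le> real k powr - real_of_int (int (a * (n + 1)) - int m)"
proof -
  have *: "real k ^ q \<le> norm (pochhammer (of_nat k + of_nat r :: complex) q)" for q
  proof (induction q)
    case (Suc q)
    have "of_nat k + of_nat r + of_nat q = (of_nat (k + r + q) :: complex)" by simp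
    then have "real k \<le> norm (of_nat k + of_nat r + of_nat q :: complex)"
      by (simp only: norm_of_nat of_nat_le_iff)
    with Suc show ?case
      by (simp add: pochhammer_Suc norm_mult mult.commute[of "real k"] mult_mono del: of_nat_add)
  qed simp
  have k0: "0 < real k ^ (n + 1)" using assms by simp
  have "norm (rfun m a n r (of_nat k)) =
      real k ^ m / norm (pochhammer (of_nat k + of_nat r :: complex) (n + 1)) ^ a"
    by (simp only: rfun_def norm_divide norm_power norm_of_nat)
  also have "\<dots> \<le> real k ^ m / (real k ^ (n + 1)) ^ a"
    by (intro divide_left_mono power_mono mult_pos_pos zero_less_power * k0 less_le_trans[OF k0 *])
      simp_all
  also have "\<dots> = real k powr - real_of_int (int (a * (n + 1)) - int m)"
  proof -
    have "- real_of_int (int (a * (n + 1)) - int m) = real m - real ((n + 1) * a)" by simp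
    then show ?thesis
      using assms by (simp only: powr_diff powr_realpow power_mult)
  qed
  finally show ?thesis .
qed

context nested
begin

lemma coef_prod: "coef w i = (\<Prod>l<length w. \<Sum>j\<le>n (i + l). c (i + l) (Pole j (w ! l)))"
  by (induction w arbitrary: i)
     (simp_all add: prod.lessThan_Suc_shift del: prod.lessThan_Suc)

lemma nest_weak_lists:
  "nest q i N = (\<Sum>k\<in>weak_lists q N. \<Prod>l<q.
    rfun (m (i + l)) (A (i + l)) (n (i + l)) (r (i + l)) (of_nat (k ! l)))"
proof (induction q arbitrary: i N)
  case 0
  have "weak_lists 0 N = {[]}" by (auto simp: weak_lists_def)
  then show ?case by simp
next
  case (Suc q)
  let ?f = "\<lambda>i k. rfun (m i) (A i) (n i) (r i) (of_nat k)"
  have "nest (Suc q) i N = (\<Sum>x\<le>N. \<Sum>k\<in>weak_lists q x. ?f i (Suc x) * (\<Prod>l<q. ?f (Suc i + l) (k ! l)))"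
    unfolding nest.simps psum_def Suc.IH sum_distrib_left pt_def ..
  also have "\<dots> = (\<Sum>(x, k)\<in>(SIGMA x:{..N}. weak_lists q x).
      ?f i (Suc x) * (\<Prod>l<q. ?f (Suc i + l) (k ! l)))"
    by (rule sum.Sigma) (auto simp: finite_weak_lists)
  also have "\<dots> = (\<Sum>k\<in>weak_lists (Suc q) N. \<Prod>l<Suc q. ?f (i + l) (k ! l))"
    unfolding weak_lists_Suc
    by (subst sum.reindex)
       (auto simp: inj_on_def prod.lessThan_Suc_shift case_prod_beta
         simp del: prod.lessThan_Suc of_nat_Suc)
  finally show ?case .
qed

lemma nested_sum:
  assumes "1 \<le> p" and dec: "\<And>j. 1 \<le> j \<Longrightarrow> j \<le> p \<Longrightarrow> int j + 1 \<le> (\<Sum>l<j. e l)"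
  defines "f \<equiv> \<lambda>k. \<Prod>l<p. rfun (m l) (A l) (n l) (r l) (of_nat (k ! l))"
  shows "f summable_on series_index p"
    and "\<exists>z. infsum f (series_index p) = (\<Sum>w\<in>top_words p 0. coef w 0 * mzv w) + z \<and>
      mzv_comb K {w \<in> words 0. length w < p \<and> count_list w 1 \<le> ones 0 \<and> (w = [] \<or> 2 \<le> hd w)} z"
proof -
  show sm: "f summable_on series_index p"
  proof (rule summable_on_series_index[OF dec])
    fix k assume k: "k \<in> series_index p"
    have "norm (f k) = (\<Prod>l<p. norm (rfun (m l) (A l) (n l) (r l) (of_nat (k ! l))))"
      by (simp add: f_def prod_norm)
    also have "\<dots> \<le> (\<Prod>l<p. real (k ! l) powr - real_of_int (e l))"
      using k by (intro prod_mono conjI norm_rfun_le norm_ge_zero) (auto simp: series_index_def)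
    finally show "norm (f k) \<le> (\<Prod>l<p. real (k ! l) powr - real_of_int (e l))" .
  qed auto
  have "(\<lambda>N. sum f (weak_lists p N)) \<longlonglongrightarrow> infsum f (series_index p)"
  proof (rule sum_tendsto_infsum[OF sm])
    fix k assume k: "k \<in> series_index p"
    have "eventually (\<lambda>N. \<forall>x\<in>set k. x \<le> N) sequentially"
      by (intro eventually_ball_finite) (auto simp: eventually_ge_at_top)
    then show "eventually (\<lambda>N. k \<in> weak_lists p N) sequentially"
      by eventually_elim (use k in \<open>auto simp: weak_lists_def series_index_def le_SucI\<close>)
  qed (auto simp: finite_weak_lists, auto simp: weak_lists_def series_index_def)
  then have lim: "nest p 0 \<longlonglongrightarrow> infsum f (series_index p)"
    by (simp add: nest_weak_lists[abs_def] f_def)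
  have e0: "2 \<le> e 0" using dec[of 1] assms(1) by simp
  have top: "(\<lambda>N. \<Sum>w\<in>top_words p 0. coef w 0 * hsum w N) \<longlonglongrightarrow>
      (\<Sum>w\<in>top_words p 0. coef w 0 * mzv w)"
  proof (rule tendsto_sum)
    fix w assume w: "w \<in> top_words p 0"
    show "(\<lambda>N. coef w 0 * hsum w N) \<longlonglongrightarrow> coef w 0 * mzv w"
    \<comment> \<open>\<open>top_words\<close> contains divergent words too, but since
      \<open>e 0\<close> is at least 2 their coefficients vanish.\<close>
    proof (cases "coef w 0 = 0")
      case False
      have "2 \<le> hd w" using coef_nz_hd[of w "p - 1" 0] w False e0 assms(1) by simp
      moreover have "\<forall>x\<in>set w. 1 \<le> x"
        using top_words_good[OF w] good_pos by (auto simp: words_def)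
      ultimately show ?thesis by (intro tendsto_mult_left hsum_tendsto_mzv)
    qed simp
  qed
  obtain z where z: "(\<lambda>N. nest p 0 N - (\<Sum>w\<in>top_words p 0. coef w 0 * hsum w N)) \<longlonglongrightarrow> z"
    "mzv_comb K {w \<in> words 0. length w < p \<and> count_list w 1 \<le> ones 0 \<and> (w = [] \<or> 2 \<le> hd w)} z"
    using mzv_comb_limit[OF nest_expansion_final[OF assms(1) dec]] good_pos unfolding words_def by blast
  have "(\<lambda>N. nest p 0 N - (\<Sum>w\<in>top_words p 0. coef w 0 * hsum w N)) \<longlonglongrightarrow>
      infsum f (series_index p) - (\<Sum>w\<in>top_words p 0. coef w 0 * mzv w)"
    by (intro tendsto_diff lim top)
  then have "z = infsum f (series_index p) - (\<Sum>w\<in>top_words p 0. coef w 0 * mzv w)"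
    by (rule LIMSEQ_unique[OF z(1)])
  then show "\<exists>z. infsum f (series_index p) = (\<Sum>w\<in>top_words p 0. coef w 0 * mzv w) + z \<and>
      mzv_comb K {w \<in> words 0. length w < p \<and> count_list w 1 \<le> ones 0 \<and> (w = [] \<or> 2 \<le> hd w)} z"
    using z(2) by (intro exI[of _ z]) simp
qed

end

section \<open>Existence of partial fraction expansions\<close>

lemma ratfun_monomials:
  assumes "P \<in> mpolys K p"
  shows "ratfun p A n r P x = (\<Sum>m\<in>Poly_Mapping.keys P. Poly_Mapping.lookup P m *
    (\<Prod>i<p. rfun (Poly_Mapping.lookup m i) (A i) (n i) (r i) (x ! i)))"
proof -
  have "(\<Prod>i\<in>Poly_Mapping.keys m. (x ! i) ^ Poly_Mapping.lookup m i) =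
      (\<Prod>i<p. (x ! i) ^ Poly_Mapping.lookup m i)" if "m \<in> Poly_Mapping.keys P" for m
    using assms that by (intro prod.mono_neutral_left) (auto simp: mpolys_def in_keys_iff)
  then show ?thesis
    by (simp add: ratfun_def mpoly_eval_def rfun_def prod_dividef sum_divide_distrib)
qed

context complex_subfield
begin

lemma rfun_expansion_exists:
  "\<exists>c. (\<forall>u. c u \<in> K) \<and> (\<forall>u. u \<notin> pf_factors a n (int m - int (a * (n + 1))) \<longrightarrow> c u = 0) \<and>
    (int m - int (a * (n + 1)) \<le> - 2 \<longrightarrow> (\<Sum>j\<le>n. c (Pole j 1)) = 0) \<and>
    (\<forall>x\<in>off_poles n r. rfun m a n r x =
      (\<Sum>u\<in>pf_factors a n (int m - int (a * (n + 1))). c u * factor_eval r u x))"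
proof (rule rfun_coeffs)
  show "rfun m a n r \<in> kspan K (off_poles n r) (pf_gens (\<lambda>x. x) (pole_order a n r) (int m - int (a * (n + 1))))"
    by (rule kspan_rfun) (simp add: off_poles_def)
qed

text \<open>The coefficients \<open>c m i\<close> belong to the variable \<open>i\<close> in the monomial \<open>m\<close> of \<open>P\<close>.\<close>

lemma is_pf_expansion_monomials:
  fixes c :: "(nat \<Rightarrow>\<^sub>0 nat) \<Rightarrow> nat \<Rightarrow> pf_factor \<Rightarrow> complex"
  assumes P: "P \<in> mpolys K p"
    and c_mem: "\<And>m i u. c m i u \<in> K"
    and c_supp: "\<And>m i u. u \<notin> pf_factors (A i) (n i) (int (Poly_Mapping.lookup m i) - int (A i * (n i + 1))) \<Longrightarrow>
      c m i u = 0"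
    and c_eq: "\<And>m i x. x \<in> off_poles (n i) (r i) \<Longrightarrow> rfun (Poly_Mapping.lookup m i) (A i) (n i) (r i) x =
      (\<Sum>u\<in>pf_factors (A i) (n i) (int (Poly_Mapping.lookup m i) - int (A i * (n i + 1))).
        c m i u * factor_eval (r i) u x)"
  shows "\<exists>C. is_pf_expansion K p A n r P C \<and> (\<forall>u. length u = p \<longrightarrow> Poly_Mapping.lookup C u =
    (\<Sum>m\<in>Poly_Mapping.keys P. Poly_Mapping.lookup P m * (\<Prod>i<p. c m i (u ! i))))"
proof -
  \<comment> \<open>A common degree bound, which lets one finite set \<open>F\<close> index the
    expansions of all monomials.\<close>
  define M :: int where
    "M = int (\<Sum>m\<in>Poly_Mapping.keys P. \<Sum>i<p. Poly_Mapping.lookup m i)"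
  define S where "S i = pf_factors (A i) (n i) M" for i
  define F where "F = {u. length u = p \<and> (\<forall>i<p. u ! i \<in> S i)}"
  define C' where "C' u = (if length u = p then
    \<Sum>m\<in>Poly_Mapping.keys P. Poly_Mapping.lookup P m * (\<Prod>i<p. c m i (u ! i)) else 0)" for u
  have le_M: "int (Poly_Mapping.lookup m i) \<le> M" if "m \<in> Poly_Mapping.keys P" "i < p" for m i
  proof -
    have "Poly_Mapping.lookup m i \<le> (\<Sum>i<p. Poly_Mapping.lookup m i)"
      using that by (intro member_le_sum) auto
    also have "\<dots> \<le> (\<Sum>m\<in>Poly_Mapping.keys P. \<Sum>i<p. Poly_Mapping.lookup m i)"
      using that by (intro member_le_sum) auto
    finally show ?thesis by (simp add: M_def del: of_nat_sum)
  qed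
  have sub: "pf_factors (A i) (n i) (int (Poly_Mapping.lookup m i) - int (A i * (n i + 1))) \<subseteq> S i"
    if "m \<in> Poly_Mapping.keys P" "i < p" for m i
    using le_M[OF that] unfolding S_def pf_factors_def by fastforce
  have finF: "finite F" unfolding F_def S_def by (intro finite_lists_nth finite_factors)
  have supp: "{u. C' u \<noteq> 0} \<subseteq> F"
  proof
    fix u assume "u \<in> {u. C' u \<noteq> 0}"
    then have l: "length u = p"
      and nz: "(\<Sum>m\<in>Poly_Mapping.keys P. Poly_Mapping.lookup P m * (\<Prod>i<p. c m i (u ! i))) \<noteq> 0"
      by (auto simp: C'_def split: if_splits)
    obtain m where m: "m \<in> Poly_Mapping.keys P"
      "Poly_Mapping.lookup P m * (\<Prod>i<p. c m i (u ! i)) \<noteq> 0"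
      using sum.not_neutral_contains_not_neutral[OF nz] by blast
    then have "c m i (u ! i) \<noteq> 0" if "i < p" for i using that by auto
    then have "u ! i \<in> S i" if "i < p" for i using c_supp sub[OF m(1) that] that by blast
    then show "u \<in> F" using l by (simp add: F_def)
  qed
  define C where "C = Abs_poly_mapping C'"
  have lookup: "Poly_Mapping.lookup C = C'"
    unfolding C_def by (rule lookup_Abs_poly_mapping) (rule finite_subset[OF supp finF])
  have keys: "Poly_Mapping.keys C \<subseteq> F" using supp by (auto simp: in_keys_iff lookup)
  have "is_pf_expansion K p A n r P C"
    unfolding is_pf_expansion_def
  proof (intro conjI allI ballI impI)
    show "Poly_Mapping.lookup C u \<in> K" for u
      unfolding lookup C'_def using P c_mem
      by (auto simp: mpolys_def intro!: sum_closed mult_closed prod_closed)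
    show "length u = p" if "u \<in> Poly_Mapping.keys C" for u using keys that by (auto simp: F_def)
    show "factor_ok (A i) (n i) (u ! i)" if "u \<in> Poly_Mapping.keys C" "i < p" for u i
      using keys that by (auto simp: F_def S_def intro: factor_ok_factors)
    fix x :: "complex list"
    assume x: "length x = p \<and> (\<forall>i<p. \<forall>j\<le>n i. x ! i + of_nat (r i) + of_nat j \<noteq> 0)"
    have "(\<Sum>u\<in>Poly_Mapping.keys C. Poly_Mapping.lookup C u * (\<Prod>i<p. factor_eval (r i) (u ! i) (x ! i))) =
        (\<Sum>u\<in>F. \<Sum>m\<in>Poly_Mapping.keys P. Poly_Mapping.lookup P m *
          (\<Prod>i<p. c m i (u ! i) * factor_eval (r i) (u ! i) (x ! i)))"
      by (subst sum_keys_superset[OF finF keys], unfold lookup, intro sum.cong)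
        (auto simp: C'_def F_def sum_distrib_right prod.distrib mult.assoc)
    also have "\<dots> = (\<Sum>m\<in>Poly_Mapping.keys P. Poly_Mapping.lookup P m *
        (\<Sum>u\<in>F. \<Prod>i<p. c m i (u ! i) * factor_eval (r i) (u ! i) (x ! i)))"
      unfolding sum_distrib_left by (rule sum.swap)
    also have "\<dots> = (\<Sum>m\<in>Poly_Mapping.keys P. Poly_Mapping.lookup P m *
        (\<Prod>i<p. \<Sum>v\<in>S i. c m i v * factor_eval (r i) v (x ! i)))"
    proof -
      have "(\<Sum>u\<in>F. \<Prod>i<p. c m i (u ! i) * factor_eval (r i) (u ! i) (x ! i)) =
          (\<Prod>i<p. \<Sum>v\<in>S i. c m i v * factor_eval (r i) v (x ! i))" for m
        unfolding F_def by (rule sum_prod_lists[where g = "\<lambda>i v. c m i v * factor_eval (r i) v (x ! i)"])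
      then show ?thesis by simp
    qed
    also have "\<dots> = (\<Sum>m\<in>Poly_Mapping.keys P. Poly_Mapping.lookup P m *
        (\<Prod>i<p. rfun (Poly_Mapping.lookup m i) (A i) (n i) (r i) (x ! i)))"
    proof (intro sum.cong refl arg_cong2[of _ _ _ _ "(*)"] prod.cong)
      fix m i assume m: "m \<in> Poly_Mapping.keys P" and i: "i \<in> {..<p}"
      have o: "x ! i \<in> off_poles (n i) (r i)" using x i by (auto simp: off_poles_def)
      show "(\<Sum>v\<in>S i. c m i v * factor_eval (r i) v (x ! i)) =
          rfun (Poly_Mapping.lookup m i) (A i) (n i) (r i) (x ! i)"
        unfolding c_eq[OF o] using sub[OF m, of i] i c_supp
        by (intro sum.mono_neutral_right) (auto simp: S_def finite_factors)
    qed
    also have "\<dots> = ratfun p A n r P x"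
      using ratfun_monomials[OF P] by simp
    finally show "ratfun p A n r P x = (\<Sum>u\<in>Poly_Mapping.keys C. Poly_Mapping.lookup C u *
        (\<Prod>i<p. factor_eval (r i) (u ! i) (x ! i)))" by simp
  qed
  then show ?thesis by (intro exI[of _ C] conjI) (simp_all add: lookup C'_def)
qed

end

section \<open>The representation\<close>

lemma card_nth_eq_count_list: "card {l. l < length s \<and> s ! l = x} = count_list s x"
  by (simp add: count_list_eq_length_filter length_filter_conv_card eq_commute conj_commute)

lemma has_sum_finite_sum:
  fixes f :: "'i \<Rightarrow> 'a \<Rightarrow> complex"
  shows "finite I \<Longrightarrow> (\<And>i. i \<in> I \<Longrightarrow> (f i has_sum a i) A) \<Longrightarrow>
    ((\<lambda>x. \<Sum>i\<in>I. f i x) has_sum (\<Sum>i\<in>I. a i)) A"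
  by (induction I rule: finite_induct) (auto intro: has_sum_add has_sum_0)

text \<open>The exponents of a monomial are at most the degrees of \<open>P\<close>, so the degree
  hypothesis is inherited by each monomial.\<close>

lemma defect_sum_ge:
  assumes m: "m \<in> Poly_Mapping.keys P"
    and deg: "(\<Sum>i<j. mdeg i P) \<le> ereal (real_of_int (deg_bound A n j))"
  shows "int j + 1 \<le> (\<Sum>l<j. int (A l * (n l + 1)) - int (Poly_Mapping.lookup m l))"
proof -
  have "ereal (real (Poly_Mapping.lookup m i)) \<le> mdeg i P" for i
    unfolding mdeg_def using m by (rule SUP_upper)
  then have "(\<Sum>i<j. ereal (real (Poly_Mapping.lookup m i))) \<le> (\<Sum>i<j. mdeg i P)"
    by (rule sum_mono)
  then have "(\<Sum>i<j. ereal (real (Poly_Mapping.lookup m i))) \<le> ereal (real_of_int (deg_bound A n j))"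
    using deg by (rule order_trans)
  then have "real_of_int (\<Sum>i<j. int (Poly_Mapping.lookup m i)) \<le> real_of_int (deg_bound A n j)"
    by simp
  then have "(\<Sum>i<j. int (Poly_Mapping.lookup m i)) \<le> deg_bound A n j"
    by (simp only: of_int_le_iff)
  then show ?thesis by (simp add: deg_bound_def sum_subtractf)
qed

theorem theorem2p3:
  fixes K :: "complex set" and p :: nat and A n r :: "nat \<Rightarrow> nat" and P :: mpoly
  assumes "subfield K (ring_of_type_algebra :: complex ring)"
    and "p \<ge> 1"
    and "P \<in> mpolys K p"
    and "\<forall>j\<in>{1..p}. (\<Sum>i<j. mdeg i P) \<le> ereal (real_of_int (deg_bound A n j))"
  shows "series_term p A n r P summable_on series_index p \<and>
    (\<exists>lam :: nat list \<Rightarrow>\<^sub>0 complex.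
       admissible_rep K p A n r P (infsum (series_term p A n r P) (series_index p)) lam \<and>
       (\<forall>s. length s = p \<and> (\<forall>x\<in>set s. 1 \<le> x) \<longrightarrow>
          Poly_Mapping.lookup lam s =
            (\<Sum>j\<in>{j. length j = p \<and> (\<forall>i<p. j ! i \<le> n i)}. pf_coeff K p A n r P s j)))"
proof -
  interpret complex_subfield K by (rule complex_subfieldI[OF assms(1)])
  define hy where "hy \<longleftrightarrow> (\<forall>i. Suc i < p \<longrightarrow> r i \<ge> r (Suc i) + n (Suc i) + 1)"
  let ?lk = "Poly_Mapping.lookup :: (nat \<Rightarrow>\<^sub>0 nat) \<Rightarrow> nat \<Rightarrow> nat"
  let ?P = "Poly_Mapping.lookup P"
  let ?\<delta> = "\<lambda>m i. int (?lk m i) - int (A i * (n i + 1))"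
  let ?I = "{i. i < p \<and> mdeg i P \<ge> ereal (real (A i * (n i + 1)) - 1)}"
  define Q where "Q m i c \<longleftrightarrow>
    (\<forall>u. c u \<in> K) \<and> (\<forall>u. u \<notin> pf_factors (A i) (n i) (?\<delta> m i) \<longrightarrow> c u = 0) \<and>
    (?\<delta> m i \<le> - 2 \<longrightarrow> (\<Sum>j\<le>n i. c (Pole j 1)) = 0) \<and>
    (\<forall>x\<in>off_poles (n i) (r i). rfun (?lk m i) (A i) (n i) (r i) x =
      (\<Sum>u\<in>pf_factors (A i) (n i) (?\<delta> m i). c u * factor_eval (r i) u x))" for m i c
  have "\<exists>c. Q m i c" for m i unfolding Q_def by (rule rfun_expansion_exists)
  \<comment> \<open>The same coefficients are used to expand the rational function and to sum the
    series; this is what makes the depth \<open>p\<close> part comparable with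
    \<open>pf_coeff\<close>.\<close>
  then obtain c where "\<And>m i. Q m i (c m i)" by metis
  then have c: "\<And>m i u. c m i u \<in> K"
    "\<And>m i u. u \<notin> pf_factors (A i) (n i) (?\<delta> m i) \<Longrightarrow> c m i u = 0"
    "\<And>m i. ?\<delta> m i \<le> - 2 \<Longrightarrow> (\<Sum>j\<le>n i. c m i (Pole j 1)) = 0"
    "\<And>m i x. x \<in> off_poles (n i) (r i) \<Longrightarrow> rfun (?lk m i) (A i) (n i) (r i) x =
      (\<Sum>u\<in>pf_factors (A i) (n i) (?\<delta> m i). c m i u * factor_eval (r i) u x)"
    unfolding Q_def by blast+
  obtain C where C: "is_pf_expansion K p A n r P C"
    and C_lookup: "\<And>u. length u = p \<Longrightarrow>
      Poly_Mapping.lookup C u = (\<Sum>m\<in>Poly_Mapping.keys P. ?P m * (\<Prod>i<p. c m i (u ! i)))"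
    using is_pf_expansion_monomials[OF assms(3) c(1,2,4)] by blast
  have N: "nested K hy p A n r (?lk m) (c m)" for m
  proof
    show "r (Suc i) + n (Suc i) + 1 \<le> r i" if hy "Suc i < p" for i using that by (auto simp: hy_def)
    show "c m i u \<in> K" for i u by (rule c(1))
    show "(\<Sum>j\<le>n i. c m i (Pole j 1)) = 0" if "?\<delta> m i \<le> - 2" for i by (rule c(3)[OF that])
    show "rfun (?lk m i) (A i) (n i) (r i) x =
        (\<Sum>u\<in>pf_factors (A i) (n i) (?\<delta> m i). c m i u * factor_eval (r i) u x)"
      if "\<And>j. j \<le> n i \<Longrightarrow> x + of_nat (r i) + of_nat j \<noteq> 0" for i x
      by (rule c(4)) (use that in \<open>auto simp: off_poles_def\<close>)
  qed
  define W where "W = nested.top_words A p 0"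
  define coef where "coef m w = nested.coef n (c m) w 0" for m w
  define f where "f m k = (\<Prod>l<p. rfun (?lk m l) (A l) (n l) (r l) (of_nat (k ! l)))"
    for m and k :: "nat list"
  define V where "V = {w. good hy p A w 0 \<and> length w < p \<and> count_list w 1 \<le> card ?I \<and>
    (w = [] \<or> 2 \<le> hd w)}"
  have dec: "int j + 1 \<le> (\<Sum>l<j. int (A l * (n l + 1)) - int (?lk m l))"
    if "m \<in> Poly_Mapping.keys P" "1 \<le> j" "j \<le> p" for m j
    using that assms(4) by (intro defect_sum_ge) auto
  have ones: "nested.ones p A n (?lk m) 0 \<le> card ?I" if m: "m \<in> Poly_Mapping.keys P" for m
    unfolding nested.ones_def[OF N]
  proof (intro card_mono subsetI)
    fix l assume "l \<in> {l. 0 \<le> l \<and> l < p \<and> int (A l * (n l + 1)) - int (?lk m l) \<le> 1}"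
    then have l: "l < p" "int (A l * (n l + 1)) - int (?lk m l) \<le> 1" by auto
    then have "real_of_int (int (A l * (n l + 1)) - int (?lk m l)) \<le> 1" by linarith
    then have "real (A l * (n l + 1)) - 1 \<le> real (?lk m l)" by simp
    then have "ereal (real (A l * (n l + 1)) - 1) \<le> ereal (real (?lk m l))"
      by (simp only: ereal_less_eq)
    also have "\<dots> \<le> mdeg l P" unfolding mdeg_def using m by (rule SUP_upper)
    finally show "l \<in> ?I" using l by simp
  qed simp
  have "\<exists>z. (f m has_sum ((\<Sum>w\<in>W. coef m w * mzv w) + z)) (series_index p) \<and> mzv_comb K V z"
    if m: "m \<in> Poly_Mapping.keys P" for m
  proof -
    note ns = nested.nested_sum[OF N assms(2) dec[OF m], folded f_def W_def coef_def]
    obtain z where z: "infsum (f m) (series_index p) = (\<Sum>w\<in>W. coef m w * mzv w) + z"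
      "mzv_comb K {w \<in> nested.words hy p A 0. length w < p \<and>
        count_list w 1 \<le> nested.ones p A n (?lk m) 0 \<and> (w = [] \<or> 2 \<le> hd w)} z"
      using ns(2) by blast
    have "mzv_comb K V z"
      by (rule mzv_comb_mono[OF z(2)])
        (use ones[OF m] in \<open>auto simp: V_def nested.words_def[OF N]\<close>)
    then show ?thesis using has_sum_infsum[OF ns(1)] z(1) by auto
  qed
  then obtain z where z: "\<And>m. m \<in> Poly_Mapping.keys P \<Longrightarrow>
      (f m has_sum ((\<Sum>w\<in>W. coef m w * mzv w) + z m)) (series_index p)"
    "\<And>m. m \<in> Poly_Mapping.keys P \<Longrightarrow> mzv_comb K V (z m)"
    by metis
  \<comment> \<open>The monomials share the set \<open>W\<close> of leading words, so their depth
    \<open>p\<close> coefficients are collected word by word.\<close>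
  define T where "T s = (if length s = p \<and> (\<forall>x\<in>set s. 1 \<le> x)
    then \<Sum>m\<in>Poly_Mapping.keys P. ?P m * coef m s else 0)" for s
  have coef_W: "s \<in> W" if "coef m s \<noteq> 0" "length s = p" "\<forall>x\<in>set s. 1 \<le> x" for m s
    using nested.coef_nz_top_words[OF N, of m s 0] that c(2)[of "Pole _ _"]
    unfolding W_def coef_def by (auto simp: factors_iff)
  have W_prop: "length s = p \<and> good hy p A s 0" if "s \<in> W" for s
    using nested.length_top_words[OF N, of s p 0] nested.top_words_good[OF N, of s p 0] that
    by (auto simp: W_def nested.words_def[OF N])
  have W_pos: "\<forall>x\<in>set s. 1 \<le> x" if "s \<in> W" for s
    using W_prop[OF that] by (intro good_pos) blast
  have finW: "finite W" unfolding W_def by (rule nested.finite_top_words[OF N])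
  \<comment> \<open>A nonzero total needs one monomial with a nonzero coefficient, and that monomial
    certifies convergence and the bound on ones for the word.\<close>
  have T_nz: "\<exists>m\<in>Poly_Mapping.keys P. coef m s \<noteq> 0 \<and> s \<in> W" if "T s \<noteq> 0" for s
  proof -
    have s: "length s = p" "\<forall>x\<in>set s. 1 \<le> x"
      and "(\<Sum>m\<in>Poly_Mapping.keys P. ?P m * coef m s) \<noteq> 0"
      using that by (auto simp: T_def split: if_splits)
    then obtain m where "m \<in> Poly_Mapping.keys P" "?P m * coef m s \<noteq> 0"
      using sum.not_neutral_contains_not_neutral by blast
    then show ?thesis using coef_W[of m s] s by auto
  qed
  define top where "top = Abs_poly_mapping T"
  have top: "Poly_Mapping.lookup top = T"
    unfolding top_def by (rule lookup_Abs_poly_mapping) (use T_nz finW in \<open>blast intro: finite_subset\<close>)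
  have keys_top: "Poly_Mapping.keys top \<subseteq> W" using T_nz by (auto simp: in_keys_iff top)
  have PK: "?P m \<in> K" for m using assms(3) by (simp add: mpolys_def)
  have "mzv_comb K V (\<Sum>m\<in>Poly_Mapping.keys P. ?P m * z m)"
    by (intro mzv_comb_sum mzv_comb_scale z PK)
  then obtain low where low: "\<forall>s. Poly_Mapping.lookup low s \<in> K" "Poly_Mapping.keys low \<subseteq> V"
    "(\<Sum>m\<in>Poly_Mapping.keys P. ?P m * z m) = (\<Sum>s\<in>Poly_Mapping.keys low. Poly_Mapping.lookup low s * mzv s)"
    unfolding mzv_comb_def by blast
  have "((\<lambda>k. \<Sum>m\<in>Poly_Mapping.keys P. ?P m * f m k) has_sum
      (\<Sum>m\<in>Poly_Mapping.keys P. ?P m * ((\<Sum>w\<in>W. coef m w * mzv w) + z m))) (series_index p)"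
    by (intro has_sum_finite_sum has_sum_cmult_right z) auto
  also have "(\<Sum>m\<in>Poly_Mapping.keys P. ?P m * ((\<Sum>w\<in>W. coef m w * mzv w) + z m)) =
      (\<Sum>s\<in>Poly_Mapping.keys (top + low). Poly_Mapping.lookup (top + low) s * mzv s)"
  proof -
    have "(\<Sum>m\<in>Poly_Mapping.keys P. ?P m * (\<Sum>w\<in>W. coef m w * mzv w)) = (\<Sum>w\<in>W. T w * mzv w)"
      unfolding sum_distrib_left
      by (subst sum.swap, intro sum.cong)
        (use W_prop W_pos in \<open>auto simp: T_def sum_distrib_right mult.assoc\<close>)
    then show ?thesis
      unfolding sum_keys_add low(3)[symmetric] sum_keys_superset[OF finW keys_top]
      by (simp add: distrib_left sum.distrib top)
  qed
  also have "((\<lambda>k. \<Sum>m\<in>Poly_Mapping.keys P. ?P m * f m k) has_sum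
      (\<Sum>s\<in>Poly_Mapping.keys (top + low). Poly_Mapping.lookup (top + low) s * mzv s)) (series_index p) \<longleftrightarrow>
      (series_term p A n r P has_sum
      (\<Sum>s\<in>Poly_Mapping.keys (top + low). Poly_Mapping.lookup (top + low) s * mzv s)) (series_index p)"
    by (rule has_sum_cong)
      (simp add: series_term_def ratfun_monomials[OF assms(3)] f_def series_index_def)
  finally have S: "(series_term p A n r P has_sum
      (\<Sum>s\<in>Poly_Mapping.keys (top + low). Poly_Mapping.lookup (top + low) s * mzv s)) (series_index p)" .
  have admissible_words: "good hy p A s 0 \<and> length s \<le> p \<and> count_list s 1 \<le> card ?I \<and> (s = [] \<or> 2 \<le> hd s)"
    if s: "s \<in> Poly_Mapping.keys (top + low)" for s
  proof (cases "s \<in> Poly_Mapping.keys top")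
    case True
    then obtain m where m: "m \<in> Poly_Mapping.keys P" "coef m s \<noteq> 0" "s \<in> W"
      using T_nz[of s] by (auto simp: in_keys_iff top)
    have "count_list s 1 \<le> nested.ones p A n (?lk m) 0"
      using nested.coef_nz_ones[OF N, of s p 0 m] m by (simp add: W_def coef_def)
    moreover have "2 \<le> hd s"
      using nested.coef_nz_hd[OF N, of s "p - 1" 0 m] m dec[OF m(1), of 1] assms(2)
      by (simp add: W_def coef_def)
    ultimately show ?thesis using W_prop[OF m(3)] ones[OF m(1)] by auto
  next
    case False
    then have "s \<in> V" using s low(2) Poly_Mapping.keys_add[of top low] by blast
    then show ?thesis by (auto simp: V_def)
  qed
  have TK: "T s \<in> K" for s
    using nested.coef_closed[OF N] unfolding T_def coef_def
    by (auto intro!: sum_closed mult_closed PK)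
  have "admissible_rep K p A n r P (infsum (series_term p A n r P) (series_index p)) (top + low)"
    unfolding admissible_rep_def
  proof (intro conjI allI ballI impI)
    show "Poly_Mapping.lookup (top + low) s \<in> K" for s
      using low(1) TK by (auto simp: lookup_add top intro: add_closed)
    show "infsum (series_term p A n r P) (series_index p) =
        (\<Sum>s\<in>Poly_Mapping.keys (top + low). Poly_Mapping.lookup (top + low) s * mzv s)"
      by (rule infsumI[OF S])
    fix s assume s: "s \<in> Poly_Mapping.keys (top + low)"
    note aw = admissible_words[OF s]
    show "index_ok p s"
      using aw good_pos[of hy p A s 0] by (cases s) (auto simp: index_ok_def)
    show "cond_a p A s" if "s \<noteq> []"
      using good_cond_a[of hy p A s 0] aw that unfolding cond_a_def by blast
    show "cond_b p A n r P s"
      unfolding cond_b_def hy_def[symmetric]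
    proof (intro impI conjI)
      assume hy
      then show "\<exists>h :: nat \<Rightarrow> nat. strict_mono_on {..<length s} h \<and>
          (\<forall>l<length s. h l < p \<and> 1 \<le> s ! l \<and> s ! l \<le> A (h l))"
        using good_embedding[of p A s 0] aw by auto
      show "card {l. l < length s \<and> s ! l = 1} \<le> card ?I"
        using aw by (simp only: card_nth_eq_count_list)
    qed
  qed
  moreover have "Poly_Mapping.lookup (top + low) s =
      (\<Sum>j\<in>{j. length j = p \<and> (\<forall>i<p. j ! i \<le> n i)}. pf_coeff K p A n r P s j)"
    if s: "length s = p \<and> (\<forall>x\<in>set s. 1 \<le> x)" for s
  proof -
    \<comment> \<open>Words of \<open>low\<close> are shorter than \<open>p\<close>, so
      \<open>top\<close> alone carries the depth \<open>p\<close> part.\<close>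
    have "s \<notin> Poly_Mapping.keys low" using low(2) s by (auto simp: V_def)
    then have "Poly_Mapping.lookup (top + low) s = (\<Sum>m\<in>Poly_Mapping.keys P. ?P m * coef m s)"
      using s by (simp add: lookup_add top T_def in_keys_iff)
    also have "\<dots> = (\<Sum>m\<in>Poly_Mapping.keys P. ?P m *
        (\<Sum>j | length j = p \<and> (\<forall>i<p. j ! i \<in> {..n i}). \<Prod>i<p. c m i (Pole (j ! i) (s ! i))))"
    proof -
      have "(\<Sum>j | length j = p \<and> (\<forall>i<p. j ! i \<in> {..n i}). \<Prod>i<p. c m i (Pole (j ! i) (s ! i))) =
          coef m s" for m
        unfolding coef_def nested.coef_prod[OF N]
          sum_prod_lists[where g = "\<lambda>i j. c m i (Pole j (s ! i))"] by (simp add: s)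
      then show ?thesis by simp
    qed
    also have "\<dots> = (\<Sum>j | length j = p \<and> (\<forall>i<p. j ! i \<in> {..n i}).
        \<Sum>m\<in>Poly_Mapping.keys P. ?P m * (\<Prod>i<p. c m i (Pole (j ! i) (s ! i))))"
      unfolding sum_distrib_left by (rule sum.swap)
    also have "\<dots> = (\<Sum>j | length j = p \<and> (\<forall>i<p. j ! i \<le> n i). pf_coeff K p A n r P s j)"
    proof (rule sum.cong)
      fix j assume j: "j \<in> {j. length j = p \<and> (\<forall>i<p. j ! i \<le> n i)}"
      have "(THE c. is_pf_expansion K p A n r P c) = C"
        using C pf_expansion_unique by (intro the_equality)
      then show "(\<Sum>m\<in>Poly_Mapping.keys P. ?P m * (\<Prod>i<p. c m i (Pole (j ! i) (s ! i)))) =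
          pf_coeff K p A n r P s j"
        using j s by (simp add: pf_coeff_def C_lookup)
    qed simp
    finally show ?thesis .
  qed
  ultimately show ?thesis using has_sum_imp_summable[OF S] by blast
qed

end
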